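(* Let $0<\varepsilon<1$ and let $\{(\mathbf u^n,r^n)\}_{1\le n\le N}$ and $\{(\mathbf u^n_\varepsilon,r^n_\varepsilon)\}_{1\le n\le N}$ be the solutions of Algorithm 1 and Algorithm 3 (described in the context), respectively, with time step $k=T/N$. Then there exists a constant $C>0$ (independent of $k$ and $\varepsilon$) such that $$\max_{1\le n\le N}\mathbb E\bigl[\|\mathbf u^n-\mathbf u^n_\varepsilon\|^2\bigr]+k\sum_{n=1}^N\mathbb E\bigl[\|\nabla(\mathbf u^n-\mathbf u^n_\varepsilon)\|^2+\varepsilon\|\nabla(r^n-r^n_\varepsilon)\|^2\bigr]\le C\varepsilon .$$
   Context: Setting. Let $d\in\{2,3\}$, $L,T>0$, $D=(0,L)^d$. The subscript "per" denotes functions that are periodic with period $L$ in each coordinate direction; $(\cdot,\cdot)$ and $\|\cdot\|$ are the $L^2(D)$ inner product and norm; spaces "$/\mathbb R$" are identified with mean-zero functions. Put $\mathbb V=\{\mathbf v\in H^1_{per}(D;\mathbb R^d):\operatorname{div}\mathbf v=0\}$. Let $(\Omega,\mathcal F,\{\mathcal F_t\},\mathbb P)$ be a filtered probability space with a continuous filtration, and $W$ a real-valued Wiener process on it. Data. $\mathbf u_0\in L^2(\Omega;\mathbb V\cap H^2_{per}(D;\mathbb R^d))$ is $\mathcal F_0$-measurable; $\mathbf f\in L^2(\Omega;C^{1/2}([0,T];H^1_{per}(D;\mathbb R^d)))$ is $\{\mathcal F_t\}$-adapted. The map $\mathbf B$ (taking $L^2(\Omega;H^1_{per}(D;\mathbb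 R^d))$ into itself) satisfies, for some constant $C>0$ and all $\mathbf v,\mathbf w\in L^2_{per}(D;\mathbb R^d)$: $\|\mathbf B(\mathbf v)-\mathbf B(\mathbf w)\|\le C\|\mathbf v-\mathbf w\|$, $\|\mathbf B(\mathbf v)\|\le C(1+\|\mathbf v\|)$, and $\|\mathcal D\mathbf B\|_*\le C$, where $\mathcal D\mathbf B$ is the Gateaux derivative of $\mathbf B$ and $\|\cdot\|_*$ its operator norm. Time mesh. $N\in\mathbb N$, $k=T/N$, $t_n=nk$, $\Delta_{n+1}W=W(t_{n+1})-W(t_n)$, $\mathbf f^{n+1}=\mathbf f(t_{n+1},\cdot)$. Algorithm 1. Let $\mathbf u^0=\mathbf u_0$. For $n=0,\dots,N-1$: (1) find $\xi^n\in L^2(\Omega;H^1_{per}(D)/\mathbb R)$ with $(\nabla\xi^n,\nabla\phi)=(\mathbf B(\mathbf u^n),\nabla\phi)$ for all $\phi\in H^1_{per}(D)$; (2) set $\boldsymbol\eta^n:=\mathbf B(\mathbf u^n)-\nabla\xi^n$ and find $(\mathbf u^{n+1},r^{n+1})\in L^2(\Omega;\mathbb V\times L^2_{per}(D)/\mathbb R)$ such that for all $\mathbf v\in H^1_{per}(D;\mathbb R^d)$, $q\in L^2_{per}(D)$, $$(\mathbf u^{n+1},\mathbf v)+k(\nabla\mathbf u^{n+1},\nabla\mathbf v)-k(\operatorname{div}\mathbf v,r^{n+1})=(\mathbf u^n,\mathbf v)+k(\mathbf f^{n+1},\mathbf v)+(\boldsymbol\eta^n\Delta_{n+1}W,\mathbf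 v),\qquad(\operatorname{div}\mathbf u^{n+1},q)=0.$$ Algorithm 3. Let $\mathbf u_\varepsilon^0=\mathbf u_0$. For $n=0,\dots,N-1$: (1) find $\xi_\varepsilon^n\in L^2(\Omega;H^1_{per}(D)/\mathbb R)$ with $(\nabla\xi_\varepsilon^n,\nabla\phi)=(\mathbf B(\mathbf u_\varepsilon^n),\nabla\phi)$ for all $\phi\in H^1_{per}(D)$; (2) set $\boldsymbol\eta_\varepsilon^n:=\mathbf B(\mathbf u_\varepsilon^n)-\nabla\xi_\varepsilon^n$ and find $(\mathbf u_\varepsilon^{n+1},r_\varepsilon^{n+1})\in L^2(\Omega;H^1_{per}(D;\mathbb R^d)\times H^1_{per}(D)/\mathbb R)$ such that for all $\mathbf v\in H^1_{per}(D;\mathbb R^d)$, $q\in H^1_{per}(D)$, $$(\mathbf u_\varepsilon^{n+1},\mathbf v)+k(\nabla\mathbf u_\varepsilon^{n+1},\nabla\mathbf v)-k(\operatorname{div}\mathbf v,r_\varepsilon^{n+1})=(\mathbf u_\varepsilon^n,\mathbf v)+k(\mathbf f^{n+1},\mathbf v)+(\boldsymbol\eta_\varepsilon^n\Delta_{n+1}W,\mathbf v),$$ $$(\operatorname{div}\mathbf u_\varepsilon^{n+1},q)+\varepsilon(\nabla r_\varepsilon^{n+1},\nabla q)=0.$$ Constants. $C$ is a generic positive constant that may depend on $T,\mathbf u_0,\mathbf f,D$ (and the fixed $\mathbf B$) but not on $k$ or $\varepsilon$. *)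

theory Defs
  imports "HOL-Probability.Probability"
begin

section \<open>Periodic Lebesgue and Sobolev spaces\<close>

text \<open>Elements of the function spaces are represented by periodic Borel functions on the whole of
  \<open>\<real>\<^sup>d\<close>; two functions with \<open>L2norm L (v - w) = 0\<close> represent the same element.\<close>

definition cell :: "real \<Rightarrow> (real^'d) set" where
  "cell L = box 0 (\<chi> i. L)"

definition periodic :: "real \<Rightarrow> (real^'d \<Rightarrow> 'b) \<Rightarrow> bool" where
  "periodic L v \<longleftrightarrow> (\<forall>x i. v (x + axis i L) = v x)"

definition L2per :: "real \<Rightarrow> (real^'d \<Rightarrow> 'b::euclidean_space) set" where
  "L2per L = {v. v \<in> borel_measurable borel \<and> periodic L v \<and>
                 set_integrable lborel (cell L) (\<lambda>x. (norm (v x))\<^sup>2)}"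

definition L2inner :: "real \<Rightarrow> (real^'d \<Rightarrow> 'b::euclidean_space) \<Rightarrow> (real^'d \<Rightarrow> 'b) \<Rightarrow> real" where
  "L2inner L v w = (LINT x:cell L|lborel. v x \<bullet> w x)"

definition L2norm :: "real \<Rightarrow> (real^'d \<Rightarrow> 'b::euclidean_space) \<Rightarrow> real" where
  "L2norm L v = sqrt (L2inner L v v)"

definition mean_zero :: "real \<Rightarrow> (real^'d \<Rightarrow> real) set" where
  "mean_zero L = {q. (LINT x:cell L|lborel. q x) = 0}"

definition pd :: "'d \<Rightarrow> (real^'d \<Rightarrow> real) \<Rightarrow> real^'d \<Rightarrow> real" where
  "pd i \<phi> x = frechet_derivative \<phi> (at x) (axis i 1)"

text \<open>Differentiability of all iterated partial derivatives amounts to \<open>C\<^sup>\<infinity>\<close>.\<close>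

definition smooth_per :: "real \<Rightarrow> (real^'d \<Rightarrow> real) set" where
  "smooth_per L = {\<phi>. periodic L \<phi> \<and> (\<forall>js. foldr pd js \<phi> differentiable_on UNIV)}"

definition has_weak_pd ::
  "real \<Rightarrow> 'd \<Rightarrow> (real^'d \<Rightarrow> 'b::euclidean_space) \<Rightarrow> (real^'d \<Rightarrow> 'b) \<Rightarrow> bool" where
  "has_weak_pd L i v g \<longleftrightarrow> v \<in> L2per L \<and> g \<in> L2per L \<and>
     (\<forall>\<phi>\<in>smooth_per L. (LINT x:cell L|lborel. pd i \<phi> x *\<^sub>R v x)
                       = - (LINT x:cell L|lborel. \<phi> x *\<^sub>R g x))"

text \<open>The weak partial derivative; meaningful (and unique up to null sets) if one exists.\<close>

definition wpd :: "real \<Rightarrow> 'd \<Rightarrow> (real^'d \<Rightarrow> 'b::euclidean_space) \<Rightarrow> real^'d \<Rightarrow> 'b" where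
  "wpd L i v = (SOME g. has_weak_pd L i v g)"

primrec Hper :: "real \<Rightarrow> nat \<Rightarrow> (real^'d \<Rightarrow> 'b::euclidean_space) set" where
  "Hper L 0 = L2per L"
| "Hper L (Suc m) = {v \<in> L2per L. \<forall>i. \<exists>g\<in>Hper L m. has_weak_pd L i v g}"

primrec Hnorm :: "real \<Rightarrow> nat \<Rightarrow> (real^'d \<Rightarrow> 'b::euclidean_space) \<Rightarrow> real" where
  "Hnorm L 0 v = L2norm L v"
| "Hnorm L (Suc m) v = sqrt ((L2norm L v)\<^sup>2 + (\<Sum>i\<in>UNIV. (Hnorm L m (wpd L i v))\<^sup>2))"

definition wgrad :: "real \<Rightarrow> (real^'d \<Rightarrow> real) \<Rightarrow> real^'d \<Rightarrow> real^'d" where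
  "wgrad L q x = (\<chi> i. wpd L i q x)"

definition wdiv :: "real \<Rightarrow> (real^'d \<Rightarrow> real^'d) \<Rightarrow> real^'d \<Rightarrow> real" where
  "wdiv L v x = (\<Sum>i\<in>UNIV. wpd L i v x $ i)"

definition grad_inner :: "real \<Rightarrow> (real^'d \<Rightarrow> real^'d) \<Rightarrow> (real^'d \<Rightarrow> real^'d) \<Rightarrow> real" where
  "grad_inner L v w = (\<Sum>i\<in>UNIV. L2inner L (wpd L i v) (wpd L i w))"

definition Vper :: "real \<Rightarrow> (real^'d \<Rightarrow> real^'d) set" where
  "Vper L = {v \<in> Hper L 1. AE x in lborel. wdiv L v x = 0}"

text \<open>Squared norms with values in \<open>[0,\<infinity>]\<close>, so that an upper bound on them carries the claim that the
  norm is finite. In particular \<open>grad_normsq\<close> is infinite unless the weak gradient exists in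
  \<open>L\<^sup>2\<close>.\<close>

definition normsq :: "real \<Rightarrow> (real^'d \<Rightarrow> 'b::euclidean_space) \<Rightarrow> ennreal" where
  "normsq L v = (\<integral>\<^sup>+x\<in>cell L. ennreal ((norm (v x))\<^sup>2) \<partial>lborel)"

definition grad_normsq :: "real \<Rightarrow> (real^'d \<Rightarrow> 'b::euclidean_space) \<Rightarrow> ennreal" where
  "grad_normsq L v = (if v \<in> Hper L 1 then \<Sum>i\<in>UNIV. normsq L (wpd L i v) else \<infinity>)"

text \<open>The Hoelder space \<open>C\<^sup>1\<^sup>/\<^sup>2([0,T]; H\<^sup>1)\<close> and its norm.\<close>

definition HoelderH1 :: "real \<Rightarrow> real \<Rightarrow> (real \<Rightarrow> real^'d \<Rightarrow> real^'d) set" where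
  "HoelderH1 L T = {g. (\<forall>t\<in>{0..T}. g t \<in> Hper L 1) \<and>
     (\<exists>K. \<forall>s\<in>{0..T}. \<forall>t\<in>{0..T}. Hnorm L 1 (g t - g s) \<le> K * sqrt \<bar>t - s\<bar>)}"

definition HoelderH1_norm :: "real \<Rightarrow> real \<Rightarrow> (real \<Rightarrow> real^'d \<Rightarrow> real^'d) \<Rightarrow> real" where
  "HoelderH1_norm L T g = (SUP t\<in>{0..T}. Hnorm L 1 (g t)) +
     (SUP (s, t)\<in>{(s, t). s \<in> {0..T} \<and> t \<in> {0..T} \<and> s \<noteq> t}.
        Hnorm L 1 (g t - g s) / sqrt \<bar>t - s\<bar>)"


section \<open>Random variables with values in function spaces\<close>

text \<open>Bochner's notion for a (semi)normed space \<open>(X, nrm)\<close>: \<open>u\<close> is almost surely the limit of simple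
  functions that are measurable with respect to the sub-\<open>\<sigma>\<close>-algebra \<open>G\<close> of \<open>M\<close>.\<close>

definition strongly_measurable ::
  "'a measure \<Rightarrow> 'a measure \<Rightarrow> 'x set \<Rightarrow> ('x::minus \<Rightarrow> real) \<Rightarrow> ('a \<Rightarrow> 'x) \<Rightarrow> bool" where
  "strongly_measurable M G X nrm u \<longleftrightarrow> (AE \<omega> in M. u \<omega> \<in> X) \<and>
     (\<exists>s :: nat \<Rightarrow> 'a \<Rightarrow> 'x. (\<forall>j. simple_function G (s j) \<and> s j ` space G \<subseteq> X) \<and>
        (AE \<omega> in M. (\<lambda>j. nrm (u \<omega> - s j \<omega>)) \<longlonglongrightarrow> 0))"

definition L2Omega :: "'a measure \<Rightarrow> 'x set \<Rightarrow> ('x::minus \<Rightarrow> real) \<Rightarrow> ('a \<Rightarrow> 'x) set" where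
  "L2Omega M X nrm = {u. strongly_measurable M M X nrm u \<and>
                          (\<integral>\<^sup>+\<omega>. ennreal ((nrm (u \<omega>))\<^sup>2) \<partial>M) < \<infinity>}"

definition continuous_filtration :: "'a measure \<Rightarrow> real \<Rightarrow> (real \<Rightarrow> 'a measure) \<Rightarrow> bool" where
  "continuous_filtration M T F \<longleftrightarrow>
     (\<forall>t\<in>{0..T}. subalgebra M (F t)) \<and>
     (\<forall>s t. 0 \<le> s \<and> s \<le> t \<and> t \<le> T \<longrightarrow> sets (F s) \<subseteq> sets (F t)) \<and>
     (\<forall>t\<in>{0..<T}. sets (F t) = (\<Inter>s\<in>{t<..T}. sets (F s))) \<and>
     (\<forall>t\<in>{0<..T}. sets (F t) = sigma_sets (space M) (\<Union>s\<in>{0..<t}. sets (F s)))"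

definition wiener_process ::
  "'a measure \<Rightarrow> real \<Rightarrow> (real \<Rightarrow> 'a measure) \<Rightarrow> (real \<Rightarrow> 'a \<Rightarrow> real) \<Rightarrow> bool" where
  "wiener_process M T F W \<longleftrightarrow>
     (\<forall>t\<in>{0..T}. W t \<in> borel_measurable (F t)) \<and>
     (AE \<omega> in M. W 0 \<omega> = 0) \<and>
     (AE \<omega> in M. continuous_on {0..T} (\<lambda>t. W t \<omega>)) \<and>
     (\<forall>s t. 0 \<le> s \<and> s < t \<and> t \<le> T \<longrightarrow>
        distributed M lborel (\<lambda>\<omega>. W t \<omega> - W s \<omega>) (normal_density 0 (sqrt (t - s))) \<and>
        prob_space.indep_set M (sets (F s))
          (sets (vimage_algebra (space M) (\<lambda>\<omega>. W t \<omega> - W s \<omega>) borel)))"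


section \<open>Data\<close>

definition initial_datum ::
  "'a measure \<Rightarrow> (real \<Rightarrow> 'a measure) \<Rightarrow> real \<Rightarrow> ('a \<Rightarrow> real^'d \<Rightarrow> real^'d) \<Rightarrow> bool" where
  "initial_datum M F L u0 \<longleftrightarrow>
     u0 \<in> L2Omega M (Vper L \<inter> Hper L 2) (Hnorm L 2) \<and>
     strongly_measurable M (F 0) (Vper L \<inter> Hper L 2) (Hnorm L 2) u0"

definition forcing ::
  "'a measure \<Rightarrow> (real \<Rightarrow> 'a measure) \<Rightarrow> real \<Rightarrow> real \<Rightarrow>
   ('a \<Rightarrow> real \<Rightarrow> real^'d \<Rightarrow> real^'d) \<Rightarrow> bool" where
  "forcing M F L T f \<longleftrightarrow>
     f \<in> L2Omega M (HoelderH1 L T) (HoelderH1_norm L T) \<and>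
     (\<forall>t\<in>{0..T}. strongly_measurable M (F t) (Hper L 1) (Hnorm L 1) (\<lambda>\<omega>. f \<omega> t))"

text \<open>\<open>A\<close> is the Gateaux derivative of \<open>B\<close> at \<open>v\<close> (as an operator on \<open>L\<^sup>2\<close>). Linearity is an identity
  in \<open>L\<^sup>2\<close>, hence up to null sets. Boundedness is expressed separately, via \<open>op_norm\<close>.\<close>

definition gateaux_derivative ::
  "real \<Rightarrow> ((real^'d \<Rightarrow> real^'d) \<Rightarrow> (real^'d \<Rightarrow> real^'d)) \<Rightarrow> (real^'d \<Rightarrow> real^'d) \<Rightarrow>
   ((real^'d \<Rightarrow> real^'d) \<Rightarrow> (real^'d \<Rightarrow> real^'d)) \<Rightarrow> bool" where
  "gateaux_derivative L B v A \<longleftrightarrow>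
     (\<forall>h\<in>L2per L. A h \<in> L2per L) \<and>
     (\<forall>g\<in>L2per L. \<forall>h\<in>L2per L. \<forall>a b.
        L2norm L (\<lambda>x. A (\<lambda>y. a *\<^sub>R g y + b *\<^sub>R h y) x - (a *\<^sub>R A g x + b *\<^sub>R A h x)) = 0) \<and>
     (\<forall>h\<in>L2per L.
        ((\<lambda>s. L2norm L (\<lambda>x. (B (\<lambda>y. v y + s *\<^sub>R h y) x - B v x) /\<^sub>R s - A h x)) \<longlongrightarrow> 0) (at 0))"

definition op_norm :: "real \<Rightarrow> ((real^'d \<Rightarrow> real^'d) \<Rightarrow> (real^'d \<Rightarrow> real^'d)) \<Rightarrow> ennreal" where
  "op_norm L A = (SUP h\<in>{h \<in> L2per L. L2norm L h \<le> 1}. ennreal (L2norm L (A h)))"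

definition noise_operator ::
  "'a measure \<Rightarrow> real \<Rightarrow> ((real^'d \<Rightarrow> real^'d) \<Rightarrow> (real^'d \<Rightarrow> real^'d)) \<Rightarrow> bool" where
  "noise_operator M L B \<longleftrightarrow>
     (\<forall>v\<in>L2per L. B v \<in> L2per L) \<and>
     (\<forall>v\<in>L2Omega M (Hper L 1) (Hnorm L 1). (\<lambda>\<omega>. B (v \<omega>)) \<in> L2Omega M (Hper L 1) (Hnorm L 1)) \<and>
     (\<exists>C>0.
        (\<forall>v\<in>L2per L. \<forall>w\<in>L2per L. L2norm L (B v - B w) \<le> C * L2norm L (v - w)) \<and>
        (\<forall>v\<in>L2per L. L2norm L (B v) \<le> C * (1 + L2norm L v)) \<and>
        (\<forall>v\<in>L2per L. \<exists>A. gateaux_derivative L B v A \<and> op_norm L A \<le> ennreal C))"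


section \<open>The two algorithms\<close>

definition helmholtz_potential ::
  "'a measure \<Rightarrow> real \<Rightarrow> ('a \<Rightarrow> real^'d \<Rightarrow> real^'d) \<Rightarrow> ('a \<Rightarrow> real^'d \<Rightarrow> real) \<Rightarrow> bool" where
  "helmholtz_potential M L g \<xi> \<longleftrightarrow>
     \<xi> \<in> L2Omega M (Hper L 1 \<inter> mean_zero L) (Hnorm L 1) \<and>
     (AE \<omega> in M. \<forall>\<phi>\<in>Hper L 1. L2inner L (wgrad L (\<xi> \<omega>)) (wgrad L \<phi>) = L2inner L (g \<omega>) (wgrad L \<phi>))"

text \<open>The momentum equation with time step \<open>k\<close>, old and new velocities \<open>u\<close> and \<open>u'\<close>, new pressure
  \<open>r'\<close>, new force \<open>g\<close>, projected noise coefficient \<open>\<eta>\<close> and Wiener increment \<open>dW\<close>.\<close>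

definition momentum_eq ::
  "real \<Rightarrow> real \<Rightarrow> (real^'d \<Rightarrow> real^'d) \<Rightarrow> (real^'d \<Rightarrow> real^'d) \<Rightarrow> (real^'d \<Rightarrow> real) \<Rightarrow>
   (real^'d \<Rightarrow> real^'d) \<Rightarrow> (real^'d \<Rightarrow> real^'d) \<Rightarrow> real \<Rightarrow> bool" where
  "momentum_eq L k u u' r' g \<eta> dW \<longleftrightarrow>
     (\<forall>v\<in>Hper L 1.
        L2inner L u' v + k * grad_inner L u' v - k * L2inner L (wdiv L v) r'
        = L2inner L u v + k * L2inner L g v + L2inner L (\<lambda>x. dW *\<^sub>R \<eta> x) v)"

definition algorithm1 ::
  "'a measure \<Rightarrow> real \<Rightarrow> real \<Rightarrow> (real \<Rightarrow> 'a \<Rightarrow> real) \<Rightarrow>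
   ('a \<Rightarrow> real^'d \<Rightarrow> real^'d) \<Rightarrow> ('a \<Rightarrow> real \<Rightarrow> real^'d \<Rightarrow> real^'d) \<Rightarrow>
   ((real^'d \<Rightarrow> real^'d) \<Rightarrow> (real^'d \<Rightarrow> real^'d)) \<Rightarrow> nat \<Rightarrow>
   (nat \<Rightarrow> 'a \<Rightarrow> real^'d \<Rightarrow> real^'d) \<Rightarrow> (nat \<Rightarrow> 'a \<Rightarrow> real^'d \<Rightarrow> real) \<Rightarrow> bool" where
  "algorithm1 M L T W u0 f B N u r \<longleftrightarrow>
     (let k = T / real N; t = (\<lambda>n. real n * k) in
      u 0 = u0 \<and>
      (\<forall>n<N. \<exists>\<xi>. helmholtz_potential M L (\<lambda>\<omega>. B (u n \<omega>)) \<xi> \<and>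
        u (Suc n) \<in> L2Omega M (Vper L) (Hnorm L 1) \<and>
        r (Suc n) \<in> L2Omega M (L2per L \<inter> mean_zero L) (L2norm L) \<and>
        (AE \<omega> in M.
           momentum_eq L k (u n \<omega>) (u (Suc n) \<omega>) (r (Suc n) \<omega>) (f \<omega> (t (Suc n)))
             (B (u n \<omega>) - wgrad L (\<xi> \<omega>)) (W (t (Suc n)) \<omega> - W (t n) \<omega>) \<and>
           (\<forall>q\<in>L2per L. L2inner L (wdiv L (u (Suc n) \<omega>)) q = 0))))"

definition algorithm3 ::
  "'a measure \<Rightarrow> real \<Rightarrow> real \<Rightarrow> (real \<Rightarrow> 'a \<Rightarrow> real) \<Rightarrow>
   ('a \<Rightarrow> real^'d \<Rightarrow> real^'d) \<Rightarrow> ('a \<Rightarrow> real \<Rightarrow> real^'d \<Rightarrow> real^'d) \<Rightarrow>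
   ((real^'d \<Rightarrow> real^'d) \<Rightarrow> (real^'d \<Rightarrow> real^'d)) \<Rightarrow> nat \<Rightarrow> real \<Rightarrow>
   (nat \<Rightarrow> 'a \<Rightarrow> real^'d \<Rightarrow> real^'d) \<Rightarrow> (nat \<Rightarrow> 'a \<Rightarrow> real^'d \<Rightarrow> real) \<Rightarrow> bool" where
  "algorithm3 M L T W u0 f B N \<epsilon> u r \<longleftrightarrow>
     (let k = T / real N; t = (\<lambda>n. real n * k) in
      u 0 = u0 \<and>
      (\<forall>n<N. \<exists>\<xi>. helmholtz_potential M L (\<lambda>\<omega>. B (u n \<omega>)) \<xi> \<and>
        u (Suc n) \<in> L2Omega M (Hper L 1) (Hnorm L 1) \<and>
        r (Suc n) \<in> L2Omega M (Hper L 1 \<inter> mean_zero L) (Hnorm L 1) \<and>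
        (AE \<omega> in M.
           momentum_eq L k (u n \<omega>) (u (Suc n) \<omega>) (r (Suc n) \<omega>) (f \<omega> (t (Suc n)))
             (B (u n \<omega>) - wgrad L (\<xi> \<omega>)) (W (t (Suc n)) \<omega> - W (t n) \<omega>) \<and>
           (\<forall>q\<in>Hper L 1. L2inner L (wdiv L (u (Suc n) \<omega>)) q
                + \<epsilon> * L2inner L (wgrad L (r (Suc n) \<omega>)) (wgrad L q) = 0))))"

end

theory Submission
  imports Defs
begin

text \<open>
  Write \<open>e = u - u\<^sub>\<epsilon>\<close> and \<open>p = r - r\<^sub>\<epsilon>\<close>. Testing the difference of the two momentum equations with
  \<open>e\<^sup>n\<^sup>+\<^sup>1\<close> and the difference of the two divergence constraints with \<open>p\<^sup>n\<^sup>+\<^sup>1\<close> gives an energy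
  identity whose only consistency error is \<open>k \<epsilon> (\<nabla>r\<^sup>n\<^sup>+\<^sup>1, \<nabla>p\<^sup>n\<^sup>+\<^sup>1)\<close>. This needs an \<open>H\<^sup>1\<close> bound on the
  pressure of the unpenalized scheme, which is only assumed to be in \<open>L\<^sup>2\<close>. Testing its momentum
  equation with gradients of trigonometric functions eliminates the velocities and, since the noise
  coefficient is a Helmholtz projection, also the noise. What remains is the very weak form of
  \<open>\<Delta>r = div f\<close> on the torus, and a Fourier series argument (Riesz-Fischer) gives \<open>r \<in> H\<^sup>1\<close> with
  \<open>\<parallel>\<nabla>r\<parallel> \<le> \<parallel>f\<parallel>\<close>.

  In the noise term, \<open>\<Delta>W (\<eta> - \<eta>\<^sub>\<epsilon>, e\<^sup>n\<^sup>+\<^sup>1 - e\<^sup>n)\<close> is absorbed by \<open>\<parallel>e\<^sup>n\<^sup>+\<^sup>1 - e\<^sup>n\<parallel>\<^sup>2\<close>, while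
  \<open>\<Delta>W (\<eta> - \<eta>\<^sub>\<epsilon>, e\<^sup>n)\<close> has expectation zero because the iterates are adapted. Adaptedness is not part of
  the algorithms; it follows since each step depends on its data in a Lipschitz manner. The discrete
  Gronwall lemma concludes.
\<close>

section \<open>The space of square integrable periodic functions\<close>

text \<open>Young's inequality splits the consistency error: one part is absorbed by the dissipation
  of \<open>p\<close>, the other is bounded by \<open>k * \<epsilon>\<close> times the squared norm
  of the force. A power of \<open>1 / k\<close> or a trace of the noise in the pressure bound would
  destroy the rate. This is why the pressure is estimated sample point by sample point, with test
  fields that remove the velocities and the noise exactly. The constant is
  \<open>2 * exp (C^2 * T) * T * forcing_bound\<close>: a step of length \<open>k\<close> amplifies
  the squared error by \<open>1 + k * C^2\<close>, because the squared increment has mean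
  \<open>k\<close>, and the initial error is zero. Fields are functions rather than classes and
  \<open>wpd\<close> is a choice, so derivatives are additive only almost everywhere; such relations
  are used under the integral. Hartley functions avoid both complex values and separate sine and
  cosine families. Random inner products are likewise replaced by measurable versions.\<close>

definition cell_measure :: "real \<Rightarrow> (real^'d) measure" where
  "cell_measure L = restrict_space lborel (cell L)"

lemma cell_sets [measurable, simp]: "cell L \<in> sets borel"
  by (simp add: cell_def)

lemma space_cell_measure: "space (cell_measure L) = cell L"
  by (simp add: cell_measure_def space_restrict_space)

lemma borel_measurable_cell_measure:
  "v \<in> borel_measurable borel \<Longrightarrow> v \<in> borel_measurable (cell_measure L)"
  unfolding cell_measure_def by (intro measurable_restrict_space1) simp

lemma set_integrable_cell_iff:
  fixes g :: "real^'d \<Rightarrow> 'b::euclidean_space"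
  shows "set_integrable lborel (cell L) g \<longleftrightarrow> integrable (cell_measure L) g"
  unfolding cell_measure_def set_integrable_def
  by (subst integrable_restrict_space) auto

lemma set_integral_cell_eq:
  fixes g :: "real^'d \<Rightarrow> 'b::euclidean_space"
  shows "(LINT x:cell L|lborel. g x) = integral\<^sup>L (cell_measure L) g"
  unfolding cell_measure_def set_lebesgue_integral_def
  by (subst integral_restrict_space) auto

lemma finite_measure_cell_measure: "finite_measure (cell_measure L :: (real^'d) measure)"
proof
  show "emeasure (cell_measure L :: (real^'d) measure) (space (cell_measure L)) \<noteq> \<infinity>"
    unfolding space_cell_measure unfolding cell_measure_def
    by (subst emeasure_restrict_space) (auto simp: cell_def emeasure_lborel_box_eq)
qed

lemma AE_lborel_cell_measure: "(AE x in lborel. P x) \<Longrightarrow> (AE x in cell_measure L. P x)"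
  unfolding cell_measure_def by (subst AE_restrict_space_iff) auto

lemma L2per_iff:
  "v \<in> L2per L \<longleftrightarrow> v \<in> borel_measurable borel \<and> periodic L v \<and>
     integrable (cell_measure L) (\<lambda>x. (norm (v x))\<^sup>2)"
  unfolding L2per_def set_integrable_cell_iff by simp

lemma L2inner_eq: "L2inner L v w = (\<integral>x. v x \<bullet> w x \<partial>cell_measure L)"
  unfolding L2inner_def set_integral_cell_eq ..

lemma L2per_measurable: "v \<in> L2per L \<Longrightarrow> v \<in> borel_measurable (cell_measure L)"
  by (auto simp: L2per_iff intro: borel_measurable_cell_measure)

lemma L2per_integrable_inner:
  fixes v w :: "real^'d \<Rightarrow> 'b::euclidean_space"
  assumes "v \<in> L2per L" "w \<in> L2per L"
  shows "integrable (cell_measure L) (\<lambda>x. v x \<bullet> w x)"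
proof (rule Bochner_Integration.integrable_bound)
  show "integrable (cell_measure L) (\<lambda>x. (norm (v x))\<^sup>2 + (norm (w x))\<^sup>2)"
    using assms by (auto simp: L2per_iff)
  show "(\<lambda>x. v x \<bullet> w x) \<in> borel_measurable (cell_measure L)"
    using assms[THEN L2per_measurable] by measurable
  have "\<bar>v x \<bullet> w x\<bar> \<le> (norm (v x))\<^sup>2 + (norm (w x))\<^sup>2" for x
  proof -
    have "\<bar>v x \<bullet> w x\<bar> \<le> norm (v x) * norm (w x)" by (rule Cauchy_Schwarz_ineq2)
    moreover have "2 * (norm (v x) * norm (w x)) \<le> (norm (v x))\<^sup>2 + (norm (w x))\<^sup>2"
      using sum_squares_bound[of "norm (v x)" "norm (w x)"] by simp
    ultimately show ?thesis using mult_nonneg_nonneg[OF norm_ge_zero norm_ge_zero, of "v x" "w x"] by linarith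
  qed
  then show "AE x in cell_measure L. norm (v x \<bullet> w x) \<le> norm ((norm (v x))\<^sup>2 + (norm (w x))\<^sup>2)"
    by simp
qed

lemma periodic_add: "periodic L v \<Longrightarrow> periodic L w \<Longrightarrow> periodic L (\<lambda>x. v x + w x)"
  and periodic_scaleR: "periodic L v \<Longrightarrow> periodic L (\<lambda>x. c *\<^sub>R v x)"
  for v w :: "real^'d \<Rightarrow> 'b::euclidean_space"
  by (simp_all add: periodic_def)

lemma L2per_scaleR: "v \<in> L2per L \<Longrightarrow> (\<lambda>x. c *\<^sub>R v x) \<in> L2per L"
  by (auto simp: L2per_iff periodic_scaleR power_mult_distrib)

lemma L2per_add:
  fixes v w :: "real^'d \<Rightarrow> 'b::euclidean_space"
  assumes "v \<in> L2per L" "w \<in> L2per L"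
  shows "(\<lambda>x. v x + w x) \<in> L2per L"
proof -
  have "(norm (v x + w x))\<^sup>2 = (norm (v x))\<^sup>2 + 2 * (v x \<bullet> w x) + (norm (w x))\<^sup>2" for x
    unfolding power2_norm_eq_inner by (simp add: inner_simps inner_commute)
  moreover have "integrable (cell_measure L) (\<lambda>x. (norm (v x))\<^sup>2 + 2 * (v x \<bullet> w x) + (norm (w x))\<^sup>2)"
    using assms L2per_integrable_inner[OF assms] by (auto simp: L2per_iff)
  ultimately show ?thesis
    using assms by (auto simp: L2per_iff periodic_add)
qed

lemma L2per_minus: "v \<in> L2per L \<Longrightarrow> (\<lambda>x. - v x) \<in> L2per L"
  using L2per_scaleR[of v L "-1"] by simp

lemma L2per_diff: "v \<in> L2per L \<Longrightarrow> w \<in> L2per L \<Longrightarrow> (\<lambda>x. v x - w x) \<in> L2per L"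
  using L2per_add[OF _ L2per_minus, of v L w] by simp

lemma L2per_diff': "v \<in> L2per L \<Longrightarrow> w \<in> L2per L \<Longrightarrow> v - w \<in> L2per L"
  using L2per_diff[of v L w] by (simp add: fun_diff_def)

lemma L2per_zero [simp]: "(\<lambda>x. 0) \<in> L2per L"
  by (simp add: L2per_iff periodic_def)

lemma L2per_sum: "(\<And>i. i \<in> A \<Longrightarrow> v i \<in> L2per L) \<Longrightarrow> (\<lambda>x. \<Sum>i\<in>A. v i x) \<in> L2per L"
  by (induction A rule: infinite_finite_induct) (auto intro: L2per_add)

lemma L2per_bounded:
  fixes v :: "real^'d \<Rightarrow> 'b::euclidean_space"
  assumes "v \<in> borel_measurable borel" "periodic L v" "\<And>x. x \<in> cell L \<Longrightarrow> norm (v x) \<le> K"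
  shows "v \<in> L2per L"
proof -
  interpret finite_measure "cell_measure L :: (real^'d) measure" by (rule finite_measure_cell_measure)
  have "(norm (v x))\<^sup>2 \<le> K\<^sup>2" if "x \<in> cell L" for x
    using assms(3)[OF that] by (intro power_mono) auto
  then have "integrable (cell_measure L) (\<lambda>x. (norm (v x))\<^sup>2)"
    using borel_measurable_cell_measure[OF assms(1), of L]
    by (intro integrable_const_bound[where B="K\<^sup>2"]) (auto simp: space_cell_measure intro!: AE_I2)
  then show ?thesis using assms by (simp add: L2per_iff)
qed

lemma L2per_inner:
  fixes v :: "real^'d \<Rightarrow> 'b::euclidean_space"
  assumes "v \<in> L2per L" shows "(\<lambda>x. v x \<bullet> b) \<in> L2per L"
proof -
  have m: "(\<lambda>x. v x \<bullet> b) \<in> borel_measurable borel" using assms by (auto simp: L2per_iff)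
  have "integrable (cell_measure L) (\<lambda>x. (norm (v x \<bullet> b))\<^sup>2)"
  proof (rule Bochner_Integration.integrable_bound)
    show "integrable (cell_measure L) (\<lambda>x. (norm b)\<^sup>2 * (norm (v x))\<^sup>2)" using assms by (simp add: L2per_iff)
    show "(\<lambda>x. (norm (v x \<bullet> b))\<^sup>2) \<in> borel_measurable (cell_measure L)"
      using borel_measurable_cell_measure[OF m] by measurable
    show "AE x in cell_measure L. norm ((norm (v x \<bullet> b))\<^sup>2) \<le> norm ((norm b)\<^sup>2 * (norm (v x))\<^sup>2)"
    proof (rule AE_I2)
      fix x
      have "(norm (v x \<bullet> b))\<^sup>2 \<le> (norm b * norm (v x))\<^sup>2"
        using Cauchy_Schwarz_ineq2[of "v x" b] by (intro power_mono) (auto simp: mult.commute)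
      then show "norm ((norm (v x \<bullet> b))\<^sup>2) \<le> norm ((norm b)\<^sup>2 * (norm (v x))\<^sup>2)"
        by (simp add: power_mult_distrib)
    qed
  qed
  then show ?thesis using assms m by (auto simp: L2per_iff periodic_def)
qed

lemma L2per_nth:
  fixes v :: "real^'d \<Rightarrow> real^'n"
  shows "v \<in> L2per L \<Longrightarrow> (\<lambda>x. v x $ j) \<in> L2per L"
  using L2per_inner[of v L "axis j 1"] by (simp add: inner_axis)

lemma L2per_vec:
  fixes v :: "'n::finite \<Rightarrow> real^'d \<Rightarrow> real"
  assumes "\<And>j. v j \<in> L2per L" shows "(\<lambda>x. \<chi> j. v j x) \<in> L2per L"
proof -
  have m: "(\<lambda>x. \<chi> j. v j x) \<in> borel_measurable borel"
    using assms unfolding L2per_iff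
    by (subst borel_measurable_euclidean_space) (auto simp: Basis_vec_def inner_axis)
  show ?thesis
    using assms m unfolding L2per_iff
    by (auto simp: periodic_def norm_vec_def L2_set_def sum_nonneg)
qed

section \<open>Bilinearity, Cauchy-Schwarz and triangle inequality for the L2 seminorm\<close>

lemma L2inner_commute: "L2inner L v w = L2inner L w v"
  by (simp add: L2inner_eq inner_commute)

lemma L2inner_add_left:
  "v \<in> L2per L \<Longrightarrow> w \<in> L2per L \<Longrightarrow> z \<in> L2per L \<Longrightarrow>
    L2inner L (\<lambda>x. v x + w x) z = L2inner L v z + L2inner L w z"
  unfolding L2inner_eq inner_add_left by (intro Bochner_Integration.integral_add L2per_integrable_inner)

lemma L2inner_scaleR_left: "L2inner L (\<lambda>x. c *\<^sub>R v x) w = c * L2inner L v w"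
  by (simp add: L2inner_eq)

lemma L2inner_diff_left:
  "v \<in> L2per L \<Longrightarrow> w \<in> L2per L \<Longrightarrow> z \<in> L2per L \<Longrightarrow>
    L2inner L (v - w) z = L2inner L v z - L2inner L w z"
  unfolding L2inner_eq minus_apply inner_diff_left
  by (intro Bochner_Integration.integral_diff L2per_integrable_inner)

lemma L2inner_diff_right:
  "v \<in> L2per L \<Longrightarrow> w \<in> L2per L \<Longrightarrow> z \<in> L2per L \<Longrightarrow>
    L2inner L z (v - w) = L2inner L z v - L2inner L z w"
  using L2inner_diff_left[of v L w z] by (simp add: L2inner_commute)

lemma L2inner_sum_left:
  "(\<And>i. i \<in> A \<Longrightarrow> v i \<in> L2per L) \<Longrightarrow> w \<in> L2per L \<Longrightarrow>
    L2inner L (\<lambda>x. \<Sum>i\<in>A. v i x) w = (\<Sum>i\<in>A. L2inner L (v i) w)"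
  unfolding L2inner_eq inner_sum_left
  by (intro Bochner_Integration.integral_sum L2per_integrable_inner)

lemma L2inner_vec:
  fixes v w :: "real^'d \<Rightarrow> real^'n"
  assumes "v \<in> L2per L" "w \<in> L2per L"
  shows "L2inner L v w = (\<Sum>j\<in>UNIV. L2inner L (\<lambda>x. v x $ j) (\<lambda>x. w x $ j))"
  unfolding L2inner_eq inner_vec_def
  by (intro Bochner_Integration.integral_sum)
     (use L2per_integrable_inner[OF L2per_nth[OF assms(1)] L2per_nth[OF assms(2)]] in auto)

lemma L2inner_self_nonneg [simp]: "0 \<le> L2inner L v v"
  unfolding L2inner_eq by (intro integral_nonneg_AE) auto

lemma L2norm_nonneg [simp]: "0 \<le> L2norm L v"
  by (simp add: L2norm_def)

lemma L2norm_sq: "(L2norm L v)\<^sup>2 = L2inner L v v"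
  by (simp add: L2norm_def)

lemma L2norm_scaleR: "L2norm L (\<lambda>x. c *\<^sub>R v x) = \<bar>c\<bar> * L2norm L v"
  by (simp add: L2norm_def L2inner_eq real_sqrt_mult power2_eq_square[symmetric] mult.assoc[symmetric])

lemma L2norm_minus: "L2norm L (\<lambda>x. - v x) = L2norm L v"
  by (simp add: L2norm_def L2inner_eq)

lemma L2norm_minus_commute: "L2norm L (v - w) = L2norm L (w - v)"
  using L2norm_minus[of L "v - w"] by (simp add: fun_diff_def)

lemma L2norm_zero [simp]: "L2norm L (\<lambda>x. 0) = 0"
  by (simp add: L2norm_def L2inner_eq)

lemma L2norm_sq_diff:
  assumes "v \<in> L2per L" "w \<in> L2per L"
  shows "(L2norm L (v - w))\<^sup>2 = (L2norm L v)\<^sup>2 - 2 * L2inner L v w + (L2norm L w)\<^sup>2"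
  unfolding L2norm_sq using assms
  by (simp add: L2inner_diff_left L2inner_diff_right L2per_diff' L2inner_commute)

text \<open>\<open>L2norm\<close> is only a seminorm on functions. The inequality is read off from a
  nonnegative quadratic form in \<open>s\<close> and \<open>t\<close>, and vanishing norms need a
  separate case.\<close>

lemma L2_Cauchy_Schwarz:
  assumes "v \<in> L2per L" "w \<in> L2per L"
  shows "\<bar>L2inner L v w\<bar> \<le> L2norm L v * L2norm L w"
proof -
  define a b c where "a = L2norm L v" and "b = L2norm L w" and "c = L2inner L v w"
  have q: "2 * s * t * c \<le> s\<^sup>2 * a\<^sup>2 + t\<^sup>2 * b\<^sup>2" for s t
  proof -
    have "0 \<le> (L2norm L ((\<lambda>x. s *\<^sub>R v x) - (\<lambda>x. t *\<^sub>R w x)))\<^sup>2" by simp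
    also have "\<dots> = s\<^sup>2 * a\<^sup>2 - 2 * s * t * c + t\<^sup>2 * b\<^sup>2"
      using assms
      by (subst L2norm_sq_diff)
         (auto intro: L2per_scaleR simp: L2norm_scaleR power_mult_distrib L2inner_scaleR_left
           L2inner_commute[of L v] a_def b_def c_def)
    finally show ?thesis by simp
  qed
  have nn: "0 \<le> a" "0 \<le> b" by (auto simp: a_def b_def)
  have "c\<^sup>2 \<le> a\<^sup>2 * b\<^sup>2"
  proof (cases "b = 0")
    case True
    have "c = 0"
    proof (rule ccontr)
      assume "c \<noteq> 0"
      \<comment> \<open>With \<open>b = 0\<close> the upper bound does not depend on
        \<open>t\<close>, and \<open>t = (a^2 + 1) / c\<close> pushes the left-hand side beyond
        it.\<close>
      have "2 * (a\<^sup>2 + 1) / c * c \<le> a\<^sup>2"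
        using q[of 1 "(a\<^sup>2 + 1) / c"] True by simp
      then show False using \<open>c \<noteq> 0\<close> by simp (smt (verit) zero_le_power2)
    qed
    then show ?thesis by simp
  next
    case False
    \<comment> \<open>The ratio \<open>t / s = c / b^2\<close> is the optimal one; this scaling
      avoids division.\<close>
    have "2 * b\<^sup>2 * c * c \<le> (b\<^sup>2)\<^sup>2 * a\<^sup>2 + c\<^sup>2 * b\<^sup>2" using q[of "b\<^sup>2" c] by simp
    then have "b\<^sup>2 * c\<^sup>2 \<le> b\<^sup>2 * (a\<^sup>2 * b\<^sup>2)" by (simp add: power2_eq_square algebra_simps)
    then show ?thesis using False by simp
  qed
  then have "c\<^sup>2 \<le> (a * b)\<^sup>2" by (simp add: power_mult_distrib)
  then show ?thesis using nn unfolding a_def[symmetric] b_def[symmetric] c_def[symmetric]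
    using abs_le_square_iff[of c "a*b"] by simp
qed

lemma L2norm_triangle:
  assumes "v \<in> L2per L" "w \<in> L2per L"
  shows "L2norm L (\<lambda>x. v x + w x) \<le> L2norm L v + L2norm L w"
proof (rule power2_le_imp_le)
  have "(L2norm L (\<lambda>x. v x + w x))\<^sup>2 = (L2norm L v)\<^sup>2 + 2 * L2inner L v w + (L2norm L w)\<^sup>2"
    using L2norm_sq_diff[OF assms(1) L2per_minus[OF assms(2)]] L2inner_scaleR_left[of L "-1" w v]
    by (simp add: fun_diff_def L2norm_minus L2inner_commute[of L v])
  also have "\<dots> \<le> (L2norm L v + L2norm L w)\<^sup>2"
    using L2_Cauchy_Schwarz[OF assms] by (simp add: power2_sum)
  finally show "(L2norm L (\<lambda>x. v x + w x))\<^sup>2 \<le> (L2norm L v + L2norm L w)\<^sup>2" .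
qed simp

lemma L2norm_triangle_diff:
  assumes "v \<in> L2per L" "w \<in> L2per L" "z \<in> L2per L"
  shows "L2norm L (v - w) \<le> L2norm L (v - z) + L2norm L (z - w)"
  using L2norm_triangle[OF L2per_diff'[OF assms(1,3)] L2per_diff'[OF assms(3,2)]]
  by (simp add: fun_diff_def)

lemma L2norm_sq_diff_le:
  assumes "v \<in> L2per L" "w \<in> L2per L"
  shows "(L2norm L (v - w))\<^sup>2 \<le> 2 * (L2norm L v)\<^sup>2 + 2 * (L2norm L w)\<^sup>2"
proof -
  have "- 2 * L2inner L v w \<le> 2 * (L2norm L v * L2norm L w)"
    using L2_Cauchy_Schwarz[OF assms] by linarith
  also have "\<dots> \<le> (L2norm L v)\<^sup>2 + (L2norm L w)\<^sup>2"
    using sum_squares_bound[of "L2norm L v" "L2norm L w"] by simp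
  finally show ?thesis using L2norm_sq_diff[OF assms] by simp
qed

text \<open>This replaces passing to equivalence classes: almost everywhere identities between
  chosen weak derivatives enter the estimates through it.\<close>

lemma L2inner_cong_AE:
  assumes "v \<in> L2per L" "v' \<in> L2per L" "w \<in> L2per L" "w' \<in> L2per L"
    "AE x in cell_measure L. v x = v' x" "AE x in cell_measure L. w x = w' x"
  shows "L2inner L v w = L2inner L v' w'"
  unfolding L2inner_eq
proof (rule integral_cong_AE)
  show "(\<lambda>x. v x \<bullet> w x) \<in> borel_measurable (cell_measure L)"
    "(\<lambda>x. v' x \<bullet> w' x) \<in> borel_measurable (cell_measure L)"
    using L2per_integrable_inner[OF assms(1,3)] L2per_integrable_inner[OF assms(2,4)] by auto
  show "AE x in cell_measure L. v x \<bullet> w x = v' x \<bullet> w' x" using assms(5,6) by eventually_elim simp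
qed

lemma L2norm_cong_AE:
  assumes "v \<in> L2per L" "v' \<in> L2per L" "AE x in cell_measure L. v x = v' x"
  shows "L2norm L v = L2norm L v'"
  unfolding L2norm_def using L2inner_cong_AE[OF assms(1,2,1,2,3,3)] by simp

lemma nn_integral_L2norm:
  assumes "v \<in> L2per L"
  shows "(\<integral>\<^sup>+x. ennreal ((norm (v x))\<^sup>2) \<partial>cell_measure L) = ennreal ((L2norm L v)\<^sup>2)"
  using assms unfolding L2norm_sq L2inner_eq power2_norm_eq_inner[symmetric]
  by (intro nn_integral_eq_integral) (auto simp: L2per_iff)

lemma normsq_eq: "v \<in> L2per L \<Longrightarrow> normsq L v = ennreal ((L2norm L v)\<^sup>2)"
  unfolding normsq_def nn_integral_L2norm[symmetric] cell_measure_def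
  by (subst nn_integral_restrict_space) auto

section \<open>The Hartley basis on the torus\<close>

definition freq :: "real \<Rightarrow> ('d \<Rightarrow> int) \<Rightarrow> real^'d" where
  "freq L m = (\<chi> i. 2 * pi / L * of_int (m i))"

text \<open>The functions \<open>cas = cos + sin\<close> form a real orthogonal basis indexed by all of \<open>\<int>\<^sup>d\<close>, and
  differentiation maps \<open>cas L m\<close> to a multiple of \<open>cas L (- m)\<close>.\<close>

definition cas :: "real \<Rightarrow> ('d \<Rightarrow> int) \<Rightarrow> real^'d \<Rightarrow> real" where
  "cas L m x = cos (freq L m \<bullet> x) + sin (freq L m \<bullet> x)"

lemma freq_minus: "freq L (- m) = - freq L m"
  and freq_add: "freq L (\<lambda>i. m i + n i) = freq L m + freq L n"
  and freq_diff: "freq L (\<lambda>i. m i - n i) = freq L m - freq L n"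
  and freq_zero: "freq L (\<lambda>i. 0) = 0"
  by (simp_all add: freq_def vec_eq_iff ring_distribs add_divide_distrib diff_divide_distrib)

lemma freq_minus_nth [simp]: "freq L (- m) $ i = - (freq L m $ i)"
  by (simp add: freq_minus)

lemma freq_nth_eq_0_iff: "L \<noteq> 0 \<Longrightarrow> freq L m $ i = 0 \<longleftrightarrow> m i = 0"
  by (simp add: freq_def)

lemma cos_freq: "cos (freq L m \<bullet> x) = (cas L m x + cas L (- m) x) / 2"
  and sin_freq: "sin (freq L m \<bullet> x) = (cas L m x - cas L (- m) x) / 2"
  by (simp_all add: cas_def freq_minus)

lemma cas_zero: "cas L (\<lambda>i. 0) x = 1"
  by (simp add: cas_def freq_zero)

text \<open>This product formula serves twice: it makes trigonometric polynomials an algebra, and it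
  reduces orthogonality to integrals of single modes.\<close>

lemma cas_mult: "cas L m x * cas L n x =
    cos (freq L (\<lambda>i. m i - n i) \<bullet> x) + sin (freq L (\<lambda>i. m i + n i) \<bullet> x)"
  by (simp add: cas_def freq_add freq_diff inner_add_left inner_diff_left cos_diff sin_add algebra_simps)

lemma cas_periodic:
  assumes "L \<noteq> 0" shows "periodic L (cas L m)"
proof -
  have "freq L m \<bullet> axis i L = 2 * pi * of_int (m i)" for i
    using assms by (simp add: freq_def inner_axis)
  then show ?thesis
    by (simp add: periodic_def cas_def inner_add_right cos_add sin_add)
qed

lemma cas_continuous [continuous_intros]: "continuous_on A (cas L m)"
  unfolding cas_def by (intro continuous_intros)

lemma cas_measurable [measurable]: "cas L m \<in> borel_measurable borel"
  by (intro borel_measurable_continuous_onI cas_continuous)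

lemma cas_bound: "\<bar>cas L m x\<bar> \<le> 2"
  unfolding cas_def
  using abs_cos_le_one[of "freq L m \<bullet> x"] abs_sin_le_one[of "freq L m \<bullet> x"] by linarith

lemma cas_L2per [simp]: "L \<noteq> 0 \<Longrightarrow> cas L m \<in> L2per L"
  by (rule L2per_bounded[where K=2]) (auto simp: cas_periodic cas_bound)

lemma cas_has_derivative:
  "((\<lambda>x. c * cas L m x) has_derivative (\<lambda>h. c * (freq L m \<bullet> h) * cas L (- m) x)) (at x)"
  unfolding cas_def freq_minus
  by (auto intro!: derivative_eq_intros simp: algebra_simps)

lemma pd_eqI: "(\<phi> has_derivative D) (at x) \<Longrightarrow> pd i \<phi> x = D (axis i 1)"
  unfolding pd_def by (metis frechet_derivative_at)

lemma pd_cas: "pd i (\<lambda>x. c * cas L m x) = (\<lambda>x. c * freq L m $ i * cas L (- m) x)"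
  by (rule ext) (simp add: pd_eqI[OF cas_has_derivative] inner_axis)

lemma pd_cas': "pd i (cas L m) x = freq L m $ i * cas L (- m) x"
  using pd_cas[of i 1 L m] by simp

lemma cas_smooth:
  assumes "L \<noteq> 0" shows "cas L m \<in> smooth_per L"
proof -
  \<comment> \<open>The scalar factor is part of the claim because each differentiation produces a
    new one; without it the induction on \<open>js\<close> would not close.\<close>
  have "\<exists>c' m'. foldr pd js (\<lambda>x. c * cas L m x) = (\<lambda>x. c' * cas L m' x)" for js c
    by (induction js) (auto simp: pd_cas, metis)
  then have "foldr pd js (cas L m) differentiable_on UNIV" for js
  proof -
    assume "\<And>js c. \<exists>c' m'. foldr pd js (\<lambda>x. c * cas L m x) = (\<lambda>x. c' * cas L m' x)"
    from this[of js 1] obtain c' m' where "foldr pd js (cas L m) = (\<lambda>x. c' * cas L m' x)" by auto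
    then show ?thesis
      using cas_has_derivative[of c' L m'] unfolding differentiable_on_def differentiable_def
      by (auto intro: has_derivative_at_withinI)
  qed
  then show ?thesis using assms by (auto simp: smooth_per_def cas_periodic)
qed

section \<open>Integration by parts on the periodic cell\<close>

text \<open>Cutting and shifting the open cell loses points on hyperplanes; these may be
  ignored.\<close>

lemma AE_lborel_component_neq: "AE x in lborel. (x::real^'d) $ i \<noteq> c"
proof -
  have "{x::real^'d. axis i 1 \<bullet> x = c} \<in> sets lborel"
    by (auto intro: borel_closed closed_hyperplane)
  moreover have "negligible {x::real^'d. axis i 1 \<bullet> x = c}"
    by (rule negligible_hyperplane) (auto simp: axis_eq_0_iff)
  ultimately have "{x::real^'d. axis i 1 \<bullet> x = c} \<in> null_sets lborel"
    by (simp add: negligible_iff_null_sets null_sets_completion_iff)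
  then have "{x::real^'d. x $ i = c} \<in> null_sets lborel"
    by (simp add: cart_eq_inner_axis inner_commute)
  then show ?thesis by (intro AE_I'[of "{x::real^'d. x $ i = c}"]) auto
qed

lemma integral_lborel_translation:
  fixes g :: "real^'d \<Rightarrow> real"
  assumes "g \<in> borel_measurable borel"
  shows "(\<integral>x. g (x + c) \<partial>lborel) = (\<integral>x. g x \<partial>lborel)"
proof -
  have "(\<integral>x. g x \<partial>lborel) = (\<integral>x. g x \<partial>distr lborel borel ((+) c))"
    by (simp add: lborel_distr_plus)
  also have "\<dots> = (\<integral>x. g (c + x) \<partial>lborel)" using assms by (intro integral_distr) auto
  finally show ?thesis by (simp add: add.commute)
qed

lemma cell_iff: "x \<in> cell L \<longleftrightarrow> (\<forall>i. 0 < x $ i \<and> x $ i < L)"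
  by (simp add: cell_def mem_box_cart)

lemma cell_iff_split:
  "x \<in> cell L \<longleftrightarrow> (\<forall>j. j \<noteq> i \<longrightarrow> 0 < x $ j \<and> x $ j < L) \<and> 0 < x $ i \<and> x $ i < L"
  unfolding cell_iff by metis

lemma axis_scale: "h *\<^sub>R axis i 1 = (axis i h :: real^'d)"
  by (simp add: vec_eq_iff axis_def)

text \<open>The cell shifted by \<open>h\<close> consists of the part \<open>A\<close> that stays
  inside and a slab protruding beyond \<open>x $ i = L\<close>. One period back, the slab fills the
  gap \<open>A'\<close> left by the shift. Only the hyperplanes \<open>x $ i = L\<close> and
  \<open>x $ i = h\<close> are missed.\<close>

lemma integral_cell_translation:
  fixes \<psi> :: "real^'d \<Rightarrow> real"
  assumes c: "continuous_on UNIV \<psi>" and p: "periodic L \<psi>" and h: "0 < h" "h < L"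
  shows "(LINT x:cell L|lborel. \<psi> (x + axis i h)) = (LINT x:cell L|lborel. \<psi> x)"
proof -
  have m [measurable]: "\<psi> \<in> borel_measurable borel" using c by (rule borel_measurable_continuous_onI)
  define A where "A = {x \<in> cell L. h < x $ i}"
  define A' where "A' = {x \<in> cell L. x $ i < h}"
  have [measurable]: "(\<lambda>x::real^'d. x $ i) \<in> borel_measurable borel"
    unfolding cart_eq_inner_axis by measurable
  have sA [measurable]: "A \<in> sets borel" "A' \<in> sets borel"
  proof -
    have b: "{x \<in> space borel. h < x $ i} \<in> sets (borel :: (real^'d) measure)"
      "{x \<in> space borel. x $ i < h} \<in> sets (borel :: (real^'d) measure)" by measurable
    have "A = cell L \<inter> {x \<in> space borel. h < x $ i}" "A' = cell L \<inter> {x \<in> space borel. x $ i < h}"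
      by (auto simp: A_def A'_def)
    then show "A \<in> sets borel" "A' \<in> sets borel"
      using sets.Int[OF cell_sets b(1)] sets.Int[OF cell_sets b(2)] by simp_all
  qed
  \<comment> \<open>Since \<open>h < L\<close>, a box of side \<open>2 * L\<close> contains the cell
    and the protruding slab.\<close>
  have comp: "set_integrable lborel S \<psi>" if "S \<subseteq> cbox 0 (\<chi> i. 2*L)" "S \<in> sets borel" for S
  proof (rule set_integrable_subset[of lborel "cbox 0 (\<chi> i. 2*L)"])
    show "set_integrable lborel (cbox 0 (\<chi> i. 2*L)) \<psi>" unfolding set_integrable_def
      using c by (intro borel_integrable_compact compact_cbox continuous_on_subset[OF c]) auto
  qed (use that in auto)
  have cell_sub: "(cell L :: (real^'d) set) \<subseteq> cbox 0 (\<chi> i. 2*L)"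
  proof
    fix x :: "real^'d" assume "x \<in> cell L"
    then have "0 < x $ j" "x $ j < L" for j by (auto simp: cell_iff)
    then have "0 \<le> x $ j \<and> x $ j \<le> 2 * L" for j using h by (smt (verit))
    then show "x \<in> cbox 0 (\<chi> i. 2*L)" by (simp add: mem_box_cart)
  qed
  let ?A'' = "{x. x - axis i L \<in> A'}"
  have sA'' [measurable]: "?A'' \<in> sets borel" 
    using measurable_sets[of "\<lambda>x. x - axis i L" borel borel A'] sA by (simp add: vimage_def)
  have iA: "set_integrable lborel A \<psi>" "set_integrable lborel A' \<psi>" "set_integrable lborel ?A'' \<psi>"
  proof -
    show "set_integrable lborel A \<psi>" "set_integrable lborel A' \<psi>"
      using cell_sub by (auto intro!: comp simp: A_def A'_def)
    have "0 \<le> x $ j \<and> x $ j \<le> 2 * L" if "x - axis i L \<in> A'" for x j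
    proof -
      have "0 < (x - axis i L) $ j" "(x - axis i L) $ j < L" "(x - axis i L) $ i < h"
        using that by (auto simp: A'_def cell_iff)
      then show ?thesis using h by (cases "j = i") (auto simp: axis_def)
    qed
    then show "set_integrable lborel ?A'' \<psi>"
      by (intro comp) (auto simp: mem_box_cart)
  qed
  \<comment> \<open>The indicator is also expressed in the shifted variable, so that translation
    invariance applies to the whole integrand.\<close>
  have "(LINT x:cell L|lborel. \<psi> (x + axis i h))
      = (\<integral>x. indicator (cell L) ((x + axis i h) - axis i h) * \<psi> (x + axis i h) \<partial>lborel)"
    by (simp add: set_lebesgue_integral_def)
  also have "\<dots> = (\<integral>x. indicator (cell L) (x - axis i h) * \<psi> x \<partial>lborel)"
    by (rule integral_lborel_translation[of "\<lambda>x. indicator (cell L) (x - axis i h) * \<psi> x"]) measurable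
  also have "\<dots> = (\<integral>x. indicator A x *\<^sub>R \<psi> x + indicator ?A'' x *\<^sub>R \<psi> x \<partial>lborel)"
  proof (rule integral_cong_AE)
    have key: "x - axis i h \<in> cell L \<longleftrightarrow> x \<in> A \<or> x \<in> ?A''" "x \<in> A \<Longrightarrow> x \<notin> ?A''" if "x $ i \<noteq> L" for x
    proof -
      define Q where "Q \<longleftrightarrow> (\<forall>j. j \<noteq> i \<longrightarrow> 0 < x $ j \<and> x $ j < L)"
      have shift: "(x - axis i c) $ i = x $ i - c" "j \<noteq> i \<Longrightarrow> (x - axis i c) $ j = x $ j" for c j
        by (simp_all add: axis_def)
      have Q: "(\<forall>j. j \<noteq> i \<longrightarrow> 0 < (x - axis i c) $ j \<and> (x - axis i c) $ j < L) \<longleftrightarrow> Q" for c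
        unfolding Q_def by (intro iff_allI imp_cong refl) (simp add: axis_def)
      have "x - axis i h \<in> cell L \<longleftrightarrow> Q \<and> h < x $ i \<and> x $ i < L + h"
        unfolding cell_iff_split[of _ L i] Q shift by (intro conj_cong refl) linarith+
      moreover have "x \<in> A \<longleftrightarrow> Q \<and> h < x $ i \<and> x $ i < L"
        unfolding A_def mem_Collect_eq cell_iff_split[of _ L i] Q_def[symmetric] using h by linarith
      moreover have "x \<in> ?A'' \<longleftrightarrow> Q \<and> L < x $ i \<and> x $ i < L + h"
        unfolding A'_def mem_Collect_eq cell_iff_split[of _ L i] Q shift using h by linarith
      ultimately show "x - axis i h \<in> cell L \<longleftrightarrow> x \<in> A \<or> x \<in> ?A''" "x \<in> A \<Longrightarrow> x \<notin> ?A''"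
        using that h by linarith+
    qed
    show "AE x in lborel. indicator (cell L) (x - axis i h) * \<psi> x
        = indicator A x *\<^sub>R \<psi> x + indicator ?A'' x *\<^sub>R \<psi> x"
    proof (rule AE_mp[OF AE_lborel_component_neq[of i L]], intro AE_I2 impI)
      fix x :: "real^'d" assume "x $ i \<noteq> L"
      from key[OF this] show "indicator (cell L) (x - axis i h) * \<psi> x
        = indicator A x *\<^sub>R \<psi> x + indicator ?A'' x *\<^sub>R \<psi> x"
        by (cases "x \<in> A"; cases "x \<in> ?A''") simp_all
    qed
  qed measurable
  also have "\<dots> = (\<integral>x. indicator A x *\<^sub>R \<psi> x \<partial>lborel) + (\<integral>x. indicator ?A'' x *\<^sub>R \<psi> x \<partial>lborel)"
    using iA unfolding set_integrable_def by (intro Bochner_Integration.integral_add)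
  \<comment> \<open>The protruding slab is moved back by one full period, which does not change
    \<open>\<psi>\<close>.\<close>
  also have "(\<integral>x. indicator ?A'' x *\<^sub>R \<psi> x \<partial>lborel)
      = (\<integral>x. indicator ?A'' (x + axis i L) *\<^sub>R \<psi> (x + axis i L) \<partial>lborel)"
    by (rule integral_lborel_translation[symmetric]) measurable
  also have "\<dots> = (\<integral>x. indicator A' x *\<^sub>R \<psi> x \<partial>lborel)"
    using p by (simp add: periodic_def indicator_def)
  also have "(\<integral>x. indicator A x *\<^sub>R \<psi> x \<partial>lborel) + (\<integral>x. indicator A' x *\<^sub>R \<psi> x \<partial>lborel)
      = (\<integral>x. indicator A x *\<^sub>R \<psi> x + indicator A' x *\<^sub>R \<psi> x \<partial>lborel)"
    using iA unfolding set_integrable_def by (intro Bochner_Integration.integral_add[symmetric])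
  also have "\<dots> = (\<integral>x. indicator (cell L) x *\<^sub>R \<psi> x \<partial>lborel)"
  proof (rule integral_cong_AE)
    show "AE x in lborel. indicator A x *\<^sub>R \<psi> x + indicator A' x *\<^sub>R \<psi> x = indicator (cell L) x *\<^sub>R \<psi> x"
      using AE_lborel_component_neq[of i h]
      by eventually_elim (auto simp: indicator_def A_def A'_def)
  qed measurable
  finally show ?thesis by (simp add: set_lebesgue_integral_def)
qed

text \<open>Difference quotients of a periodic function integrate to zero by translation invariance,
  and the mean value theorem provides a constant that dominates them. No boundary terms or iterated
  integrals occur.\<close>

lemma integral_cell_pd_eq_0:
  fixes \<psi> :: "real^'d \<Rightarrow> real"
  assumes L: "0 < L" and p: "periodic L \<psi>" and d: "\<And>x. \<psi> differentiable (at x)"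
    and c: "continuous_on UNIV (pd i \<psi>)"
  shows "(\<integral>x. pd i \<psi> x \<partial>cell_measure L) = 0"
proof -
  interpret finite_measure "cell_measure L :: (real^'d) measure" by (rule finite_measure_cell_measure)
  have cont: "continuous_on UNIV \<psi>"
    using d by (auto intro!: differentiable_imp_continuous_on simp: differentiable_on_def differentiable_at_withinI)
  have m [measurable]: "\<psi> \<in> borel_measurable borel" "pd i \<psi> \<in> borel_measurable borel"
    using c cont by (auto intro: borel_measurable_continuous_onI)
  have der: "((\<lambda>t. \<psi> (x + axis i t)) has_real_derivative pd i \<psi> (x + axis i t)) (at t)" for x t
  proof -
    have "(\<psi> has_derivative frechet_derivative \<psi> (at (x + t *\<^sub>R axis i 1))) (at (x + t *\<^sub>R axis i 1))"
      using d by (simp add: frechet_derivative_works)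
    then have "((\<lambda>t. \<psi> (x + t *\<^sub>R axis i 1)) has_derivative
        (\<lambda>h. frechet_derivative \<psi> (at (x + t *\<^sub>R axis i 1)) (h *\<^sub>R axis i 1))) (at t)"
      by (rule has_derivative_compose[rotated]) (auto intro!: derivative_eq_intros)
    moreover have "frechet_derivative \<psi> (at y) (h *\<^sub>R axis i 1) = h * pd i \<psi> y" for y h
      using d linear_frechet_derivative[of \<psi> "at y"] by (simp add: pd_def linear_cmul)
    ultimately show ?thesis by (simp add: axis_scale has_field_derivative_def mult.commute[of _ "pd i \<psi> _"])
  qed
  let ?K = "cbox 0 (\<chi> i. 2*L) :: (real^'d) set"
  have "compact (pd i \<psi> ` ?K)"
    by (intro compact_continuous_image continuous_on_subset[OF c] compact_cbox) auto
  then obtain K where K: "\<And>y. y \<in> ?K \<Longrightarrow> \<bar>pd i \<psi> y\<bar> \<le> K"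
    using compact_imp_bounded[of "pd i \<psi> ` ?K"] unfolding bounded_iff by force
  \<comment> \<open>The offset 2 keeps every step strictly below \<open>L\<close>, as the
    translation lemma demands, also for \<open>n = 0\<close>.\<close>
  define h where "h n = L / (real n + 2)" for n :: nat
  have h: "0 < h n" "h n < L" for n
  proof -
    have "L * 1 < L * (real n + 2)" using L by (intro mult_strict_left_mono) auto
    then show "0 < h n" "h n < L" using L by (simp_all add: h_def divide_less_eq)
  qed
  have h0: "h \<longlonglongrightarrow> 0" unfolding h_def
    using LIMSEQ_ignore_initial_segment[OF lim_const_over_n[of L], of 2] by (simp add: add.commute)
  define q where "q n x = (\<psi> (x + axis i (h n)) - \<psi> x) / h n" for n x
  have [measurable]: "q n \<in> borel_measurable borel" for n unfolding q_def by measurable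
  have "(\<lambda>n. \<integral>x. q n x \<partial>cell_measure L) \<longlonglongrightarrow> (\<integral>x. pd i \<psi> x \<partial>cell_measure L)"
  proof (rule integral_dominated_convergence[where w="\<lambda>_. K"])
    show "AE x in cell_measure L. (\<lambda>n. q n x) \<longlonglongrightarrow> pd i \<psi> x"
    proof (rule AE_I2)
      fix x
      have "((\<lambda>t. (\<psi> (x + axis i (0 + t)) - \<psi> (x + axis i 0)) / t) \<longlongrightarrow> pd i \<psi> (x + axis i 0)) (at 0)"
        using der[of x 0] unfolding DERIV_def .
      moreover have "axis i 0 = (0::real^'d)" by (simp add: vec_eq_iff axis_def)
      ultimately have "((\<lambda>t. (\<psi> (x + axis i t) - \<psi> x) / t) \<longlongrightarrow> pd i \<psi> x) (at 0)" by simp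
      moreover have "filterlim h (at 0) sequentially"
        using h0 h(1) unfolding filterlim_at by (auto intro!: always_eventually) (metis less_irrefl)
      ultimately show "(\<lambda>n. q n x) \<longlonglongrightarrow> pd i \<psi> x"
        unfolding q_def by (rule filterlim_compose)
    qed
    show "AE x in cell_measure L. norm (q n x) \<le> K" for n
    proof (rule AE_I2)
      fix x :: "real^'d" assume "x \<in> space (cell_measure L)"
      then have x: "x \<in> cell L" by (simp add: space_cell_measure)
      obtain z where z: "0 < z" "z < h n"
          "\<psi> (x + axis i (h n)) - \<psi> (x + axis i 0) = (h n - 0) * pd i \<psi> (x + axis i z)"
        using MVT2[of 0 "h n" "\<lambda>t. \<psi> (x + axis i t)" "\<lambda>t. pd i \<psi> (x + axis i t)"] h(1)[of n] der
        by blast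
      have "0 \<le> (x + axis i z) $ j \<and> (x + axis i z) $ j \<le> 2 * L" for j
      proof -
        have "0 < x $ j" "x $ j < L" using x by (auto simp: cell_iff)
        then show ?thesis using z h(2)[of n] by (auto simp: axis_def)
      qed
      then have "x + axis i z \<in> ?K" by (simp add: mem_box_cart)
      then have "\<bar>pd i \<psi> (x + axis i z)\<bar> \<le> K" by (rule K)
      moreover have "q n x = pd i \<psi> (x + axis i z)"
      proof -
        have "axis i 0 = (0::real^'d)" by (simp add: vec_eq_iff axis_def)
        with z(3) have "\<psi> (x + axis i (h n)) - \<psi> x = h n * pd i \<psi> (x + axis i z)"
          by (metis add.right_neutral diff_zero)
        then show ?thesis using h(1)[of n] by (simp add: q_def)
      qed
      ultimately show "norm (q n x) \<le> K" by simp
    qed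
  qed (auto intro: borel_measurable_cell_measure)
  moreover have "(\<integral>x. q n x \<partial>cell_measure L) = 0" for n
  proof -
    have per: "periodic L (\<lambda>x. \<psi> (x + axis i (h n)))"
      using p unfolding periodic_def by (metis add.assoc add.commute)
    have i: "integrable (cell_measure L) g" if cg: "continuous_on UNIV g" for g :: "real^'d \<Rightarrow> real"
      unfolding set_integrable_cell_iff[symmetric]
    proof (rule set_integrable_subset[of lborel ?K])
      show "set_integrable lborel ?K g" unfolding set_integrable_def
        by (intro borel_integrable_compact compact_cbox continuous_on_subset[OF cg]) auto
      show "cell L \<subseteq> ?K"
      proof
        fix x :: "real^'d" assume "x \<in> cell L"
        then have "0 < x $ j" "x $ j < L" for j by (auto simp: cell_iff)
        then have "0 \<le> x $ j \<and> x $ j \<le> 2 * L" for j using L by (smt (verit))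
        then show "x \<in> ?K" by (simp add: mem_box_cart)
      qed
    qed auto
    have "continuous_on UNIV (\<lambda>x. \<psi> (x + axis i (h n)))"
      by (rule continuous_on_compose2[OF cont]) (auto intro!: continuous_intros)
    then have "(\<integral>x. q n x \<partial>cell_measure L)
      = ((\<integral>x. \<psi> (x + axis i (h n)) \<partial>cell_measure L) - (\<integral>x. \<psi> x \<partial>cell_measure L)) / h n"
      unfolding q_def using i cont by simp
    also have "\<dots> = 0"
      using integral_cell_translation[OF cont p h(1)[of n] h(2)[of n], of i] unfolding set_integral_cell_eq by simp
    finally show ?thesis .
  qed
  ultimately show ?thesis by (simp add: LIMSEQ_const_iff)
qed

lemma fun_minus_minus [simp]: "- (- m) = m" for m :: "'d \<Rightarrow> int"
  by (simp add: fun_eq_iff)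

lemma smooth_per_differentiable:
  assumes "\<phi> \<in> smooth_per L"
  shows "\<phi> differentiable (at x)" "pd i \<phi> differentiable (at x)"
proof -
  have "foldr pd [] \<phi> differentiable_on UNIV" "foldr pd [i] \<phi> differentiable_on UNIV"
    using assms unfolding smooth_per_def by blast+
  then show "\<phi> differentiable (at x)" "pd i \<phi> differentiable (at x)"
    by (auto simp: differentiable_on_def)
qed

lemma smooth_per_continuous:
  assumes "\<phi> \<in> smooth_per L"
  shows "continuous_on A \<phi>" "continuous_on A (pd i \<phi>)"
  using smooth_per_differentiable[OF assms]
  by (auto intro!: continuous_at_imp_continuous_on differentiable_imp_continuous_within)

lemma pd_mult:
  assumes "\<phi> differentiable (at x)" "\<psi> differentiable (at x)"
  shows "pd i (\<lambda>x. \<phi> x * \<psi> x) x = pd i \<phi> x * \<psi> x + \<phi> x * pd i \<psi> x"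
proof -
  have "((\<lambda>x. \<phi> x * \<psi> x) has_derivative
      (\<lambda>h. \<phi> x * frechet_derivative \<psi> (at x) h + frechet_derivative \<phi> (at x) h * \<psi> x)) (at x)"
    using assms unfolding frechet_derivative_works by (rule has_derivative_mult)
  from pd_eqI[OF this, of i] show ?thesis by (simp add: pd_def)
qed

lemma periodic_pd:
  assumes "\<phi> \<in> smooth_per L" shows "periodic L (pd i \<phi>)"
  unfolding periodic_def
proof (intro allI)
  fix x j
  have p: "periodic L \<phi>" using assms by (simp add: smooth_per_def)
  have "((\<lambda>y. \<phi> (y + axis j L)) has_derivative frechet_derivative \<phi> (at (x + axis j L))) (at x)"
    by (rule has_derivative_compose[of "\<lambda>y. y + axis j L" "\<lambda>h. h" x UNIV \<phi>, unfolded o_def])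
       (use smooth_per_differentiable(1)[OF assms] in \<open>auto simp: frechet_derivative_works[symmetric] intro!: derivative_eq_intros\<close>)
  then have "(\<phi> has_derivative frechet_derivative \<phi> (at (x + axis j L))) (at x)"
    using p by (simp add: periodic_def)
  from pd_eqI[OF this, of i] show "pd i \<phi> (x + axis j L) = pd i \<phi> x" by (simp add: pd_def)
qed

lemma continuous_periodic_L2per:
  fixes v :: "real^'d \<Rightarrow> real"
  assumes c: "continuous_on UNIV v" and p: "periodic L v"
  shows "v \<in> L2per L"
proof -
  let ?K = "cbox 0 (\<chi> i. L) :: (real^'d) set"
  have "compact (v ` ?K)"
    by (intro compact_continuous_image continuous_on_subset[OF c] compact_cbox) auto
  then obtain K where "\<And>y. y \<in> ?K \<Longrightarrow> \<bar>v y\<bar> \<le> K"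
    using compact_imp_bounded[of "v ` ?K"] unfolding bounded_iff by force
  moreover have "cell L \<subseteq> ?K" by (auto simp: cell_def box_subset_cbox)
  ultimately show ?thesis
    using c p by (intro L2per_bounded[where K=K]) (auto intro: borel_measurable_continuous_onI)
qed

lemma smooth_per_L2per:
  assumes "\<phi> \<in> smooth_per L" shows "\<phi> \<in> L2per L" "pd i \<phi> \<in> L2per L"
  using assms smooth_per_continuous[OF assms] periodic_pd[OF assms]
  by (auto intro!: continuous_periodic_L2per simp: smooth_per_def)

lemma integral_by_parts_cas:
  assumes L: "0 < L" and s: "\<phi> \<in> smooth_per L"
  shows "L2inner L (pd i \<phi>) (cas L m) = - (freq L m $ i * L2inner L \<phi> (cas L (- m)))"
proof -
  let ?\<psi> = "\<lambda>x. \<phi> x * cas L m x"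
  have d: "cas L m differentiable (at x)" for x
    using cas_has_derivative[of 1 L m x] by (auto simp: differentiable_def)
  have pd: "pd i ?\<psi> = (\<lambda>x. pd i \<phi> x * cas L m x + freq L m $ i * (\<phi> x * cas L (-m) x))"
    by (rule ext) (simp add: pd_mult[OF smooth_per_differentiable(1)[OF s] d] pd_cas')
  have "(\<integral>x. pd i ?\<psi> x \<partial>cell_measure L) = 0"
  proof (rule integral_cell_pd_eq_0[OF L])
    show "periodic L ?\<psi>" using s cas_periodic[of L m] L by (auto simp: smooth_per_def periodic_def)
    show "?\<psi> differentiable (at x)" for x
      by (intro differentiable_mult smooth_per_differentiable[OF s] d)
    show "continuous_on UNIV (pd i ?\<psi>)" unfolding pd
      by (intro continuous_intros smooth_per_continuous[OF s])
  qed
  moreover have "integrable (cell_measure L) (\<lambda>x. pd i \<phi> x * cas L m x)"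
    "integrable (cell_measure L) (\<lambda>x. \<phi> x * cas L (-m) x)"
    using L L2per_integrable_inner[OF smooth_per_L2per(2)[OF s] cas_L2per, of i m]
      L2per_integrable_inner[OF smooth_per_L2per(1)[OF s] cas_L2per, of "-m"] by auto
  ultimately show ?thesis unfolding pd L2inner_eq by simp
qed

text \<open>Up to a nonzero frequency component, \<open>cas L m\<close> is a derivative of
  \<open>cas L (- m)\<close>; integration by parts against the constant mode finishes the
  argument.\<close>

lemma integral_cas_eq_0:
  assumes L: "0 < L" and m: "m \<noteq> (\<lambda>i. 0)"
  shows "(\<integral>x. cas L m x \<partial>cell_measure L) = 0"
proof -
  obtain i where i: "m i \<noteq> 0" using m by auto
  have "L2inner L (pd i (cas L (- m))) (cas L (\<lambda>i. 0)) = 0"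
    using L by (subst integral_by_parts_cas) (auto simp: cas_smooth freq_zero)
  then have "freq L (- m) $ i * (\<integral>x. cas L m x \<partial>cell_measure L) = 0"
    unfolding L2inner_eq by (simp add: pd_cas' cas_zero)
  then show ?thesis using freq_nth_eq_0_iff[of L m i] L i by simp
qed

text \<open>The \<open>itself\<close> argument carries the dimension, which \<open>L\<close> alone
  does not determine.\<close>

definition cell_vol :: "real \<Rightarrow> (real^'d) itself \<Rightarrow> real" where
  "cell_vol L t = L ^ CARD('d)"

lemma cell_vol_pos: "0 < L \<Longrightarrow> 0 < cell_vol L t"
  by (simp add: cell_vol_def)

lemma integral_cell_one:
  assumes "0 < L"
  shows "(\<integral>x. 1 \<partial>(cell_measure L :: (real^'d) measure)) = cell_vol L TYPE(real^'d)"
proof -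
  have "measure (cell_measure L :: (real^'d) measure) (cell L) = measure lborel (cell L :: (real^'d) set)"
    unfolding cell_measure_def by (subst measure_restrict_space) auto
  also have "\<dots> = (\<Prod>b\<in>(Basis :: (real^'d) set). ((\<chi> i. L) :: real^'d) \<bullet> b - 0 \<bullet> b)"
    unfolding cell_def using assms by (subst measure_lborel_box_eq) (auto simp: Basis_vec_def inner_axis less_imp_le)
  also have "\<dots> = (\<Prod>b\<in>(Basis :: (real^'d) set). L)"
    by (rule prod.cong) (auto simp: Basis_vec_def inner_axis)
  finally show ?thesis by (simp add: space_cell_measure cell_vol_def)
qed

lemma cas_integrable: "0 < L \<Longrightarrow> integrable (cell_measure L) (cas L m)"
  using L2per_integrable_inner[of "cas L m" L "cas L (\<lambda>i. 0)"] by (simp add: cas_zero)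

lemma cas_orthogonal:
  assumes L: "0 < L"
  shows "L2inner L (cas L m) (cas L n :: real^'d \<Rightarrow> real) = (if m = n then cell_vol L TYPE(real^'d) else 0)"
proof -
  let ?d = "\<lambda>i. m i - n i" and ?s = "\<lambda>i. m i + n i"
  have i0: "(\<integral>x. cas L k x \<partial>cell_measure L) = (if k = (\<lambda>i. 0) then cell_vol L TYPE(real^'d) else 0)" for k :: "'d \<Rightarrow> int"
    using integral_cas_eq_0[OF L, of k] integral_cell_one[OF L, where 'd='d] by (auto simp: cas_zero)
  have "L2inner L (cas L m) (cas L n) = (\<integral>x. ((cas L ?d x + cas L (- ?d) x) / 2
      + (cas L ?s x - cas L (- ?s) x) / 2) \<partial>cell_measure L)"
    unfolding L2inner_eq inner_real_def cas_mult cos_freq sin_freq ..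
  also have "\<dots> = ((\<integral>x. cas L ?d x \<partial>cell_measure L) + (\<integral>x. cas L (- ?d) x \<partial>cell_measure L)) / 2
      + ((\<integral>x. cas L ?s x \<partial>cell_measure L) - (\<integral>x. cas L (- ?s) x \<partial>cell_measure L)) / 2"
    by (simp add: cas_integrable[OF L])
  \<comment> \<open>The sine contribution cancels even for \<open>m + n = 0\<close>, because
    \<open>?s\<close> and \<open>- ?s\<close> vanish together; the cosine contribution survives
    exactly for \<open>m = n\<close>.\<close>
  also have "\<dots> = (if m = n then cell_vol L TYPE(real^'d) else 0)"
  proof -
    have "- k = (\<lambda>i. 0) \<longleftrightarrow> k = (\<lambda>i. 0)" for k :: "'d \<Rightarrow> int" by (simp add: fun_eq_iff)
    moreover have "?d = (\<lambda>i. 0) \<longleftrightarrow> m = n" by (simp add: fun_eq_iff)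
    ultimately show ?thesis unfolding i0 by (simp only:) simp
  qed
  finally show ?thesis .
qed

section \<open>Completeness of the Hartley basis\<close>

text \<open>The linear span of the Hartley functions, given by rules so that closure under products
  and orthogonality follow by induction.\<close>

inductive trig_poly :: "real \<Rightarrow> (real^'d \<Rightarrow> real) \<Rightarrow> bool" for L where
  cas: "trig_poly L (cas L m)"
| add: "trig_poly L p \<Longrightarrow> trig_poly L q \<Longrightarrow> trig_poly L (\<lambda>x. p x + q x)"
| scale: "trig_poly L p \<Longrightarrow> trig_poly L (\<lambda>x. c * p x)"

lemma trig_poly_cos: "trig_poly L (\<lambda>x. cos (freq L m \<bullet> x))"
  and trig_poly_sin: "trig_poly L (\<lambda>x. sin (freq L m \<bullet> x))"
proof -
  have "trig_poly L (\<lambda>x. (1/2) * (cas L m x + cas L (- m) x))"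
    "trig_poly L (\<lambda>x. (1/2) * (cas L m x + (-1) * cas L (- m) x))"
    by (intro trig_poly.intros)+
  then show "trig_poly L (\<lambda>x. cos (freq L m \<bullet> x))" "trig_poly L (\<lambda>x. sin (freq L m \<bullet> x))"
    by (simp_all add: cos_freq sin_freq)
qed

lemma trig_poly_const: "trig_poly L (\<lambda>x. c)"
  using trig_poly.scale[OF trig_poly.cas[of L "\<lambda>i. 0"], of c] by (simp add: cas_zero)

lemma trig_poly_mult:
  assumes "trig_poly L p" "trig_poly L q" shows "trig_poly L (\<lambda>x. p x * q x)"
  using assms(1)
proof induction
  case (cas m)
  from assms(2) show ?case
  proof induction
    case (cas n)
    show ?case unfolding cas_mult by (intro trig_poly.add trig_poly_cos trig_poly_sin)
  next
    case (add p q) then show ?case using trig_poly.add by (fastforce simp: ring_distribs)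
  next
    case (scale p c) then show ?case using trig_poly.scale[of L "\<lambda>x. cas L m x * p x" c] by (simp add: ac_simps)
  qed
next
  case (add p1 p2) then show ?case using trig_poly.add by (fastforce simp: ring_distribs)
next
  case (scale p c) then show ?case using trig_poly.scale[of L "\<lambda>x. p x * q x" c] by (simp add: ac_simps)
qed

lemma trig_poly_sum: "(\<And>i. i \<in> A \<Longrightarrow> trig_poly L (p i)) \<Longrightarrow> trig_poly L (\<lambda>x. \<Sum>i\<in>A. p i x)"
  by (induction A rule: infinite_finite_induct) (auto intro: trig_poly_const trig_poly.add)

lemma trig_poly_L2per: "trig_poly L p \<Longrightarrow> L \<noteq> 0 \<Longrightarrow> p \<in> L2per L"
  by (induction rule: trig_poly.induct) (auto intro: L2per_add L2per_scaleR[where 'b=real, simplified])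

lemma trig_poly_L2inner_eq_0:
  assumes "trig_poly L p" "L \<noteq> 0" "v \<in> L2per L" "\<And>m. L2inner L v (cas L m) = 0"
  shows "L2inner L v p = 0"
  using assms(1)
proof induction
  case (add p q)
  then have "L2inner L (\<lambda>x. p x + q x) v = L2inner L p v + L2inner L q v"
    using assms trig_poly_L2per[of L] by (intro L2inner_add_left) auto
  then show ?case using add by (simp add: L2inner_commute)
next
  case (scale p c)
  then show ?case using L2inner_scaleR_left[of L c p v] by (simp add: L2inner_commute[of L v])
qed (use assms in auto)

text \<open>The embedding of the torus as a product of unit circles. Polynomials in the ambient
  coordinates pull back to trigonometric polynomials, so the polynomial Stone-Weierstrass theorem
  becomes applicable.\<close>

definition torus :: "real \<Rightarrow> real^'d \<Rightarrow> complex^'d" where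
  "torus L x = (\<chi> i. cis (2 * pi / L * x $ i))"

lemma torus_continuous: "continuous_on A (torus L)"
  unfolding torus_def cis_conv_exp
  by (intro continuous_on_vec_lambda continuous_intros)

lemma trig_poly_torus_poly:
  assumes "real_polynomial_function p"
  shows "trig_poly L (\<lambda>x. p (torus L x))"
  using assms
proof induction
  case (linear f)
  then have lf: "linear f" by (rule bounded_linear.linear)
  have b: "trig_poly L (\<lambda>x. torus L x \<bullet> b)" if "b \<in> Basis" for b
  proof -
    obtain i u where b: "b = axis i u" and u: "u \<in> Basis" using \<open>b \<in> Basis\<close> by (auto simp: Basis_vec_def)
    have "freq L (\<lambda>j. if j = i then 1 else 0) = axis i (2 * pi / L)"
      by (simp add: vec_eq_iff freq_def axis_def)
    then have f: "freq L (\<lambda>j. if j = i then 1 else 0) \<bullet> x = 2 * pi / L * x $ i" for x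
      by (simp add: inner_axis')
    have "torus L x \<bullet> b = cis (2 * pi / L * x $ i) \<bullet> u" for x
      by (simp add: torus_def b inner_axis)
    then have eq: "(\<lambda>x. torus L x \<bullet> b) = (\<lambda>x. cis (2 * pi / L * x $ i) \<bullet> u)" by (rule ext)
    have "u = 1 \<or> u = \<i>" using u by (simp add: Basis_complex_def)
    then show ?thesis
    proof
      assume "u = 1"
      then have "(\<lambda>x. torus L x \<bullet> b) = (\<lambda>x. cos (freq L (\<lambda>j. if j = i then 1 else 0) \<bullet> x))"
        unfolding eq f by (simp add: inner_complex_def)
      then show ?thesis by (simp only: trig_poly_cos)
    next
      assume "u = \<i>"
      then have "(\<lambda>x. torus L x \<bullet> b) = (\<lambda>x. sin (freq L (\<lambda>j. if j = i then 1 else 0) \<bullet> x))"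
        unfolding eq f by (simp add: inner_complex_def)
      then show ?thesis by (simp only: trig_poly_sin)
    qed
  qed
  have f_eq: "f z = (\<Sum>b\<in>Basis. f b * (z \<bullet> b))" for z
  proof -
    have "f z = f (\<Sum>b\<in>Basis. (z \<bullet> b) *\<^sub>R b)" unfolding euclidean_representation ..
    also have "\<dots> = (\<Sum>b\<in>Basis. f ((z \<bullet> b) *\<^sub>R b))" by (rule linear_sum[OF lf])
    also have "\<dots> = (\<Sum>b\<in>Basis. f b * (z \<bullet> b))"
    proof (rule sum.cong[OF refl])
      fix b
      have "f ((z \<bullet> b) *\<^sub>R b) = (z \<bullet> b) * f b" unfolding linear_cmul[OF lf] real_scaleR_def ..
      then show "f ((z \<bullet> b) *\<^sub>R b) = f b * (z \<bullet> b)" by (rule trans[OF _ mult.commute])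
    qed
    finally show ?thesis .
  qed
  have "trig_poly L (\<lambda>x. \<Sum>b\<in>Basis. f b * (torus L x \<bullet> b))"
    by (intro trig_poly_sum trig_poly.scale b)
  moreover have "(\<lambda>x. f (torus L x)) = (\<lambda>x. \<Sum>b\<in>Basis. f b * (torus L x \<bullet> b))"
    by (intro ext f_eq)
  ultimately show ?case by metis
qed (intro trig_poly_const trig_poly.add trig_poly_mult; assumption)+

text \<open>Opposite faces of the closed box are identified with each other but never with an
  interior point: two coordinates differ by a multiple of \<open>L\<close> of absolute value below
  \<open>L\<close>. Hence one point is taken in the open cell and the other in the closed
  box.\<close>

lemma torus_inj:
  assumes L: "0 < L" and x: "x \<in> cell L" and y: "y \<in> cbox 0 (\<chi> i. L)" and eq: "torus L x = torus L y"
  shows "x = y"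
proof (rule vec_eq_iff[THEN iffD2, rule_format])
  fix i
  have x: "0 < x $ i" "x $ i < L" and y: "0 \<le> y $ i" "y $ i \<le> L"
    using x y by (auto simp: cell_iff mem_box_cart)
  have "cis (2 * pi / L * x $ i) = cis (2 * pi / L * y $ i)"
    using eq by (simp add: torus_def vec_eq_iff)
  then have "sin (2 * pi / L * x $ i) = sin (2 * pi / L * y $ i) \<and> cos (2 * pi / L * x $ i) = cos (2 * pi / L * y $ i)"
    by (auto simp: cis.ctr complex_eq_iff)
  then obtain n where n: "2 * pi / L * x $ i = 2 * pi / L * y $ i + 2 * pi * of_int n"
    unfolding sin_cos_eq_iff by auto
  then have "2 * pi / L * x $ i = 2 * pi / L * (y $ i + L * of_int n)" using L by (simp add: distrib_left)
  then have e: "x $ i = y $ i + L * of_int n" using L by simp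
  have "\<bar>x $ i - y $ i\<bar> < L" using x y by linarith
  then have "L * \<bar>of_int n\<bar> < L * 1" using e L by (simp add: abs_mult)
  then have "\<bar>of_int n :: real\<bar> < 1" using L by (simp only: mult_less_cancel_left_pos)
  then have "n = 0" by linarith
  with e show "x $ i = y $ i" by simp
qed

lemma integrable_L2per:
  fixes v :: "real^'d \<Rightarrow> real"
  assumes "0 < L" "v \<in> L2per L" shows "integrable (cell_measure L) v"
  using L2per_integrable_inner[OF assms(2) cas_L2per[of L "\<lambda>i. 0"]] assms(1) by (simp add: cas_zero)

text \<open>The indicator function of an open subset of the cell is a bounded pointwise limit of
  trigonometric polynomials, by the Stone-Weierstrass theorem on the torus.\<close>

lemma orthogonal_cas_integral_open:
  fixes v :: "real^'d \<Rightarrow> real"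
  assumes L: "0 < L" and v: "v \<in> L2per L" and orth: "\<And>m. L2inner L v (cas L m) = 0"
    and U: "open U" "U \<subseteq> cell L"
  shows "(\<integral>x. v x * indicator U x \<partial>cell_measure L) = 0"
proof -
  let ?C = "cbox 0 (\<chi> i. L) :: (real^'d) set"
  define K where "K = torus L ` (?C - U)"
  \<comment> \<open>A continuous cut-off that vanishes on the image of the complement of
    \<open>U\<close> and equals 1 at distance at least \<open>1 / n\<close> from it.\<close>
  define h where "h n z = min 1 (real n * infdist z K)" for n z
  have "compact (?C - U)" using U by (intro compact_diff compact_cbox)
  then have cK: "compact K" unfolding K_def by (intro compact_continuous_image torus_continuous)
  have cC: "compact (torus L ` ?C)" by (intro compact_continuous_image torus_continuous compact_cbox)
  \<comment> \<open>The corner 0 lies in the closed box but outside the open cell, so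
    \<open>K\<close> is nonempty; otherwise \<open>infdist\<close> would have the default value 0
    everywhere.\<close>
  have "0 \<in> ?C" "0 \<notin> cell L" using L by (auto simp: mem_box_cart cell_iff less_imp_le)
  then have Kne: "K \<noteq> {}" unfolding K_def using U by blast
  have sub: "x \<in> ?C" if "x \<in> cell L" for x :: "real^'d" using that by (auto simp: cell_def box_subset_cbox[THEN subsetD])
  have "\<exists>g. real_polynomial_function g \<and> (\<forall>z\<in>torus L ` ?C. \<bar>h n z - g z\<bar> < 1 / (real n + 1))" for n
  proof -
    have "continuous_on (torus L ` ?C) (h n)" unfolding h_def by (intro continuous_intros)
    from Stone_Weierstrass_real_polynomial_function[OF cC this, of "1 / (real n + 1)"]
    show ?thesis by (metis divide_pos_pos of_nat_0_le_iff add_nonneg_pos zero_less_one)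
  qed
  then obtain g where g: "\<And>n. real_polynomial_function (g n)"
    "\<And>n z. z \<in> torus L ` ?C \<Longrightarrow> \<bar>h n z - g n z\<bar> < 1 / (real n + 1)" by metis
  define p where "p n x = g n (torus L x)" for n x
  have tp: "trig_poly L (p n)" for n unfolding p_def by (rule trig_poly_torus_poly[OF g(1)])
  have pm: "p n \<in> borel_measurable (cell_measure L)" for n
    using tp L by (intro L2per_measurable trig_poly_L2per) auto
  have vm: "v \<in> borel_measurable (cell_measure L)" using v by (rule L2per_measurable)
  have Um: "(indicator U :: _ \<Rightarrow> real) \<in> borel_measurable (cell_measure L)"
    using U by (intro borel_measurable_cell_measure borel_measurable_indicator) auto
  have "(\<lambda>n. \<integral>x. v x * p n x \<partial>cell_measure L) \<longlonglongrightarrow> (\<integral>x. v x * indicator U x \<partial>cell_measure L)"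
  proof (rule integral_dominated_convergence[where w="\<lambda>x. 2 * \<bar>v x\<bar>"])
    show "(\<lambda>x. v x * p n x) \<in> borel_measurable (cell_measure L)" for n
      using vm pm by (intro borel_measurable_times)
    show "(\<lambda>x. v x * indicator U x) \<in> borel_measurable (cell_measure L)"
      using vm Um by (intro borel_measurable_times)
    show "integrable (cell_measure L) (\<lambda>x. 2 * \<bar>v x\<bar>)" using integrable_L2per[OF L v] by simp
    show "AE x in cell_measure L. (\<lambda>n. v x * p n x) \<longlonglongrightarrow> v x * indicator U x"
    proof (rule AE_I2)
      fix x :: "real^'d" assume "x \<in> space (cell_measure L)"
      then have x: "x \<in> cell L" by (simp add: space_cell_measure)
      have lim: "(\<lambda>n. h n (torus L x)) \<longlonglongrightarrow> indicator U x"
      proof (cases "x \<in> U")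
        case True
        have "torus L x \<notin> K"
        proof
          assume "torus L x \<in> K"
          then obtain y where "y \<in> ?C" "y \<notin> U" "torus L x = torus L y" unfolding K_def by blast
          with torus_inj[OF L x] True show False by blast
        qed
        then have "0 < infdist (torus L x) K"
          using in_closed_iff_infdist_zero[OF compact_imp_closed[OF cK] Kne] infdist_nonneg[of "torus L x" K]
          by (metis order_le_less)
        then obtain N :: nat where N: "1 < real N * infdist (torus L x) K"
          using reals_Archimedean3 by blast
        have "1 \<le> real n * infdist (torus L x) K" if "N \<le> n" for n
          using N mult_right_mono[of "real N" "real n" "infdist (torus L x) K"] that infdist_nonneg[of "torus L x" K]
          by linarith
        then have "h n (torus L x) = indicator U x" if "N \<le> n" for n
          using True that by (simp add: h_def min_absorb1)
        then have "\<forall>\<^sub>F n in sequentially. h n (torus L x) = indicator U x"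
          unfolding eventually_sequentially by blast
        then show ?thesis by (rule tendsto_eventually)
      next
        case False
        then have "torus L x \<in> K" unfolding K_def using x sub by blast
        then have "h n (torus L x) = 0" for n by (simp add: h_def)
        then show ?thesis using False by simp
      qed
      have "(\<lambda>n. p n x - h n (torus L x)) \<longlonglongrightarrow> 0"
      proof (rule Lim_null_comparison)
        show "\<forall>\<^sub>F n in sequentially. norm (p n x - h n (torus L x)) \<le> 1 / (real n + 1)"
          using g(2) sub[OF x] unfolding p_def
          by (intro always_eventually allI) (simp add: abs_minus_commute less_imp_le)
        show "(\<lambda>n. 1 / (real n + 1)) \<longlonglongrightarrow> 0"
          using LIMSEQ_ignore_initial_segment[OF lim_const_over_n[of "1::real"], of 1] by (simp add: add.commute)
      qed
      from tendsto_add[OF this lim] have "(\<lambda>n. p n x) \<longlonglongrightarrow> indicator U x" by simp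
      then show "(\<lambda>n. v x * p n x) \<longlonglongrightarrow> v x * indicator U x" by (rule tendsto_mult_left)
    qed
    show "AE x in cell_measure L. norm (v x * p n x) \<le> 2 * \<bar>v x\<bar>" for n
    proof (rule AE_I2)
      fix x :: "real^'d" assume "x \<in> space (cell_measure L)"
      then have "torus L x \<in> torus L ` ?C" using sub by (auto simp: space_cell_measure)
      then have "\<bar>h n (torus L x) - p n x\<bar> < 1 / (real n + 1)" unfolding p_def by (rule g(2))
      also have "\<dots> \<le> 1" by simp
      finally have "\<bar>p n x\<bar> \<le> 2"
        using infdist_nonneg[of "torus L x" K] unfolding h_def
        by (smt (verit, best) min.cobounded1 min_def mult_nonneg_nonneg of_nat_0_le_iff)
      then show "norm (v x * p n x) \<le> 2 * \<bar>v x\<bar>"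
        using mult_right_mono[of "\<bar>p n x\<bar>" 2 "\<bar>v x\<bar>"] by (simp add: abs_mult mult.commute)
    qed
  qed
  moreover have "(\<integral>x. v x * p n x \<partial>cell_measure L) = 0" for n
    using trig_poly_L2inner_eq_0[OF tp _ v orth, of n] L by (simp add: L2inner_eq)
  ultimately show ?thesis by (simp add: LIMSEQ_const_iff)
qed

text \<open>The integral of \<open>v\<close> vanishes over open subsets of the cell. Open sets form
  an intersection-stable generator of the Borel sets, so it vanishes over all Borel sets, which
  forces the density to be zero.\<close>

theorem cas_complete:
  fixes v :: "real^'d \<Rightarrow> real"
  assumes L: "0 < L" and v: "v \<in> L2per L" and orth: "\<And>m. L2inner L v (cas L m) = 0"
  shows "AE x in cell_measure L. v x = 0"
proof -
  define w where "w x = indicator (cell L) x *\<^sub>R v x" for x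
  have iw: "integrable lborel w"
    using integrable_L2per[OF L v] unfolding set_integrable_cell_iff[symmetric] w_def set_integrable_def .
  have siw: "set_integrable lborel A w" if "A \<in> sets borel" for A
    using integrable_mult_indicator[of A lborel w] that iw unfolding set_integrable_def by simp
  have open0: "set_lebesgue_integral lborel U w = 0" if "open U" for U
  proof -
    have "open (U \<inter> cell L)" using that by (auto simp: cell_def open_box)
    then have "0 = (\<integral>x. v x * indicator (U \<inter> cell L) x \<partial>cell_measure L)"
      by (intro orthogonal_cas_integral_open[OF L v orth, symmetric]) auto
    also have "\<dots> = set_lebesgue_integral lborel U w"
      unfolding set_integral_cell_eq[symmetric] unfolding set_lebesgue_integral_def w_def
      by (intro Bochner_Integration.integral_cong refl) (auto simp: indicator_def)
    finally show ?thesis by simp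
  qed
  have all0: "set_lebesgue_integral lborel A w = 0" if "A \<in> sets lborel" for A
  proof -
    have b: "sigma_sets UNIV {U::(real^'d) set. open U} = sets borel"
      by (simp add: borel_def)
    have A: "A \<in> sigma_sets UNIV {U::(real^'d) set. open U}" using that by (simp add: b)
    show ?thesis
    proof (rule sigma_sets_induct_disjoint[OF _ _ A])
      show "Int_stable {U::(real^'d) set. open U}" by (auto simp: Int_stable_def)
      show "set_lebesgue_integral lborel B w = 0" if "B \<in> {U. open U}" for B
        using that open0 by auto
      show "set_lebesgue_integral lborel (UNIV - B) w = 0"
        if "B \<in> sigma_sets UNIV {U. open U}" "set_lebesgue_integral lborel B w = 0" for B
      proof -
        have B: "B \<in> sets borel" "UNIV - B \<in> sets borel" using that unfolding b by (auto intro: sets.Diff[of UNIV])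
        have "set_lebesgue_integral lborel (B \<union> (UNIV - B)) w
            = set_lebesgue_integral lborel B w + set_lebesgue_integral lborel (UNIV - B) w"
          using B by (intro set_integral_Un siw) auto
        then show ?thesis using that open0[of UNIV] by simp
      qed
      show "set_lebesgue_integral lborel (\<Union>i. B i) w = 0"
        if "disjoint_family B" "range B \<subseteq> sigma_sets UNIV {U. open U}"
          "\<And>i. set_lebesgue_integral lborel (B i) w = 0" for B :: "nat \<Rightarrow> (real^'d) set"
      proof -
        have B: "B i \<in> sets borel" for i using that unfolding b by auto
        have "set_lebesgue_integral lborel (\<Union>i. B i) w = (\<Sum>i. set_lebesgue_integral lborel (B i) w)"
          using that(1) B by (intro lebesgue_integral_countable_add siw) (auto simp: disjoint_family_on_def)
        then show ?thesis using that(3) by simp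
      qed
    qed (auto simp: set_lebesgue_integral_def)
  qed
  have "AE x in lborel. w x = 0" by (rule sigma_finite_measure.density_zero[OF lborel.sigma_finite_measure_axioms iw all0])
  then have "AE x in cell_measure L. w x = 0" by (rule AE_lborel_cell_measure)
  then show ?thesis
    using AE_space by eventually_elim (simp add: w_def space_cell_measure)
qed

section \<open>Completeness of the space and Fourier expansions\<close>

text \<open>Cauchy-Schwarz against the constant 1 turns summable L2 increments into an integrable
  series of absolute increments, which is then finite almost everywhere.\<close>

lemma AE_convergent_of_summable_L2norm_increments:
  fixes T :: "nat \<Rightarrow> real^'d \<Rightarrow> real"
  assumes T: "\<And>j. T j \<in> L2per L"
    and sm: "summable (\<lambda>j. L2norm L (T (Suc j) - T j))" and L: "0 < L"
  shows "AE x in cell_measure L. convergent (\<lambda>j. T j x)"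
proof -
  let ?M = "cell_measure L :: (real^'d) measure"
  define D where "D j x = \<bar>T (Suc j) x - T j x\<bar>" for j x
  have TD: "T (Suc j) - T j \<in> L2per L" for j by (intro L2per_diff' T)
  have Tm [measurable]: "T j \<in> borel_measurable ?M" for j by (rule L2per_measurable[OF T])
  have Dm [measurable]: "D j \<in> borel_measurable ?M" for j unfolding D_def by measurable
  define c where "c = L2norm L (\<lambda>x::real^'d. 1::real)"
  have one: "(\<lambda>x::real^'d. 1::real) \<in> L2per L"
    using cas_L2per[of L "\<lambda>i. 0"] L by (simp add: cas_zero[abs_def] cong: if_cong)
  have D0: "0 \<le> D j x" for j x by (simp add: D_def)
  have D_L2: "D j \<in> L2per L" for j
  proof -
    have "D j \<in> borel_measurable borel" using T[of j] T[of "Suc j"] unfolding L2per_iff D_def by auto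
    moreover have "periodic L (D j)" using T unfolding L2per_iff D_def periodic_def by auto
    moreover have "integrable ?M (\<lambda>x. (norm (D j x))\<^sup>2)" using TD[of j] unfolding L2per_iff D_def by simp
    ultimately show ?thesis by (simp add: L2per_iff)
  qed
  have ID: "(\<integral>\<^sup>+x. ennreal (D j x) \<partial>?M) \<le> ennreal (c * L2norm L (T (Suc j) - T j))" for j
  proof -
    have "(\<integral>\<^sup>+x. ennreal (D j x) \<partial>?M) = ennreal (\<integral>x. D j x \<partial>?M)"
      by (intro nn_integral_eq_integral integrable_L2per[OF L D_L2] AE_I2 D0)
    also have "(\<integral>x. D j x \<partial>?M) = L2inner L (\<lambda>x. 1) (D j)" by (simp add: L2inner_eq)
    also have "\<dots> \<le> c * L2norm L (D j)" using L2_Cauchy_Schwarz[OF one D_L2, of j] unfolding c_def by linarith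
    also have "L2norm L (D j) = L2norm L (T (Suc j) - T j)"
      by (simp add: L2norm_def L2inner_eq D_def)
    finally show ?thesis by (simp add: ennreal_leI)
  qed
  have "(\<integral>\<^sup>+x. (\<Sum>j. ennreal (D j x)) \<partial>?M) = (\<Sum>j. \<integral>\<^sup>+x. ennreal (D j x) \<partial>?M)"
    by (rule nn_integral_suminf) auto
  also have "\<dots> \<le> (\<Sum>j. ennreal (c * L2norm L (T (Suc j) - T j)))"
    by (intro suminf_le ID) auto
  also have "\<dots> = ennreal (\<Sum>j. c * L2norm L (T (Suc j) - T j))"
    using sm by (intro suminf_ennreal2) (auto simp: c_def intro: summable_mult)
  finally have "(\<integral>\<^sup>+x. (\<Sum>j. ennreal (D j x)) \<partial>?M) \<noteq> \<infinity>"
    by (auto simp: top_unique)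
  then have "AE x in ?M. (\<Sum>j. ennreal (D j x)) \<noteq> \<infinity>"
    by (intro nn_integral_PInf_AE) auto
  then show ?thesis
  proof eventually_elim
    case (elim x)
    have "summable (\<lambda>j. D j x)"
      using elim by (intro summable_suminf_not_top) (auto simp: D_def)
    then have "summable (\<lambda>j. T (Suc j) x - T j x)" unfolding D_def by (rule summable_rabs_cancel)
    then have "convergent (\<lambda>n. (\<Sum>j<n. T (Suc j) x - T j x) + T 0 x)"
      unfolding summable_iff_convergent by (intro convergent_add convergent_const)
    then show ?case by (simp add: sum_lessThan_telescope[of "\<lambda>j. T j x"])
  qed
qed

text \<open>A rapidly Cauchy subsequence converges almost everywhere, and Fatou's lemma upgrades
  this to convergence in norm. The limit must be a function that is periodic at every point.\<close>

theorem L2per_complete: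
  fixes S :: "nat \<Rightarrow> real^'d \<Rightarrow> real"
  assumes L: "0 < L" and S: "\<And>n. S n \<in> L2per L"
    and cauchy: "\<And>e. 0 < e \<Longrightarrow> \<exists>N. \<forall>m\<ge>N. \<forall>n\<ge>N. L2norm L (S m - S n) \<le> e"
  obtains g where "g \<in> L2per L" "(\<lambda>n. L2norm L (g - S n)) \<longlonglongrightarrow> 0"
proof -
  let ?M = "cell_measure L :: (real^'d) measure"
  obtain N where N: "\<And>j m n. N j \<le> m \<Longrightarrow> N j \<le> n \<Longrightarrow> L2norm L (S m - S n) \<le> (1/2)^j"
    using cauchy[of "(1/2)^j" for j] by (metis zero_less_power half_gt_zero zero_less_one)
  \<comment> \<open>The running maximum makes the indices nondecreasing, and the summand
    \<open>j\<close> sends them to infinity.\<close>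
  define R where "R j = Max (N ` {..j}) + j" for j
  have R: "N j \<le> R j" "j \<le> R j" "R j \<le> R (Suc j)" for j
  proof -
    show "N j \<le> R j" unfolding R_def by (intro trans_le_add1 Max_ge) auto
    show "j \<le> R j" by (simp add: R_def)
    have "Max (N ` {..j}) \<le> Max (N ` {..Suc j})" by (intro Max_mono) auto
    then show "R j \<le> R (Suc j)" unfolding R_def by linarith
  qed
  define T where "T j = S (R j)" for j
  have le: "L2norm L (T (Suc j) - T j) \<le> (1/2)^j" for j
    unfolding T_def using R[of j] by (intro N) auto
  have "summable (\<lambda>j. L2norm L (T (Suc j) - T j))"
  proof (rule summable_comparison_test')
    show "summable (\<lambda>j. (1/2::real)^j)" by (simp add: summable_geometric)
    show "norm (L2norm L (T (Suc j) - T j)) \<le> (1/2)^j" if "0 \<le> j" for j using le[of j] by simp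
  qed
  then have conv: "AE x in ?M. convergent (\<lambda>j. T j x)"
    using S L by (intro AE_convergent_of_summable_L2norm_increments) (auto simp: T_def)
  \<comment> \<open>\<open>lim\<close> has some value even where the sequence diverges, and that
    value depends on the sequence only. Hence \<open>g\<close> is periodic and Borel everywhere, not
    merely outside a null set.\<close>
  define g where "g x = lim (\<lambda>j. T j x)" for x
  have Tb [measurable]: "T j \<in> borel_measurable borel" for j using S by (auto simp: T_def L2per_iff)
  have gb [measurable]: "g \<in> borel_measurable borel" unfolding g_def by measurable
  have gp: "periodic L g" using S by (simp add: g_def periodic_def T_def L2per_iff)
  \<comment> \<open>Fatou along the subsequence \<open>T\<close> passes the Cauchy bound to the
    limit.\<close>
  have main: "(\<integral>\<^sup>+x. ennreal ((norm (g x - S n x))\<^sup>2) \<partial>?M) \<le> ennreal (e\<^sup>2)"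
    if e: "0 < e" and K: "\<forall>m\<ge>K. \<forall>n\<ge>K. L2norm L (S m - S n) \<le> e" and n: "K \<le> n" for e K n
  proof -
    have Sm [measurable]: "S n \<in> borel_measurable ?M" "T j \<in> borel_measurable ?M" for j
      using L2per_measurable[OF S] by (auto simp: T_def)
    have "(\<integral>\<^sup>+x. ennreal ((norm (g x - S n x))\<^sup>2) \<partial>?M)
        = (\<integral>\<^sup>+x. liminf (\<lambda>j. ennreal ((norm (T j x - S n x))\<^sup>2)) \<partial>?M)"
    proof (rule nn_integral_cong_AE)
      show "AE x in ?M. ennreal ((norm (g x - S n x))\<^sup>2) = liminf (\<lambda>j. ennreal ((norm (T j x - S n x))\<^sup>2))"
        using conv
      proof eventually_elim
        case (elim x)
        then have "(\<lambda>j. T j x) \<longlonglongrightarrow> g x" unfolding g_def by (simp add: convergent_LIMSEQ_iff)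
        then have "(\<lambda>j. ennreal ((norm (T j x - S n x))\<^sup>2)) \<longlonglongrightarrow> ennreal ((norm (g x - S n x))\<^sup>2)"
          by (intro tendsto_intros)
        then show ?case by (intro lim_imp_Liminf[symmetric]) auto
      qed
    qed
    also have "\<dots> \<le> liminf (\<lambda>j. \<integral>\<^sup>+x. ennreal ((norm (T j x - S n x))\<^sup>2) \<partial>?M)"
      by (intro nn_integral_liminf) measurable
    also have "\<dots> \<le> liminf (\<lambda>j. ennreal (e\<^sup>2))"
    proof (rule Liminf_mono)
      have "(\<integral>\<^sup>+x. ennreal ((norm (T j x - S n x))\<^sup>2) \<partial>?M) \<le> ennreal (e\<^sup>2)" if "K \<le> j" for j
      proof -
        have d: "T j - S n \<in> L2per L" using S by (auto simp: T_def intro: L2per_diff')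
        have "(\<integral>\<^sup>+x. ennreal ((norm (T j x - S n x))\<^sup>2) \<partial>?M) = ennreal ((L2norm L (T j - S n))\<^sup>2)"
          using nn_integral_L2norm[OF d] by simp
        also have "\<dots> \<le> ennreal (e\<^sup>2)"
          using K n that R(2)[of j] e unfolding T_def
          by (intro ennreal_leI power_mono) auto
        finally show ?thesis .
      qed
      then show "\<forall>\<^sub>F j in sequentially. (\<integral>\<^sup>+x. ennreal ((norm (T j x - S n x))\<^sup>2) \<partial>?M) \<le> ennreal (e\<^sup>2)"
        unfolding eventually_sequentially by blast
    qed
    finally show ?thesis by (simp add: Liminf_const)
  qed
  have diff: "g - S n \<in> L2per L \<and> L2norm L (g - S n) \<le> e"
    if e: "0 < e" and K: "\<forall>m\<ge>K. \<forall>n\<ge>K. L2norm L (S m - S n) \<le> e" and n: "K \<le> n" for e K n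
  proof -
    have "(\<lambda>x. (norm (g x - S n x))\<^sup>2) \<in> borel_measurable ?M"
      using L2per_measurable[OF S, of n] borel_measurable_cell_measure[OF gb] by measurable
    then have i: "integrable ?M (\<lambda>x. (norm (g x - S n x))\<^sup>2)"
      using main[OF that] by (intro integrableI_bounded) (auto simp: top_unique less_top[symmetric])
    have "(\<lambda>x. g x - S n x) \<in> borel_measurable borel"
      using gb S[of n] by (intro borel_measurable_diff) (auto simp: L2per_iff)
    then have 1: "g - S n \<in> L2per L"
      using i gp S[of n] by (auto simp: L2per_iff periodic_def fun_diff_def)
    have "ennreal ((L2norm L (g - S n))\<^sup>2) = (\<integral>\<^sup>+x. ennreal ((norm (g x - S n x))\<^sup>2) \<partial>?M)"
      using nn_integral_L2norm[OF 1] by simp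
    also have "\<dots> \<le> ennreal (e\<^sup>2)" by (rule main[OF that])
    finally have "(L2norm L (g - S n))\<^sup>2 \<le> e\<^sup>2" by simp
    then have "L2norm L (g - S n) \<le> e" by (rule power2_le_imp_le) (use e in simp)
    with 1 show ?thesis by simp
  qed
  show ?thesis
  proof
    obtain K where K: "\<forall>m\<ge>K. \<forall>n\<ge>K. L2norm L (S m - S n) \<le> 1" using cauchy[of 1] by auto
    have "g - S K \<in> L2per L" using diff[OF _ K, of K] by simp
    from L2per_add[OF this S[of K]] show "g \<in> L2per L" by simp
    show "(\<lambda>n. L2norm L (g - S n)) \<longlonglongrightarrow> 0"
    proof (rule LIMSEQ_I)
      fix e :: real assume e: "0 < e"
      obtain K where K: "\<forall>m\<ge>K. \<forall>n\<ge>K. L2norm L (S m - S n) \<le> e / 2" using cauchy[of "e/2"] e by auto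
      have "norm (L2norm L (g - S n) - 0) < e" if "K \<le> n" for n
        using diff[OF _ K that] e by simp
      then show "\<exists>K. \<forall>n\<ge>K. norm (L2norm L (g - S n) - 0) < e" by blast
    qed
  qed
qed

section \<open>Fourier partial sums over cubes of frequencies\<close>

definition modes :: "nat \<Rightarrow> ('d \<Rightarrow> int) set" where
  "modes n = {m. \<forall>i. \<bar>m i\<bar> \<le> int n}"

lemma finite_modes [simp]: "finite (modes n :: ('d::finite \<Rightarrow> int) set)"
proof -
  have "modes n = (UNIV :: 'd set) \<rightarrow>\<^sub>E {- int n..int n}"
    by (auto simp: modes_def PiE_def Pi_def abs_le_iff) (smt (verit))+
  then show ?thesis by (simp add: finite_PiE)
qed

lemma modes_mono: "n \<le> n' \<Longrightarrow> modes n \<subseteq> modes n'"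
  by (auto simp: modes_def intro: order_trans)

lemma ex_modes: "\<exists>N. \<forall>n\<ge>N. (m::'d::finite \<Rightarrow> int) \<in> modes n"
proof -
  define N where "N = nat (Max (range (\<lambda>i. \<bar>m i\<bar>)))"
  have "\<bar>m i\<bar> \<le> int N" for i
  proof -
    have "\<bar>m i\<bar> \<le> Max (range (\<lambda>i. \<bar>m i\<bar>))" by (rule Max_ge) auto
    then show ?thesis unfolding N_def by linarith
  qed
  then have "\<bar>m i\<bar> \<le> int n" if "N \<le> n" for n i
    using that by (meson of_nat_mono order_trans)
  then show ?thesis by (auto simp: modes_def)
qed

text \<open>Differentiation exchanges \<open>m\<close> and \<open>- m\<close>. Cubes are symmetric,
  so this exchange already works at the level of partial sums.\<close>

lemma sum_modes_minus: "(\<Sum>m\<in>modes n. h (- m)) = (\<Sum>m\<in>modes n. h m)"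
  by (rule sum.reindex_bij_witness[where i=uminus and j=uminus]) (auto simp: modes_def)

lemma cas_scale_L2per: "L \<noteq> 0 \<Longrightarrow> (\<lambda>x. c * cas L m x) \<in> L2per L"
  using L2per_scaleR[of "cas L m" L c] by simp

lemma cas_sum_L2per: "L \<noteq> 0 \<Longrightarrow> (\<lambda>x. \<Sum>m\<in>A. c m * cas L m x) \<in> L2per L"
  by (intro L2per_sum cas_scale_L2per)

lemma L2inner_cas_sum_left:
  assumes "L \<noteq> 0" "w \<in> L2per L"
  shows "L2inner L (\<lambda>x. \<Sum>m\<in>A. c m * cas L m x) w = (\<Sum>m\<in>A. c m * L2inner L (cas L m) w)"
proof -
  have "L2inner L (\<lambda>x. \<Sum>m\<in>A. c m * cas L m x) w = (\<Sum>m\<in>A. L2inner L (\<lambda>x. c m * cas L m x) w)"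
    using assms by (intro L2inner_sum_left cas_scale_L2per) auto
  also have "\<dots> = (\<Sum>m\<in>A. c m * L2inner L (cas L m) w)"
    using L2inner_scaleR_left[of L _ "cas L _" w] by simp
  finally show ?thesis .
qed

lemma L2inner_cas_sum_cas:
  fixes k :: "'d::finite \<Rightarrow> int"
  assumes "0 < L" "finite A"
  shows "L2inner L (\<lambda>x. \<Sum>m\<in>A. c m * cas L m x) (cas L k)
    = (if k \<in> A then c k * cell_vol L TYPE(real^'d) else 0)"
  using assms by (simp add: L2inner_cas_sum_left cas_orthogonal if_distrib[of "\<lambda>x. _ * x"] cong: if_cong)

lemma L2norm_cas_sum:
  fixes c :: "('d::finite \<Rightarrow> int) \<Rightarrow> real"
  assumes "0 < L" "finite A"
  shows "(L2norm L (\<lambda>x. \<Sum>m\<in>A. c m * cas L m x))\<^sup>2 = cell_vol L TYPE(real^'d) * (\<Sum>m\<in>A. (c m)\<^sup>2)"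
proof -
  let ?S = "\<lambda>x. \<Sum>m\<in>A. c m * cas L m x"
  have "(L2norm L ?S)\<^sup>2 = (\<Sum>m\<in>A. c m * L2inner L ?S (cas L m))"
    unfolding L2norm_sq using assms
    by (subst L2inner_cas_sum_left) (auto simp: cas_sum_L2per L2inner_commute)
  also have "\<dots> = (\<Sum>m\<in>A. cell_vol L TYPE(real^'d) * (c m)\<^sup>2)"
    using assms by (intro sum.cong refl) (simp add: L2inner_cas_sum_cas power2_eq_square)
  finally show ?thesis by (simp add: sum_distrib_left)
qed

text \<open>\<open>a m\<close> is meant to be the inner product with the unnormalised
  \<open>cas L m\<close>, whose squared norm is the volume; this explains the division.\<close>

definition fourier_sum :: "real \<Rightarrow> (('d \<Rightarrow> int) \<Rightarrow> real) \<Rightarrow> nat \<Rightarrow> real^'d \<Rightarrow> real" where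
  "fourier_sum L a n x = (\<Sum>m\<in>modes n. a m / cell_vol L TYPE(real^'d) * cas L m x)"

lemma fourier_sum_L2per [simp]: "0 < L \<Longrightarrow> fourier_sum L a n \<in> L2per L"
  unfolding fourier_sum_def[abs_def] by (intro cas_sum_L2per) simp

lemma L2inner_tendsto:
  assumes "(\<lambda>n. L2norm L (g - S n)) \<longlonglongrightarrow> 0" "g \<in> L2per L" "\<And>n. S n \<in> L2per L" "w \<in> L2per L"
  shows "(\<lambda>n. L2inner L (S n) w) \<longlonglongrightarrow> L2inner L g w"
proof (rule LIM_zero_cancel, rule Lim_null_comparison)
  show "\<forall>\<^sub>F n in sequentially. norm (L2inner L (S n) w - L2inner L g w) \<le> L2norm L (g - S n) * L2norm L w"
    using assms(2-) L2_Cauchy_Schwarz[OF L2per_diff'[OF assms(2,3)] assms(4)]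
    by (intro always_eventually allI) (simp add: L2inner_diff_left abs_minus_commute)
  show "(\<lambda>n. L2norm L (g - S n) * L2norm L w) \<longlonglongrightarrow> 0"
    using tendsto_mult_right[OF assms(1), of "L2norm L w"] by simp
qed

text \<open>By orthogonality, the squared distance of two partial sums is an increment of the
  bounded monotone sequence \<open>s\<close>, divided by the volume.\<close>

theorem Riesz_Fischer:
  fixes a :: "('d::finite \<Rightarrow> int) \<Rightarrow> real"
  assumes L: "0 < L" and K: "\<And>n. (\<Sum>m\<in>modes n. (a m)\<^sup>2) \<le> K"
  obtains g where "g \<in> L2per L" "(\<lambda>n. L2norm L (g - fourier_sum L a n)) \<longlonglongrightarrow> 0"
    "\<And>m. L2inner L g (cas L m) = a m"
proof -
  define V where "V = cell_vol L TYPE(real^'d)"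
  have V: "0 < V" unfolding V_def by (rule cell_vol_pos[OF L])
  define s where "s n = (\<Sum>m\<in>modes n. (a m)\<^sup>2)" for n
  have smono: "s n \<le> s n'" if "n \<le> n'" for n n'
    unfolding s_def using modes_mono[OF that] by (intro sum_mono2) auto
  then have "incseq s" by (simp add: incseq_def)
  moreover have "\<forall>n. s n \<le> K" using K by (simp add: s_def)
  ultimately have "Cauchy s"
    by (metis incseq_convergent LIMSEQ_imp_Cauchy)
  have dist: "(L2norm L (fourier_sum L a n' - fourier_sum L a n))\<^sup>2 = (s n' - s n) / V" if "n \<le> n'" for n n'
  proof -
    have eq: "fourier_sum L a n' - fourier_sum L a n = (\<lambda>x. \<Sum>m\<in>modes n' - modes n. a m / V * cas L m x)"
      unfolding fourier_sum_def[abs_def] V_def[symmetric] fun_diff_def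
      using modes_mono[OF that] by (subst sum_diff) auto
    have "(L2norm L (fourier_sum L a n' - fourier_sum L a n))\<^sup>2 = V * (\<Sum>m\<in>modes n' - modes n. (a m / V)\<^sup>2)"
      unfolding eq V_def using L by (intro L2norm_cas_sum) auto
    also have "\<dots> = (\<Sum>m\<in>modes n' - modes n. (a m)\<^sup>2) / V"
      using V by (simp add: power_divide sum_divide_distrib[symmetric] power2_eq_square)
    also have "(\<Sum>m\<in>modes n' - modes n. (a m)\<^sup>2) = s n' - s n"
      unfolding s_def using modes_mono[OF that] by (intro sum_diff) auto
    finally show ?thesis .
  qed
  have cauchy: "\<exists>N. \<forall>m\<ge>N. \<forall>n\<ge>N. L2norm L (fourier_sum L a m - fourier_sum L a n) \<le> e" if e: "0 < e" for e
  proof -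
    have "0 < V * e\<^sup>2" using V e by simp
    then obtain N where N: "\<forall>m\<ge>N. \<forall>n\<ge>N. norm (s m - s n) < V * e\<^sup>2"
      using CauchyD[OF \<open>Cauchy s\<close>] by blast
    have *: "L2norm L (fourier_sum L a m - fourier_sum L a n) \<le> e" if "N \<le> n" "n \<le> m" for m n
    proof (rule power2_le_imp_le)
      have "s m - s n \<le> V * e\<^sup>2" using N that smono[OF that(2)] by (smt (verit) le_trans real_norm_def)
      then show "(L2norm L (fourier_sum L a m - fourier_sum L a n))\<^sup>2 \<le> e\<^sup>2"
        unfolding dist[OF that(2)] using V by (simp add: divide_le_eq mult.commute)
    qed (use e in simp)
    then show ?thesis by (metis L2norm_minus_commute linorder_linear)
  qed
  obtain g where g: "g \<in> L2per L" "(\<lambda>n. L2norm L (g - fourier_sum L a n)) \<longlonglongrightarrow> 0"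
    by (rule L2per_complete[OF L fourier_sum_L2per[OF L] cauchy])
  have "L2inner L g (cas L m) = a m" for m
  proof -
    have "(\<lambda>n. L2inner L (fourier_sum L a n) (cas L m)) \<longlonglongrightarrow> L2inner L g (cas L m)"
      using g L by (intro L2inner_tendsto) auto
    moreover obtain N where N: "\<forall>n\<ge>N. m \<in> modes n" using ex_modes by blast
    have "L2inner L (fourier_sum L a n) (cas L m) = a m" if "N \<le> n" for n
      using N that L V unfolding fourier_sum_def[abs_def] V_def[symmetric]
      by (subst L2inner_cas_sum_cas) (auto simp: V_def)
    then have "(\<lambda>n. L2inner L (fourier_sum L a n) (cas L m)) \<longlonglongrightarrow> a m"
      by (intro tendsto_eventually) (auto simp: eventually_sequentially)
    ultimately show ?thesis by (rule LIMSEQ_unique)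
  qed
  with g show ?thesis by (rule that)
qed

lemma Bessel:
  fixes v :: "real^'d \<Rightarrow> real"
  assumes L: "0 < L" and v: "v \<in> L2per L" and A: "finite A"
  shows "(\<Sum>m\<in>A. (L2inner L v (cas L m))\<^sup>2) \<le> cell_vol L TYPE(real^'d) * (L2norm L v)\<^sup>2"
proof -
  define V where "V = cell_vol L TYPE(real^'d)"
  have V: "0 < V" unfolding V_def by (rule cell_vol_pos[OF L])
  let ?a = "\<lambda>m. L2inner L v (cas L m)"
  let ?w = "\<lambda>x. \<Sum>m\<in>A. ?a m / V * cas L m x"
  have w: "?w \<in> L2per L" using L by (intro cas_sum_L2per) auto
  have 1: "L2inner L v ?w = (\<Sum>m\<in>A. (?a m)\<^sup>2) / V"
    using L v by (subst L2inner_commute, subst L2inner_cas_sum_left)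
      (auto simp: L2inner_commute[of L v] sum_divide_distrib power2_eq_square)
  have 2: "(L2norm L ?w)\<^sup>2 = (\<Sum>m\<in>A. (?a m)\<^sup>2) / V"
    unfolding L2norm_cas_sum[OF L A] V_def[symmetric]
    using V by (simp add: power_divide sum_divide_distrib[symmetric] power2_eq_square)
  have "0 \<le> (L2norm L (v - ?w))\<^sup>2" by simp
  also have "\<dots> = (L2norm L v)\<^sup>2 - (\<Sum>m\<in>A. (?a m)\<^sup>2) / V"
    unfolding L2norm_sq_diff[OF v w] 1 2 by simp
  finally show ?thesis using V by (simp add: V_def[symmetric] divide_le_eq mult.commute)
qed

text \<open>Bessel's inequality yields some limit of the series with the coefficients of
  \<open>v\<close>; completeness of the basis identifies this limit with \<open>v\<close> almost
  everywhere.\<close>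

lemma fourier_sum_tendsto:
  fixes v :: "real^'d \<Rightarrow> real"
  assumes L: "0 < L" and v: "v \<in> L2per L"
  shows "(\<lambda>n. L2norm L (v - fourier_sum L (\<lambda>m. L2inner L v (cas L m)) n)) \<longlonglongrightarrow> 0"
proof -
  let ?a = "\<lambda>m. L2inner L v (cas L m)"
  obtain g where g: "g \<in> L2per L" "(\<lambda>n. L2norm L (g - fourier_sum L ?a n)) \<longlonglongrightarrow> 0"
    "\<And>m. L2inner L g (cas L m) = ?a m"
    using Riesz_Fischer[OF L Bessel[OF L v finite_modes]] by blast
  have "AE x in cell_measure L. (v - g) x = 0"
    using L v g by (intro cas_complete[OF L, of "v - g"] L2per_diff') (auto simp: L2inner_diff_left)
  then have ae: "AE x in cell_measure L. (v - fourier_sum L ?a n) x = (g - fourier_sum L ?a n) x" for n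
    by eventually_elim simp
  have "L2norm L (v - fourier_sum L ?a n) = L2norm L (g - fourier_sum L ?a n)" for n
    using v g L by (intro L2norm_cong_AE[OF _ _ ae] L2per_diff') auto
  then show ?thesis using g(2) by simp
qed

text \<open>Stated as a limit along cubes, so that identities between finite sums can be transferred
  by uniqueness of limits.\<close>

theorem Parseval:
  fixes v w :: "real^'d \<Rightarrow> real"
  assumes L: "0 < L" and v: "v \<in> L2per L" and w: "w \<in> L2per L"
  shows "(\<lambda>n. (\<Sum>m\<in>modes n. L2inner L v (cas L m) * L2inner L w (cas L m)) / cell_vol L TYPE(real^'d))
    \<longlonglongrightarrow> L2inner L v w"
proof -
  have "(\<lambda>n. L2inner L (fourier_sum L (\<lambda>m. L2inner L v (cas L m)) n) w) \<longlonglongrightarrow> L2inner L v w"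
    using L2inner_tendsto[OF fourier_sum_tendsto[OF L v] v _ w] L by simp
  moreover have "L2inner L (fourier_sum L (\<lambda>m. L2inner L v (cas L m)) n) w
      = (\<Sum>m\<in>modes n. L2inner L v (cas L m) * L2inner L w (cas L m)) / cell_vol L TYPE(real^'d)" for n
    using L w unfolding fourier_sum_def[abs_def]
    by (subst L2inner_cas_sum_left) (auto simp: sum_divide_distrib L2inner_commute[of L w])
  ultimately show ?thesis by simp
qed

section \<open>Weak derivatives\<close>

lemma L2per_integrable_scaleR:
  fixes v :: "real^'d \<Rightarrow> 'b::euclidean_space"
  assumes "\<phi> \<in> L2per L" "v \<in> L2per L"
  shows "integrable (cell_measure L) (\<lambda>x. \<phi> x *\<^sub>R v x)"
proof (rule Bochner_Integration.integrable_bound)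
  show "integrable (cell_measure L) (\<lambda>x. (norm (\<phi> x))\<^sup>2 + (norm (v x))\<^sup>2)"
    using assms by (auto simp: L2per_iff)
  show "(\<lambda>x. \<phi> x *\<^sub>R v x) \<in> borel_measurable (cell_measure L)"
    using assms[THEN L2per_measurable] by measurable
  have le: "norm (\<phi> x *\<^sub>R v x) \<le> (norm (\<phi> x))\<^sup>2 + (norm (v x))\<^sup>2" for x
  proof -
    have "2 * (norm (\<phi> x) * norm (v x)) \<le> (norm (\<phi> x))\<^sup>2 + (norm (v x))\<^sup>2"
      using sum_squares_bound[of "norm (\<phi> x)" "norm (v x)"] by simp
    moreover have "0 \<le> norm (\<phi> x) * norm (v x)" by (intro mult_nonneg_nonneg norm_ge_zero)
    ultimately show ?thesis unfolding norm_scaleR real_norm_def by linarith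
  qed
  show "AE x in cell_measure L. norm (\<phi> x *\<^sub>R v x) \<le> norm ((norm (\<phi> x))\<^sup>2 + (norm (v x))\<^sup>2)"
    using le by (intro AE_I2) (simp del: norm_scaleR)
qed

lemma has_weak_pd_diff:
  fixes v w :: "real^'d \<Rightarrow> 'b::euclidean_space"
  assumes "has_weak_pd L i v g" "has_weak_pd L i w h"
  shows "has_weak_pd L i (v - w) (g - h)"
proof -
  have m: "v \<in> L2per L" "g \<in> L2per L" "w \<in> L2per L" "h \<in> L2per L"
    using assms by (auto simp: has_weak_pd_def)
  show ?thesis unfolding has_weak_pd_def
  proof (intro conjI ballI)
    fix \<phi> :: "real^'d \<Rightarrow> real" assume \<phi>: "\<phi> \<in> smooth_per L"
    note s = smooth_per_L2per[OF \<phi>]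
    have "(LINT x:cell L|lborel. pd i \<phi> x *\<^sub>R v x) = - (LINT x:cell L|lborel. \<phi> x *\<^sub>R g x)"
      "(LINT x:cell L|lborel. pd i \<phi> x *\<^sub>R w x) = - (LINT x:cell L|lborel. \<phi> x *\<^sub>R h x)"
      using assms \<phi> unfolding has_weak_pd_def by blast+
    then show "(LINT x:cell L|lborel. pd i \<phi> x *\<^sub>R (v - w) x) = - (LINT x:cell L|lborel. \<phi> x *\<^sub>R (g - h) x)"
      unfolding set_integral_cell_eq minus_apply scaleR_diff_right
      by (simp add: L2per_integrable_scaleR s m)
  qed (use m in \<open>auto intro: L2per_diff'\<close>)
qed

lemma has_weak_pd_inner:
  fixes v :: "real^'d \<Rightarrow> 'b::euclidean_space"
  assumes "has_weak_pd L i v g"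
  shows "has_weak_pd L i (\<lambda>x. v x \<bullet> b) (\<lambda>x. g x \<bullet> b)"
proof -
  have m: "v \<in> L2per L" "g \<in> L2per L" using assms by (auto simp: has_weak_pd_def)
  show ?thesis unfolding has_weak_pd_def
  proof (intro conjI ballI)
    fix \<phi> :: "real^'d \<Rightarrow> real" assume \<phi>: "\<phi> \<in> smooth_per L"
    note s = smooth_per_L2per[OF \<phi>]
    have "(LINT x:cell L|lborel. pd i \<phi> x *\<^sub>R v x) \<bullet> b = (- (LINT x:cell L|lborel. \<phi> x *\<^sub>R g x)) \<bullet> b"
      using assms \<phi> unfolding has_weak_pd_def by simp
    moreover have "(\<integral>x. \<phi> x *\<^sub>R v x \<partial>cell_measure L) \<bullet> b = (\<integral>x. \<phi> x *\<^sub>R (v x \<bullet> b) \<partial>cell_measure L)"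
      if "\<phi> \<in> L2per L" "v \<in> L2per L" for \<phi> and v :: "real^'d \<Rightarrow> 'b"
      using integral_inner_left[OF L2per_integrable_scaleR[OF that], of b] by simp
    ultimately show "(LINT x:cell L|lborel. pd i \<phi> x *\<^sub>R (v x \<bullet> b)) = - (LINT x:cell L|lborel. \<phi> x *\<^sub>R (g x \<bullet> b))"
      unfolding set_integral_cell_eq using s m by simp
  qed (use m in \<open>auto intro: L2per_inner\<close>)
qed

lemma has_weak_pd_coeff:
  fixes v :: "real^'d \<Rightarrow> real"
  assumes "0 < L" "has_weak_pd L i v g"
  shows "L2inner L g (cas L m) = - (freq L m $ i * L2inner L v (cas L (- m)))"
proof -
  have "(LINT x:cell L|lborel. pd i (cas L m) x *\<^sub>R v x) = - (LINT x:cell L|lborel. cas L m x *\<^sub>R g x)"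
    using assms cas_smooth[of L m] unfolding has_weak_pd_def by auto
  moreover have "(\<lambda>x. pd i (cas L m) x *\<^sub>R v x) = (\<lambda>x. freq L m $ i * (v x * cas L (- m) x))"
    by (simp add: fun_eq_iff pd_cas')
  ultimately show ?thesis
    unfolding set_integral_cell_eq L2inner_eq by (simp add: mult.commute[of "cas L m _"])
qed

text \<open>Testing with Hartley functions alone suffices, so constructing a weak derivative means
  prescribing coefficients. Parseval extends the identity to every smooth test function.\<close>

lemma has_weak_pdI_coeff:
  fixes v g :: "real^'d \<Rightarrow> real"
  assumes L: "0 < L" and v: "v \<in> L2per L" and g: "g \<in> L2per L"
    and c: "\<And>m. L2inner L g (cas L m) = - (freq L m $ i * L2inner L v (cas L (- m)))"
  shows "has_weak_pd L i v g"
  unfolding has_weak_pd_def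
proof (intro conjI ballI v g)
  fix \<phi> :: "real^'d \<Rightarrow> real" assume \<phi>: "\<phi> \<in> smooth_per L"
  note s = smooth_per_L2per[OF \<phi>]
  let ?V = "cell_vol L TYPE(real^'d)"
  let ?c = "\<lambda>v m. L2inner L v (cas L m)"
  have "(\<Sum>m\<in>modes n. ?c (pd i \<phi>) m * ?c v m) = - (\<Sum>m\<in>modes n. ?c \<phi> m * ?c g m)" for n
  proof -
    \<comment> \<open>Integration by parts turns the coefficient of \<open>\<phi>\<close> from
      \<open>m\<close> to \<open>- m\<close>, the hypothesis does the same to that of
      \<open>v\<close>; re-indexing over the symmetric cube matches the two.\<close>
    have "(\<Sum>m\<in>modes n. ?c (pd i \<phi>) m * ?c v m)
        = (\<Sum>m\<in>modes n. (\<lambda>k. freq L k $ i * ?c \<phi> k * ?c v (- k)) (- m))"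
      using integral_by_parts_cas[OF L \<phi>] by (intro sum.cong refl) simp
    also have "\<dots> = (\<Sum>m\<in>modes n. freq L m $ i * ?c \<phi> m * ?c v (- m))"
      by (rule sum_modes_minus)
    also have "\<dots> = - (\<Sum>m\<in>modes n. ?c \<phi> m * ?c g m)"
      unfolding c sum_negf[symmetric] by (intro sum.cong refl) simp
    finally show ?thesis .
  qed
  then have "(\<lambda>n. (\<Sum>m\<in>modes n. ?c (pd i \<phi>) m * ?c v m) / ?V)
      = (\<lambda>n. - ((\<Sum>m\<in>modes n. ?c \<phi> m * ?c g m) / ?V))"
    by simp
  then have "(\<lambda>n. - ((\<Sum>m\<in>modes n. ?c \<phi> m * ?c g m) / ?V)) \<longlonglongrightarrow> L2inner L (pd i \<phi>) v"
    using Parseval[OF L s(2)[of i] v] by simp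
  moreover have "(\<lambda>n. - ((\<Sum>m\<in>modes n. ?c \<phi> m * ?c g m) / ?V)) \<longlonglongrightarrow> - L2inner L \<phi> g"
    by (intro tendsto_minus Parseval[OF L s(1) g])
  ultimately have "L2inner L (pd i \<phi>) v = - L2inner L \<phi> g" by (rule LIMSEQ_unique)
  then show "(LINT x:cell L|lborel. pd i \<phi> x *\<^sub>R v x) = - (LINT x:cell L|lborel. \<phi> x *\<^sub>R g x)"
    unfolding set_integral_cell_eq L2inner_eq by simp
qed

text \<open>The coefficients of a weak derivative are determined by those of \<open>v\<close>, and
  completeness applies componentwise. Thus the choice in \<open>wpd\<close> matters only on null
  sets.\<close>

lemma has_weak_pd_unique:
  fixes v :: "real^'d \<Rightarrow> 'b::euclidean_space"
  assumes L: "0 < L" and "has_weak_pd L i v g" "has_weak_pd L i v h"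
  shows "AE x in cell_measure L. g x = h x"
proof -
  have gh: "g \<in> L2per L" "h \<in> L2per L" using assms by (auto simp: has_weak_pd_def)
  have "AE x in cell_measure L. g x \<bullet> b = h x \<bullet> b" for b
  proof -
    have "has_weak_pd L i (\<lambda>x. v x \<bullet> b) (\<lambda>x. g x \<bullet> b)" "has_weak_pd L i (\<lambda>x. v x \<bullet> b) (\<lambda>x. h x \<bullet> b)"
      using assms by (auto intro: has_weak_pd_inner)
    note c = this[THEN has_weak_pd_coeff[OF L]]
    have "AE x in cell_measure L. ((\<lambda>x. g x \<bullet> b) - (\<lambda>x. h x \<bullet> b)) x = 0"
      using gh L
      by (intro cas_complete[OF L, of "(\<lambda>x. g x \<bullet> b) - (\<lambda>x. h x \<bullet> b)"] L2per_diff' L2per_inner)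
        (simp_all add: L2inner_diff_left L2per_inner c)
    then show ?thesis by eventually_elim simp
  qed
  then have "AE x in cell_measure L. \<forall>b\<in>Basis. g x \<bullet> b = h x \<bullet> b"
    by (intro AE_finite_allI) auto
  then show ?thesis by eventually_elim (simp add: euclidean_eq_iff[of "g _"])
qed

lemma wpd_eq_AE:
  assumes "0 < L" "has_weak_pd L i v g"
  shows "has_weak_pd L i v (wpd L i v)" "AE x in cell_measure L. wpd L i v x = g x"
proof -
  show 1: "has_weak_pd L i v (wpd L i v)" unfolding wpd_def by (rule someI[of "has_weak_pd L i v", OF assms(2)])
  show "AE x in cell_measure L. wpd L i v x = g x" by (rule has_weak_pd_unique[OF assms(1) 1 assms(2)])
qed

lemma Hper1I: "(\<And>i. has_weak_pd L i v (g i)) \<Longrightarrow> v \<in> Hper L 1"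
  unfolding One_nat_def Hper.simps by (auto simp: has_weak_pd_def)

lemma Hper1D:
  assumes "v \<in> Hper L 1"
  shows "v \<in> L2per L" "has_weak_pd L i v (wpd L i v)" "wpd L i v \<in> L2per L"
proof -
  show "v \<in> L2per L" using assms by (simp add: One_nat_def)
  obtain g where "has_weak_pd L i v g" using assms by (auto simp: One_nat_def)
  then show "has_weak_pd L i v (wpd L i v)" unfolding wpd_def by (rule someI[of "has_weak_pd L i v"])
  then show "wpd L i v \<in> L2per L" by (simp add: has_weak_pd_def)
qed

lemma Hper1_diff:
  assumes "v \<in> Hper L 1" "w \<in> Hper L 1"
  shows "v - w \<in> Hper L 1"
  by (rule Hper1I) (rule has_weak_pd_diff[OF Hper1D(2)[OF assms(1)] Hper1D(2)[OF assms(2)]])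

lemma wpd_diff_AE:
  assumes "0 < L" "v \<in> Hper L 1" "w \<in> Hper L 1"
  shows "AE x in cell_measure L. wpd L i (v - w) x = (wpd L i v - wpd L i w) x"
  using wpd_eq_AE(2)[OF assms(1) has_weak_pd_diff[OF Hper1D(2)[OF assms(2)] Hper1D(2)[OF assms(3)]]] .

lemma has_weak_pd_cas:
  fixes c :: "'b::euclidean_space" and m :: "'d::finite \<Rightarrow> int"
  assumes L: "0 < L"
  shows "has_weak_pd L i (\<lambda>x. cas L m x *\<^sub>R c) (\<lambda>x. (freq L m $ i * cas L (- m) x) *\<^sub>R c)"
proof -
  have m: "(\<lambda>x. (k * cas L m x) *\<^sub>R c) \<in> L2per L" for k m
  proof (rule L2per_bounded[where K="\<bar>k\<bar> * 2 * norm c"])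
    show "periodic L (\<lambda>x. (k * cas L m x) *\<^sub>R c)"
      using cas_periodic[of L m] L by (simp add: periodic_def)
    show "norm ((k * cas L m x) *\<^sub>R c) \<le> \<bar>k\<bar> * 2 * norm c" for x
      using cas_bound[of L m x] by (simp add: abs_mult mult_left_mono mult_right_mono)
  qed measurable
  show ?thesis unfolding has_weak_pd_def
  proof (intro conjI ballI)
    show "(\<lambda>x. cas L m x *\<^sub>R c) \<in> L2per L" using m[of 1] by simp
    fix \<phi> :: "real^'d \<Rightarrow> real" assume \<phi>: "\<phi> \<in> smooth_per L"
    have i: "integrable (cell_measure L) (\<lambda>x. pd i \<phi> x * cas L m x)" "integrable (cell_measure L) (\<lambda>x. \<phi> x * cas L (- m) x)"
      using L2per_integrable_inner[OF smooth_per_L2per(2)[OF \<phi>] cas_L2per, of i m]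
        L2per_integrable_inner[OF smooth_per_L2per(1)[OF \<phi>] cas_L2per, of "- m"] L by auto
    have "(LINT x:cell L|lborel. pd i \<phi> x *\<^sub>R cas L m x *\<^sub>R c) = L2inner L (pd i \<phi>) (cas L m) *\<^sub>R c"
      unfolding set_integral_cell_eq L2inner_eq using i by simp
    also have "\<dots> = - ((freq L m $ i * L2inner L \<phi> (cas L (- m))) *\<^sub>R c)"
      using integral_by_parts_cas[OF L \<phi>] by simp
    also have "\<dots> = - (LINT x:cell L|lborel. \<phi> x *\<^sub>R (freq L m $ i * cas L (- m) x) *\<^sub>R c)"
    proof -
      have "(\<lambda>x. \<phi> x *\<^sub>R (freq L m $ i * cas L (- m) x) *\<^sub>R c)
          = (\<lambda>x. (freq L m $ i * (\<phi> x * cas L (- m) x)) *\<^sub>R c)" by (simp add: fun_eq_iff)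
      then show ?thesis unfolding set_integral_cell_eq L2inner_eq using i by simp
    qed
    finally show "(LINT x:cell L|lborel. pd i \<phi> x *\<^sub>R cas L m x *\<^sub>R c)
      = - (LINT x:cell L|lborel. \<phi> x *\<^sub>R (freq L m $ i * cas L (- m) x) *\<^sub>R c)" .
  qed (rule m)
qed

text \<open>Otherwise the simplifier turns \<open>Hper L 1\<close> into its defining condition.\<close>

declare Hper.simps [simp del] One_nat_def [simp del]

section \<open>Weak gradient and divergence, and their linearity under the integral\<close>

lemma wpd_nth:
  fixes v :: "real^'d \<Rightarrow> real^'n"
  assumes "v \<in> Hper L 1"
  shows "has_weak_pd L i (\<lambda>x. v x $ j) (\<lambda>x. wpd L i v x $ j)"
  using has_weak_pd_inner[OF Hper1D(2)[OF assms], of i "axis j 1"] by (simp add: inner_axis)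

lemma wgrad_L2per: "q \<in> Hper L 1 \<Longrightarrow> wgrad L q \<in> L2per L"
  unfolding wgrad_def[abs_def] by (intro L2per_vec Hper1D)

lemma wdiv_L2per: "v \<in> Hper L 1 \<Longrightarrow> wdiv L v \<in> L2per L"
  unfolding wdiv_def[abs_def] by (intro L2per_sum L2per_nth Hper1D)

lemma L2inner_wgrad:
  "p \<in> Hper L 1 \<Longrightarrow> q \<in> Hper L 1 \<Longrightarrow>
    L2inner L (wgrad L p) (wgrad L q) = (\<Sum>i\<in>UNIV. L2inner L (wpd L i p) (wpd L i q))"
  by (simp add: L2inner_vec wgrad_L2per) (simp add: wgrad_def)

lemma wgrad_diff_AE:
  fixes p q :: "real^'d \<Rightarrow> real"
  assumes "0 < L" "p \<in> Hper L 1" "q \<in> Hper L 1"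
  shows "AE x in cell_measure L. wgrad L (p - q) x = (wgrad L p - wgrad L q) x"
proof -
  have "AE x in cell_measure L. \<forall>i\<in>UNIV. wpd L i (p - q) x = (wpd L i p - wpd L i q) x"
    using wpd_diff_AE[OF assms] by (intro AE_finite_allI) auto
  then show ?thesis by eventually_elim (simp add: wgrad_def vec_eq_iff)
qed

lemma L2inner_wgrad_diff:
  fixes p q :: "real^'d \<Rightarrow> real"
  assumes "0 < L" "p \<in> Hper L 1" "q \<in> Hper L 1" "w \<in> L2per L"
  shows "L2inner L w (wgrad L (p - q)) = L2inner L w (wgrad L p) - L2inner L w (wgrad L q)"
proof -
  have "L2inner L w (wgrad L (p - q)) = L2inner L w (wgrad L p - wgrad L q)"
    using assms wgrad_diff_AE[OF assms(1-3)]
    by (intro L2inner_cong_AE) (auto intro: wgrad_L2per Hper1_diff L2per_diff')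
  then show ?thesis using assms by (simp add: L2inner_diff_right wgrad_L2per)
qed

lemma L2inner_wdiv_diff:
  fixes v w :: "real^'d \<Rightarrow> real^'d"
  assumes "0 < L" "v \<in> Hper L 1" "w \<in> Hper L 1" "q \<in> L2per L"
  shows "L2inner L (wdiv L (v - w)) q = L2inner L (wdiv L v) q - L2inner L (wdiv L w) q"
proof -
  have "AE x in cell_measure L. \<forall>i\<in>UNIV. wpd L i (v - w) x = (wpd L i v - wpd L i w) x"
    using wpd_diff_AE[OF assms(1-3)] by (intro AE_finite_allI) auto
  then have "AE x in cell_measure L. wdiv L (v - w) x = (wdiv L v - wdiv L w) x"
    by eventually_elim (simp add: wdiv_def sum_subtractf)
  then have "L2inner L (wdiv L (v - w)) q = L2inner L (wdiv L v - wdiv L w) q"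
    using assms by (intro L2inner_cong_AE) (auto intro: wdiv_L2per Hper1_diff L2per_diff')
  then show ?thesis using assms by (simp add: L2inner_diff_left wdiv_L2per)
qed

lemma grad_inner_diff_left:
  fixes v w :: "real^'d \<Rightarrow> real^'d"
  assumes "0 < L" "v \<in> Hper L 1" "w \<in> Hper L 1" "z \<in> Hper L 1"
  shows "grad_inner L (v - w) z = grad_inner L v z - grad_inner L w z"
proof -
  have "L2inner L (wpd L i (v - w)) (wpd L i z) = L2inner L (wpd L i v) (wpd L i z) - L2inner L (wpd L i w) (wpd L i z)" for i
  proof -
    have "L2inner L (wpd L i (v - w)) (wpd L i z) = L2inner L (wpd L i v - wpd L i w) (wpd L i z)"
      using assms wpd_diff_AE[OF assms(1-3)]
      by (intro L2inner_cong_AE) (auto intro: Hper1D Hper1_diff L2per_diff')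
    then show ?thesis using assms by (simp add: L2inner_diff_left Hper1D)
  qed
  then show ?thesis by (simp add: grad_inner_def sum_subtractf)
qed

lemma grad_inner_self_nonneg: "0 \<le> grad_inner L v v"
  unfolding grad_inner_def by (intro sum_nonneg) simp

lemma grad_normsq_eq:
  "v \<in> Hper L 1 \<Longrightarrow> grad_normsq L v = ennreal (\<Sum>i\<in>UNIV. (L2norm L (wpd L i v))\<^sup>2)"
  unfolding grad_normsq_def by (simp add: normsq_eq[OF Hper1D(3)] sum_ennreal)

section \<open>Regularity of the pressure\<close>

text \<open>The hypothesis is the equation "Laplacian of \<open>r\<close> equals divergence of
  \<open>g\<close>", mode by mode. It says that the gradient of \<open>r\<close> is in each mode the
  projection of \<open>g\<close> onto the direction of the frequency, which is why the bound has
  constant 1.\<close>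

lemma weak_gradient_of_very_weak_Poisson:
  fixes r :: "real^'d \<Rightarrow> real" and g :: "real^'d \<Rightarrow> real^'d"
  assumes L: "0 < L" and r: "r \<in> L2per L" and g: "g \<in> L2per L"
    and eq: "\<And>m. (norm (freq L m))\<^sup>2 * L2inner L r (cas L m)
      = (\<Sum>j\<in>UNIV. freq L m $ j * L2inner L (\<lambda>x. g x $ j) (cas L (- m)))"
  shows "r \<in> Hper L 1" "(\<Sum>i\<in>UNIV. (L2norm L (wpd L i r))\<^sup>2) \<le> (L2norm L g)\<^sup>2"
proof -
  let ?V = "cell_vol L TYPE(real^'d)"
  have V: "0 < ?V" by (rule cell_vol_pos[OF L])
  \<comment> \<open>The coefficients that a weak derivative of \<open>r\<close> in direction
    \<open>i\<close> must have.\<close>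
  define a where "a i m = - (freq L m $ i * L2inner L r (cas L (- m)))" for i and m :: "'d \<Rightarrow> int"
  define G where "G m = (\<chi> j. L2inner L (\<lambda>x. g x $ j) (cas L m))" for m :: "'d \<Rightarrow> int"
  have aG: "(\<Sum>i\<in>UNIV. (a i m)\<^sup>2) \<le> (norm (G m))\<^sup>2" for m
  proof -
    define q F where "q = L2inner L r (cas L (- m))" and "F = freq L m"
    \<comment> \<open>The equation is used at \<open>- m\<close> because \<open>a i m\<close>
      contains the coefficient of \<open>r\<close> at \<open>- m\<close>.\<close>
    have "(norm F)\<^sup>2 * q = - (F \<bullet> G m)"
      using eq[of "- m"] by (simp add: q_def F_def G_def freq_minus inner_vec_def sum_negf)
    then have "(norm F)\<^sup>2 * \<bar>q\<bar> = \<bar>F \<bullet> G m\<bar>" by (metis abs_minus_cancel abs_mult abs_power2)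
    also have "\<dots> \<le> norm F * norm (G m)" by (rule Cauchy_Schwarz_ineq2)
    finally have "norm F * (norm F * \<bar>q\<bar>) \<le> norm F * norm (G m)" by (simp add: power2_eq_square mult.assoc)
    \<comment> \<open>For the constant mode, where no cancellation is possible, the left-hand side
      vanishes.\<close>
    then have "norm F * \<bar>q\<bar> \<le> norm (G m)"
      by (cases "F = 0") (auto simp: mult_le_cancel_left)
    then have "(norm F * \<bar>q\<bar>)\<^sup>2 \<le> (norm (G m))\<^sup>2" by (intro power_mono) auto
    moreover have "(\<Sum>i\<in>UNIV. (a i m)\<^sup>2) = (norm F * \<bar>q\<bar>)\<^sup>2"
      by (simp add: a_def q_def[symmetric] F_def[symmetric] power_mult_distrib norm_vec_def L2_set_def
          sum_nonneg sum_distrib_right)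
    ultimately show ?thesis by simp
  qed
  have sumG: "(\<Sum>m\<in>modes n. (norm (G m))\<^sup>2) \<le> ?V * (L2norm L g)\<^sup>2" for n
  proof -
    have "(\<Sum>m\<in>modes n. (norm (G m))\<^sup>2) = (\<Sum>m\<in>modes n. \<Sum>j\<in>UNIV. (L2inner L (\<lambda>x. g x $ j) (cas L m))\<^sup>2)"
      by (simp add: G_def norm_vec_def L2_set_def sum_nonneg)
    also have "\<dots> = (\<Sum>j\<in>UNIV. \<Sum>m\<in>modes n. (L2inner L (\<lambda>x. g x $ j) (cas L m))\<^sup>2)"
      by (rule sum.swap)
    also have "\<dots> \<le> (\<Sum>j\<in>UNIV. ?V * (L2norm L (\<lambda>x. g x $ j))\<^sup>2)"
      using g by (intro sum_mono Bessel L L2per_nth) auto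
    also have "\<dots> = ?V * (L2norm L g)\<^sup>2"
      using L2inner_vec[OF g g] by (simp add: L2norm_sq sum_distrib_left)
    finally show ?thesis .
  qed
  have sums: "(\<Sum>m\<in>modes n. \<Sum>i\<in>UNIV. (a i m)\<^sup>2) \<le> ?V * (L2norm L g)\<^sup>2" for n
    using sum_mono[of "modes n" "\<lambda>m. \<Sum>i\<in>UNIV. (a i m)\<^sup>2" "\<lambda>m. (norm (G m))\<^sup>2", OF aG] sumG[of n] by linarith
  have "\<exists>h. h \<in> L2per L \<and> (\<forall>m. L2inner L h (cas L m) = a i m)" for i
  proof -
    have "(\<Sum>m\<in>modes n. (a i m)\<^sup>2) \<le> ?V * (L2norm L g)\<^sup>2" for n
    proof -
      have "(\<Sum>m\<in>modes n. (a i m)\<^sup>2) \<le> (\<Sum>m\<in>modes n. \<Sum>i\<in>UNIV. (a i m)\<^sup>2)"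
        by (intro sum_mono member_le_sum) auto
      then show ?thesis using sums[of n] by linarith
    qed
    then show ?thesis using Riesz_Fischer[OF L, of "a i"] by metis
  qed
  then obtain h where h: "\<And>i. h i \<in> L2per L" "\<And>i m. L2inner L (h i) (cas L m) = a i m" by metis
  have wp: "has_weak_pd L i r (h i)" for i
    by (rule has_weak_pdI_coeff[OF L r h(1)]) (simp add: h(2) a_def)
  then show "r \<in> Hper L 1" by (rule Hper1I)
  have "L2norm L (wpd L i r) = L2norm L (h i)" for i
    using wpd_eq_AE[OF L wp[of i]] h(1) by (intro L2norm_cong_AE) (auto simp: has_weak_pd_def)
  then have e: "(\<Sum>i\<in>UNIV. (L2norm L (wpd L i r))\<^sup>2) = (\<Sum>i\<in>UNIV. L2inner L (h i) (h i))"
    by (simp add: L2norm_sq)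
  have "(\<lambda>n. \<Sum>i\<in>UNIV. (\<Sum>m\<in>modes n. a i m * a i m) / ?V) \<longlonglongrightarrow> (\<Sum>i\<in>UNIV. L2inner L (h i) (h i))"
    using Parseval[OF L h(1) h(1)] unfolding h(2) by (intro tendsto_sum)
  moreover have "(\<Sum>i\<in>UNIV. (\<Sum>m\<in>modes n. a i m * a i m) / ?V) \<le> (L2norm L g)\<^sup>2" for n
  proof -
    have "(\<Sum>i\<in>UNIV. (\<Sum>m\<in>modes n. a i m * a i m) / ?V) = (\<Sum>m\<in>modes n. \<Sum>i\<in>UNIV. (a i m)\<^sup>2) / ?V"
      by (subst sum.swap) (simp add: sum_divide_distrib power2_eq_square)
    then show ?thesis using sums[of n] V by (simp add: divide_le_eq mult.commute)
  qed
  ultimately show "(\<Sum>i\<in>UNIV. (L2norm L (wpd L i r))\<^sup>2) \<le> (L2norm L g)\<^sup>2"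
    unfolding e by (intro LIMSEQ_le_const2) auto
qed

section \<open>Gradients of Hartley functions as test fields\<close>

lemma cas_field_Hper1: "0 < L \<Longrightarrow> (\<lambda>x. cas L m x *\<^sub>R c) \<in> Hper L 1"
  by (rule Hper1I) (rule has_weak_pd_cas)

lemma cas_Hper1: "0 < L \<Longrightarrow> cas L m \<in> Hper L 1"
  using cas_field_Hper1[of L m "1::real"] by simp

lemma L2inner_cas_field:
  fixes w :: "real^'d \<Rightarrow> real^'d"
  assumes L: "0 < L" and w: "w \<in> L2per L"
  shows "L2inner L w (\<lambda>x. cas L m x *\<^sub>R c) = (\<Sum>j\<in>UNIV. c $ j * L2inner L (\<lambda>x. w x $ j) (cas L m))"
proof -
  have "L2inner L w (\<lambda>x. cas L m x *\<^sub>R c)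
      = (\<Sum>j\<in>UNIV. L2inner L (\<lambda>x. w x $ j) (\<lambda>x. c $ j * cas L m x))"
    using Hper1D(1)[OF cas_field_Hper1[OF L]] w by (subst L2inner_vec) (auto simp: mult.commute)
  also have "\<dots> = (\<Sum>j\<in>UNIV. c $ j * L2inner L (\<lambda>x. w x $ j) (cas L m))"
    using L2inner_scaleR_left[of L _ "cas L m"] by (simp add: L2inner_commute[of L "\<lambda>x. w x $ _"])
  finally show ?thesis .
qed

text \<open>The field on the right is the gradient of \<open>cas L m\<close>. So a divergence-free
  field is orthogonal to every test field used for the pressure.\<close>

lemma divergence_coeff:
  fixes u :: "real^'d \<Rightarrow> real^'d"
  assumes L: "0 < L" and u: "u \<in> Hper L 1"
  shows "L2inner L (wdiv L u) (cas L m) = - L2inner L u (\<lambda>x. cas L (- m) x *\<^sub>R freq L m)"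
proof -
  have "L2inner L (wdiv L u) (cas L m) = (\<Sum>j\<in>UNIV. L2inner L (\<lambda>x. wpd L j u x $ j) (cas L m))"
    unfolding wdiv_def[abs_def] using L Hper1D(3)[OF u] by (intro L2inner_sum_left L2per_nth) auto
  also have "\<dots> = (\<Sum>j\<in>UNIV. - (freq L m $ j * L2inner L (\<lambda>x. u x $ j) (cas L (- m))))"
    by (intro sum.cong refl has_weak_pd_coeff[OF L] wpd_nth[OF u])
  finally show ?thesis
    by (simp add: sum_negf L2inner_cas_field[OF L Hper1D(1)[OF u]])
qed

text \<open>The field is an eigenfunction of the negative Laplacian. Hence the viscous term vanishes
  together with the L2 product, and no second derivative of \<open>u\<close> is involved.\<close>

lemma grad_inner_cas_field:
  fixes u :: "real^'d \<Rightarrow> real^'d" and c :: "real^'d"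
  assumes L: "0 < L" and u: "u \<in> Hper L 1"
  shows "grad_inner L u (\<lambda>x. cas L m x *\<^sub>R c) = (norm (freq L m))\<^sup>2 * L2inner L u (\<lambda>x. cas L m x *\<^sub>R c)"
proof -
  let ?\<Phi> = "\<lambda>x. cas L m x *\<^sub>R c"
  have "L2inner L (wpd L i u) (wpd L i ?\<Phi>) = (freq L m $ i)\<^sup>2 * L2inner L u ?\<Phi>" for i
  proof -
    note wp = has_weak_pd_cas[OF L, of i m c]
    have "L2inner L (wpd L i u) (wpd L i ?\<Phi>) = L2inner L (wpd L i u) (\<lambda>x. (freq L m $ i * cas L (- m) x) *\<^sub>R c)"
      using Hper1D(3)[OF u] wpd_eq_AE[OF L wp] wp
      by (intro L2inner_cong_AE) (auto simp: has_weak_pd_def)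
    also have "\<dots> = freq L m $ i * L2inner L (wpd L i u) (\<lambda>x. cas L (- m) x *\<^sub>R c)"
      using L2inner_scaleR_left[of L "freq L m $ i" "\<lambda>x. cas L (- m) x *\<^sub>R c" "wpd L i u"]
      by (simp add: L2inner_commute)
    also have "L2inner L (wpd L i u) (\<lambda>x. cas L (- m) x *\<^sub>R c)
        = (\<Sum>j\<in>UNIV. c $ j * L2inner L (\<lambda>x. wpd L i u x $ j) (cas L (- m)))"
      using L Hper1D(3)[OF u] by (rule L2inner_cas_field)
    also have "\<dots> = freq L m $ i * L2inner L u ?\<Phi>"
      using has_weak_pd_coeff[OF L wpd_nth[OF u, of i], of _ "- m"]
      by (simp add: L2inner_cas_field[OF L Hper1D(1)[OF u]] sum_distrib_left mult.left_commute)
    finally show ?thesis by (simp add: power2_eq_square)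
  qed
  then show ?thesis
    by (simp add: grad_inner_def norm_vec_def L2_set_def sum_nonneg sum_distrib_right)
qed

lemma L2inner_wgrad_cas:
  fixes w :: "real^'d \<Rightarrow> real^'d"
  assumes L: "0 < L" and w: "w \<in> L2per L"
  shows "L2inner L w (wgrad L (cas L m)) = L2inner L w (\<lambda>x. cas L (- m) x *\<^sub>R freq L m)"
proof -
  have wp: "has_weak_pd L i (cas L m) (\<lambda>x. freq L m $ i * cas L (- m) x)" for i
    using has_weak_pd_cas[OF L, of i m "1::real"] by simp
  have "AE x in cell_measure L. \<forall>i\<in>UNIV. wpd L i (cas L m) x = freq L m $ i * cas L (- m) x"
    using wpd_eq_AE(2)[OF L wp] by (intro AE_finite_allI) auto
  then have "AE x in cell_measure L. wgrad L (cas L m) x = cas L (- m) x *\<^sub>R freq L m"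
    by eventually_elim (simp add: wgrad_def vec_eq_iff)
  then show ?thesis
    using w Hper1D(1)[OF cas_field_Hper1[OF L]] wgrad_L2per[OF cas_Hper1[OF L]]
    by (intro L2inner_cong_AE) auto
qed

text \<open>The divergence of the gradient of a mode is its Laplacian, so the pressure term isolates
  a single coefficient of \<open>r\<close>.\<close>

lemma L2inner_wdiv_cas_field:
  fixes r :: "real^'d \<Rightarrow> real"
  assumes L: "0 < L" and r: "r \<in> L2per L"
  shows "L2inner L (wdiv L (\<lambda>x. cas L (- m) x *\<^sub>R freq L m)) r = - ((norm (freq L m))\<^sup>2 * L2inner L r (cas L m))"
proof -
  let ?\<Phi> = "\<lambda>x. cas L (- m) x *\<^sub>R freq L m"
  have wp: "has_weak_pd L i ?\<Phi> (\<lambda>x. (freq L (- m) $ i * cas L m x) *\<^sub>R freq L m)" for i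
    using has_weak_pd_cas[OF L, of i "- m" "freq L m"] by simp
  have "AE x in cell_measure L. \<forall>i\<in>UNIV. wpd L i ?\<Phi> x = (freq L (- m) $ i * cas L m x) *\<^sub>R freq L m"
    using wpd_eq_AE(2)[OF L wp] by (intro AE_finite_allI) auto
  then have "AE x in cell_measure L. wdiv L ?\<Phi> x = - (norm (freq L m))\<^sup>2 * cas L m x"
  proof eventually_elim
    case (elim x)
    have "wdiv L ?\<Phi> x = (\<Sum>i\<in>UNIV. - (freq L m $ i)\<^sup>2 * cas L m x)"
      unfolding wdiv_def using elim by (intro sum.cong refl) (simp add: power2_eq_square)
    also have "\<dots> = - (norm (freq L m))\<^sup>2 * cas L m x"
      unfolding sum_distrib_right[symmetric] sum_negf by (simp add: norm_vec_def L2_set_def sum_nonneg)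
    finally show ?case .
  qed
  then have "L2inner L (wdiv L ?\<Phi>) r = L2inner L (\<lambda>x. - (norm (freq L m))\<^sup>2 * cas L m x) r"
    using r L wdiv_L2per[OF cas_field_Hper1[OF L]]
    by (intro L2inner_cong_AE cas_scale_L2per) auto
  then show ?thesis
    using L2inner_scaleR_left[of L "- (norm (freq L m))\<^sup>2" "cas L m" r] by (simp add: L2inner_commute)
qed

lemma momentum_eqD:
  assumes "momentum_eq L k u u' r g \<eta> dW" "v \<in> Hper L 1"
    "u \<in> L2per L" "g \<in> L2per L" "\<eta> \<in> L2per L"
  shows "L2inner L u' v + k * grad_inner L u' v - k * L2inner L (wdiv L v) r
    = L2inner L u v + k * L2inner L g v + dW * L2inner L \<eta> v"
  using assms unfolding momentum_eq_def by (simp add: L2inner_scaleR_left)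

text \<open>Both the old and the new velocity have to be divergence-free. The common factor
  \<open>k\<close> then cancels, so the bound depends neither on the time step nor on the increment
  \<open>dW\<close>.\<close>

lemma pressure_regularity:
  fixes u u' g b :: "real^'d \<Rightarrow> real^'d" and r \<xi> :: "real^'d \<Rightarrow> real"
  assumes L: "0 < L" and k: "0 < k"
    and m: "momentum_eq L k u u' r g (b - wgrad L \<xi>) dW"
    and u: "u \<in> Hper L 1" "u' \<in> Hper L 1" and r: "r \<in> L2per L" and g: "g \<in> L2per L"
    and b: "b \<in> L2per L" and \<xi>: "\<xi> \<in> Hper L 1"
    and hel: "\<And>\<phi>. \<phi> \<in> Hper L 1 \<Longrightarrow> L2inner L (wgrad L \<xi>) (wgrad L \<phi>) = L2inner L b (wgrad L \<phi>)"
    and div: "\<And>q. q \<in> L2per L \<Longrightarrow> L2inner L (wdiv L u) q = 0" "\<And>q. q \<in> L2per L \<Longrightarrow> L2inner L (wdiv L u') q = 0"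
  shows "r \<in> Hper L 1" "(\<Sum>i\<in>UNIV. (L2norm L (wpd L i r))\<^sup>2) \<le> (L2norm L g)\<^sup>2"
proof -
  have \<eta>: "b - wgrad L \<xi> \<in> L2per L" using b \<xi> by (intro L2per_diff' wgrad_L2per)
  have "(norm (freq L m))\<^sup>2 * L2inner L r (cas L m)
      = (\<Sum>j\<in>UNIV. freq L m $ j * L2inner L (\<lambda>x. g x $ j) (cas L (- m)))" for m
  proof -
    let ?\<Phi> = "\<lambda>x. cas L (- m) x *\<^sub>R freq L m"
    have z: "L2inner L u ?\<Phi> = 0" "L2inner L u' ?\<Phi> = 0"
      using divergence_coeff[OF L u(1), of m] divergence_coeff[OF L u(2), of m] div L by auto
    have "L2inner L (b - wgrad L \<xi>) ?\<Phi> = L2inner L (b - wgrad L \<xi>) (wgrad L (cas L m))"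
      by (rule L2inner_wgrad_cas[OF L \<eta>, symmetric])
    also have "\<dots> = 0"
      using hel[OF cas_Hper1[OF L], of m] b \<xi> cas_Hper1[OF L, of m]
      by (simp add: L2inner_diff_left wgrad_L2per)
    finally have "- k * L2inner L (wdiv L ?\<Phi>) r = k * L2inner L g ?\<Phi>"
      using momentum_eqD[OF m cas_field_Hper1[OF L] Hper1D(1)[OF u(1)] g \<eta>, of "- m" "freq L m"]
        grad_inner_cas_field[OF L u(2), of "- m" "freq L m"] z by simp
    then show ?thesis
      using k by (simp add: L2inner_wdiv_cas_field[OF L r] L2inner_cas_field[OF L g])
  qed
  from weak_gradient_of_very_weak_Poisson[OF L r g this]
  show "r \<in> Hper L 1" "(\<Sum>i\<in>UNIV. (L2norm L (wpd L i r))\<^sup>2) \<le> (L2norm L g)\<^sup>2" by auto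
qed

section \<open>Deterministic stability estimates\<close>

text \<open>The difference \<open>G\<close> of the gradient parts satisfies
  \<open>(G, G) = (b - b', G)\<close>, so Pythagoras bounds what remains after subtracting
  it.\<close>

lemma Helmholtz_projection_contraction:
  fixes b b' :: "real^'d \<Rightarrow> real^'d" and \<xi> \<xi>' :: "real^'d \<Rightarrow> real"
  assumes L: "0 < L" and b: "b \<in> L2per L" "b' \<in> L2per L" and \<xi>: "\<xi> \<in> Hper L 1" "\<xi>' \<in> Hper L 1"
    and hel: "\<And>\<phi>. \<phi> \<in> Hper L 1 \<Longrightarrow> L2inner L (wgrad L \<xi>) (wgrad L \<phi>) = L2inner L b (wgrad L \<phi>)"
      "\<And>\<phi>. \<phi> \<in> Hper L 1 \<Longrightarrow> L2inner L (wgrad L \<xi>') (wgrad L \<phi>) = L2inner L b' (wgrad L \<phi>)"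
  shows "L2norm L ((b - wgrad L \<xi>) - (b' - wgrad L \<xi>')) \<le> L2norm L (b - b')"
proof (rule power2_le_imp_le)
  define G where "G = wgrad L \<xi> - wgrad L \<xi>'"
  have m: "wgrad L \<xi> \<in> L2per L" "wgrad L \<xi>' \<in> L2per L" "G \<in> L2per L" "b - b' \<in> L2per L"
    using \<xi> b unfolding G_def by (auto intro: wgrad_L2per L2per_diff')
  have G: "L2inner L w G = L2inner L w (wgrad L (\<xi> - \<xi>'))" if "w \<in> L2per L" for w
    using that m \<xi> by (simp add: G_def L2inner_diff_right L2inner_wgrad_diff[OF L])
  have "L2inner L G G = L2inner L (b - b') G"
    unfolding G[OF m(3)] G[OF m(4)] using hel(1)[OF Hper1_diff[OF \<xi>]] hel(2)[OF Hper1_diff[OF \<xi>]]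
    by (simp add: G_def L2inner_diff_left m b wgrad_L2per Hper1_diff \<xi>)
  then have "(L2norm L ((b - b') - G))\<^sup>2 = (L2norm L (b - b'))\<^sup>2 - (L2norm L G)\<^sup>2"
    unfolding L2norm_sq_diff[OF m(4,3)] by (simp add: L2norm_sq)
  moreover have "(b - wgrad L \<xi>) - (b' - wgrad L \<xi>') = (b - b') - G"
    by (simp add: fun_eq_iff G_def)
  ultimately show "(L2norm L ((b - wgrad L \<xi>) - (b' - wgrad L \<xi>')))\<^sup>2 \<le> (L2norm L (b - b'))\<^sup>2" by simp
qed simp

text \<open>Meant for two sample points of one scheme, hence the separate forces, increments and
  coefficients. The hypothesis \<open>sign\<close> covers both divergence constraints: the pressure
  term is zero for the exact one and nonpositive for the penalized one.\<close>

lemma momentum_eq_stability: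
  fixes u1 u2 u1' u2' :: "real^'d \<Rightarrow> real^'d"
  assumes L: "0 < L" and k: "0 < k"
    and m: "momentum_eq L k u1 u1' r1 g1 \<eta>1 dW1" "momentum_eq L k u2 u2' r2 g2 \<eta>2 dW2"
    and d: "u1 \<in> L2per L" "u2 \<in> L2per L" "g1 \<in> L2per L" "g2 \<in> L2per L" "\<eta>1 \<in> L2per L" "\<eta>2 \<in> L2per L"
    and u: "u1' \<in> Hper L 1" "u2' \<in> Hper L 1" and r: "r1 \<in> L2per L" "r2 \<in> L2per L"
    and sign: "L2inner L (wdiv L (u1' - u2')) (r1 - r2) \<le> 0"
  shows "L2norm L (u1' - u2') \<le> L2norm L (u1 - u2) + k * L2norm L (g1 - g2)
    + L2norm L ((\<lambda>x. dW1 *\<^sub>R \<eta>1 x) - (\<lambda>x. dW2 *\<^sub>R \<eta>2 x))"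
proof -
  define e where "e = u1' - u2'"
  have e: "e \<in> Hper L 1" "e \<in> L2per L" unfolding e_def using Hper1_diff[OF u] by (auto dest: Hper1D(1))
  have s: "(\<lambda>x. dW1 *\<^sub>R \<eta>1 x) \<in> L2per L" "(\<lambda>x. dW2 *\<^sub>R \<eta>2 x) \<in> L2per L"
    using d by (auto intro: L2per_scaleR)
  define D where "D = (\<lambda>x. dW1 *\<^sub>R \<eta>1 x) - (\<lambda>x. dW2 *\<^sub>R \<eta>2 x)"
  have D: "L2inner L D e = dW1 * L2inner L \<eta>1 e - dW2 * L2inner L \<eta>2 e" "D \<in> L2per L"
    using s e by (auto simp: D_def L2inner_diff_left L2inner_scaleR_left intro: L2per_diff')
  have A1: "L2inner L e e = L2inner L u1' e - L2inner L u2' e"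
    using L2inner_diff_left[OF Hper1D(1)[OF u(1)] Hper1D(1)[OF u(2)] e(2)] by (simp only: e_def)
  have A2: "grad_inner L e e = grad_inner L u1' e - grad_inner L u2' e"
    using grad_inner_diff_left[OF L u e(1)] by (simp only: e_def)
  have A3: "L2inner L (wdiv L e) (r1 - r2) = L2inner L (wdiv L e) r1 - L2inner L (wdiv L e) r2"
    using r wdiv_L2per[OF e(1)] by (simp add: L2inner_diff_right)
  have "L2inner L e e + k * grad_inner L e e - k * L2inner L (wdiv L e) (r1 - r2)
      = (L2inner L u1 e - L2inner L u2 e) + k * (L2inner L g1 e - L2inner L g2 e) + L2inner L D e"
    unfolding A1 A2 A3 D(1) right_diff_distrib
    using momentum_eqD[OF m(1) e(1) d(1,3,5)] momentum_eqD[OF m(2) e(1) d(2,4,6)] by linarith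
  moreover have "0 \<le> k * grad_inner L e e" using k grad_inner_self_nonneg[of L e] by simp
  moreover have "k * L2inner L (wdiv L e) (r1 - r2) \<le> 0" using k sign unfolding e_def by (simp add: mult_le_0_iff)
  ultimately have "L2inner L e e \<le> L2inner L (u1 - u2) e + k * L2inner L (g1 - g2) e + L2inner L D e"
    using d e by (simp add: L2inner_diff_left)
  moreover have "L2inner L (u1 - u2) e \<le> L2norm L (u1 - u2) * L2norm L e"
    "k * L2inner L (g1 - g2) e \<le> k * (L2norm L (g1 - g2) * L2norm L e)"
    "L2inner L D e \<le> L2norm L D * L2norm L e"
    using L2_Cauchy_Schwarz[OF L2per_diff'[OF d(1,2)] e(2)] L2_Cauchy_Schwarz[OF L2per_diff'[OF d(3,4)] e(2)]
      L2_Cauchy_Schwarz[OF D(2) e(2)] k by (auto intro: mult_left_mono)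
  ultimately have "L2norm L e * L2norm L e \<le> (L2norm L (u1 - u2) + k * L2norm L (g1 - g2) + L2norm L D) * L2norm L e"
    using L2norm_sq[of L e] by (simp add: power2_eq_square distrib_right)
  moreover have "0 \<le> L2norm L (u1 - u2) + k * L2norm L (g1 - g2) + L2norm L D"
    using k by (intro add_nonneg_nonneg mult_nonneg_nonneg) auto
  ultimately have "L2norm L e \<le> L2norm L (u1 - u2) + k * L2norm L (g1 - g2) + L2norm L D"
    using L2norm_nonneg[of L e] by (metis mult_right_le_imp_le order_le_less)
  then show ?thesis unfolding e_def D_def .
qed

text \<open>The identity obtained by testing is doubled, so that after all absorptions one copy of
  the error energy, of the velocity dissipation and of the pressure dissipation is left. The term
  linear in \<open>dW\<close> is kept, since only its expectation is controlled.\<close>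

lemma error_step:
  fixes u u' ue ue' g \<eta> \<eta>e :: "real^'d \<Rightarrow> real^'d" and r re :: "real^'d \<Rightarrow> real"
  assumes L: "0 < L" and k: "0 < k" and \<epsilon>: "0 < \<epsilon>"
    and m: "momentum_eq L k u u' r g \<eta> dW" "momentum_eq L k ue ue' re g \<eta>e dW"
    and d: "u \<in> L2per L" "ue \<in> L2per L" "g \<in> L2per L" "\<eta> \<in> L2per L" "\<eta>e \<in> L2per L"
    and u: "u' \<in> Hper L 1" "ue' \<in> Hper L 1" and r: "r \<in> Hper L 1" "re \<in> Hper L 1"
    and rg: "(\<Sum>i\<in>UNIV. (L2norm L (wpd L i r))\<^sup>2) \<le> (L2norm L g)\<^sup>2"
    and div: "\<And>q. q \<in> L2per L \<Longrightarrow> L2inner L (wdiv L u') q = 0"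
    and dive: "\<And>q. q \<in> Hper L 1 \<Longrightarrow> L2inner L (wdiv L ue') q + \<epsilon> * L2inner L (wgrad L re) (wgrad L q) = 0"
  shows "k * ((\<Sum>i\<in>UNIV. (L2norm L (wpd L i (u' - ue')))\<^sup>2) + \<epsilon> * (\<Sum>i\<in>UNIV. (L2norm L (wpd L i (r - re)))\<^sup>2))
    \<le> (L2norm L (u - ue))\<^sup>2 - (L2norm L (u' - ue'))\<^sup>2 + k * \<epsilon> * (L2norm L g)\<^sup>2
      + dW\<^sup>2 * (L2norm L (\<eta> - \<eta>e))\<^sup>2 + 2 * (dW * L2inner L (\<eta> - \<eta>e) (u - ue))"
proof -
  define e e0 p h where "e = u' - ue'" and "e0 = u - ue" and "p = r - re" and "h = \<eta> - \<eta>e"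
  have e: "e \<in> Hper L 1" "e \<in> L2per L" unfolding e_def using Hper1_diff[OF u] by (auto dest: Hper1D(1))
  have p: "p \<in> Hper L 1" "p \<in> L2per L" unfolding p_def using Hper1_diff[OF r] by (auto dest: Hper1D(1))
  have e0: "e0 \<in> L2per L" and h: "h \<in> L2per L" unfolding e0_def h_def using d by (auto intro: L2per_diff')
  have r2: "r \<in> L2per L" "re \<in> L2per L" using r by (auto dest: Hper1D(1))
  define P where "P = (\<Sum>i\<in>UNIV. (L2norm L (wpd L i p))\<^sup>2)"
  define E where "E = grad_inner L e e"
  have P: "P = (L2norm L (wgrad L p))\<^sup>2" using p by (simp add: P_def L2norm_sq L2inner_wgrad)
  have E: "E = (\<Sum>i\<in>UNIV. (L2norm L (wpd L i e))\<^sup>2)" by (simp add: E_def grad_inner_def L2norm_sq)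
  have E0: "0 \<le> E" unfolding E_def by (rule grad_inner_self_nonneg)
  have R: "(L2norm L (wgrad L r))\<^sup>2 \<le> (L2norm L g)\<^sup>2" using rg r by (simp add: L2norm_sq L2inner_wgrad)
  have A1: "L2inner L e e = L2inner L u' e - L2inner L ue' e"
    using L2inner_diff_left[OF Hper1D(1)[OF u(1)] Hper1D(1)[OF u(2)] e(2)] by (simp only: e_def)
  have A2: "E = grad_inner L u' e - grad_inner L ue' e"
    using grad_inner_diff_left[OF L u e(1)] by (simp only: e_def E_def)
  have A3: "L2inner L (wdiv L e) p = L2inner L (wdiv L e) r - L2inner L (wdiv L e) re"
    using r2 wdiv_L2per[OF e(1)] by (simp add: p_def L2inner_diff_right)
  have A4: "L2inner L e0 e = L2inner L u e - L2inner L ue e" "L2inner L h e = L2inner L \<eta> e - L2inner L \<eta>e e"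
    using d e by (auto simp: e0_def h_def L2inner_diff_left)
  have 1: "L2inner L e e + k * E - k * L2inner L (wdiv L e) p = L2inner L e0 e + dW * L2inner L h e"
    unfolding A1 A2 A3 A4 right_diff_distrib
    using momentum_eqD[OF m(1) e(1) d(1,3,4)] momentum_eqD[OF m(2) e(1) d(2,3,5)] by linarith
  \<comment> \<open>The penalized constraint admits only test functions in H^1; \<open>p\<close>
    qualifies thanks to the regularity of \<open>r\<close>.\<close>
  have "L2inner L (wdiv L e) p = \<epsilon> * L2inner L (wgrad L re) (wgrad L p)"
    using L2inner_wdiv_diff[OF L u p(2)] div[OF p(2)] dive[OF p(1)] by (simp add: e_def)
  also have "L2inner L (wgrad L re) (wgrad L p) = L2inner L (wgrad L r) (wgrad L p) - P"
    using L2inner_wgrad_diff[OF L r wgrad_L2per[OF p(1)]] unfolding P L2norm_sq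
    by (simp add: p_def L2inner_commute)
  finally have 2: "L2inner L (wdiv L e) p = \<epsilon> * L2inner L (wgrad L r) (wgrad L p) - \<epsilon> * P"
    by (simp add: right_diff_distrib)
  have "2 * L2inner L (wgrad L r) (wgrad L p) \<le> 2 * (L2norm L (wgrad L r) * L2norm L (wgrad L p))"
    using L2_Cauchy_Schwarz[OF wgrad_L2per[OF r(1)] wgrad_L2per[OF p(1)]] by linarith
  also have "\<dots> \<le> (L2norm L (wgrad L r))\<^sup>2 + P"
    unfolding P using sum_squares_bound[of "L2norm L (wgrad L r)" "L2norm L (wgrad L p)"] by simp
  finally have "2 * L2inner L (wgrad L r) (wgrad L p) \<le> (L2norm L g)\<^sup>2 + P" using R by linarith
  then have 3: "k * \<epsilon> * (2 * L2inner L (wgrad L r) (wgrad L p)) \<le> k * \<epsilon> * ((L2norm L g)\<^sup>2 + P)"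
    using k \<epsilon> by (intro mult_left_mono) auto
  \<comment> \<open>Polarization leaves the squared increment \<open>e - e0\<close> with a negative
    sign; it cancels the one arising in \<open>5\<close>.\<close>
  have 4: "2 * L2inner L e0 e = (L2norm L e)\<^sup>2 + (L2norm L e0)\<^sup>2 - (L2norm L (e - e0))\<^sup>2"
    using L2norm_sq_diff[OF e(2) e0] by (simp add: L2inner_commute)
  \<comment> \<open>Young's inequality for \<open>dW * h\<close> and \<open>e - e0\<close>: it
    replaces the new error in the noise term by the old one.\<close>
  have "0 \<le> (L2norm L ((\<lambda>x. dW *\<^sub>R h x) - (e - e0)))\<^sup>2" by simp
  also have "\<dots> = dW\<^sup>2 * (L2norm L h)\<^sup>2 - 2 * (dW * (L2inner L h e - L2inner L h e0)) + (L2norm L (e - e0))\<^sup>2"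
    using h e(2) e0
    by (subst L2norm_sq_diff)
       (auto intro: L2per_scaleR L2per_diff' simp: L2norm_scaleR power_mult_distrib L2inner_scaleR_left L2inner_diff_right)
  finally have 5: "2 * (dW * L2inner L h e) \<le> dW\<^sup>2 * (L2norm L h)\<^sup>2 + 2 * (dW * L2inner L h e0) + (L2norm L (e - e0))\<^sup>2"
    by (simp add: right_diff_distrib)
  have "2 * (L2norm L e)\<^sup>2 + 2 * (k * E) - (k * \<epsilon> * (2 * L2inner L (wgrad L r) (wgrad L p)) - 2 * (k * \<epsilon> * P))
      = 2 * L2inner L e0 e + 2 * (dW * L2inner L h e)"
    using 1 unfolding 2 L2norm_sq[symmetric] by (simp add: algebra_simps)
  then have "(L2norm L e)\<^sup>2 + 2 * (k * E) + k * \<epsilon> * P \<le> (L2norm L e0)\<^sup>2 + k * \<epsilon> * (L2norm L g)\<^sup>2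
      + dW\<^sup>2 * (L2norm L h)\<^sup>2 + 2 * (dW * L2inner L h e0)"
    using 3 4 5 by (simp add: distrib_left)
  moreover have "0 \<le> k * E" using k E0 by simp
  \<comment> \<open>One of the two copies of \<open>k * E\<close> is dropped, giving both
    dissipation terms the same factor.\<close>
  ultimately have "k * (E + \<epsilon> * P) \<le> (L2norm L e0)\<^sup>2 - (L2norm L e)\<^sup>2 + k * \<epsilon> * (L2norm L g)\<^sup>2
      + dW\<^sup>2 * (L2norm L h)\<^sup>2 + 2 * (dW * L2inner L h e0)"
    by (simp add: distrib_left mult.assoc)
  then show ?thesis unfolding E P_def e_def e0_def p_def h_def .
qed

section \<open>Strongly measurable random fields\<close>

abbreviation L2_measurable ::
  "'a measure \<Rightarrow> 'a measure \<Rightarrow> real \<Rightarrow> ('a \<Rightarrow> real^'d \<Rightarrow> 'b::euclidean_space) \<Rightarrow> bool" where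
  "L2_measurable M G L \<equiv> strongly_measurable M G (L2per L) (L2norm L)"

lemma simple_function_subalgebra:
  assumes "simple_function G s" "subalgebra G' G"
  shows "simple_function G' s"
  using assms unfolding simple_function_def subalgebra_def by auto

lemma strongly_measurable_mono:
  assumes "strongly_measurable M G X nrm u" "subalgebra G' G"
  shows "strongly_measurable M G' X nrm u"
proof -
  obtain s where "AE \<omega> in M. u \<omega> \<in> X" "\<And>j. simple_function G (s j)" "\<And>j. s j ` space G \<subseteq> X"
    "AE \<omega> in M. (\<lambda>j. nrm (u \<omega> - s j \<omega>)) \<longlonglongrightarrow> 0"
    using assms(1) unfolding strongly_measurable_def by blast
  moreover have "space G' = space G" using assms(2) by (simp add: subalgebra_def)
  ultimately show ?thesis
    unfolding strongly_measurable_def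
    by (intro conjI exI[of _ s]) (auto intro: simple_function_subalgebra[OF _ assms(2)])
qed

text \<open>One step of the scheme is Lipschitz in L2, so measurability is propagated in L2 and the
  stronger norms of the data are given up at the start.\<close>

lemma strongly_measurable_L2per:
  assumes "strongly_measurable M G X nrm u" "X \<subseteq> L2per L" "\<And>v. L2norm L v \<le> nrm v"
  shows "L2_measurable M G L u"
proof -
  obtain s where s: "AE \<omega> in M. u \<omega> \<in> X" "\<And>j. simple_function G (s j)" "\<And>j. s j ` space G \<subseteq> X"
    "AE \<omega> in M. (\<lambda>j. nrm (u \<omega> - s j \<omega>)) \<longlonglongrightarrow> 0"
    using assms(1) unfolding strongly_measurable_def by blast
  have "AE \<omega> in M. (\<lambda>j. L2norm L (u \<omega> - s j \<omega>)) \<longlonglongrightarrow> 0"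
    using s(4)
  proof eventually_elim
    case (elim \<omega>)
    show ?case by (rule Lim_null_comparison[OF _ elim]) (simp add: assms(3))
  qed
  moreover have "AE \<omega> in M. u \<omega> \<in> L2per L" using s(1) assms(2) by auto
  ultimately show ?thesis
    unfolding strongly_measurable_def
    by (intro conjI exI[of _ s] allI s(2) order_trans[OF s(3) assms(2)])
qed

text \<open>If \<open>h\<close> depends on the data in a Lipschitz manner, then simple approximations of the data yield
  simple approximations of \<open>h\<close>: replace each of their values by the value of \<open>h\<close> at a sample point
  whose data are almost closest. In particular no solution operator has to be constructed.\<close>

lemma strongly_measurable_transfer:
  fixes S :: "nat \<Rightarrow> 'a \<Rightarrow> 'y" and \<rho> :: "'y \<Rightarrow> 'a \<Rightarrow> real" and h :: "'a \<Rightarrow> real^'d \<Rightarrow> 'b::euclidean_space"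
  assumes M: "prob_space M" and G: "subalgebra M G" and P: "AE \<omega> in M. P \<omega>"
    and h: "\<And>\<omega>. P \<omega> \<Longrightarrow> h \<omega> \<in> L2per L"
    and S: "\<And>j. simple_function G (S j)" "\<And>j \<omega>. \<omega> \<in> space M \<Longrightarrow> S j \<omega> \<in> Y"
    and lim: "AE \<omega> in M. (\<lambda>j. \<rho> (S j \<omega>) \<omega>) \<longlonglongrightarrow> 0" and nn: "\<And>y \<omega>. 0 \<le> \<rho> y \<omega>"
    and lip: "\<And>\<omega> \<omega>' y. P \<omega> \<Longrightarrow> P \<omega>' \<Longrightarrow> y \<in> Y \<Longrightarrow> L2norm L (h \<omega> - h \<omega>') \<le> \<rho> y \<omega> + \<rho> y \<omega>'"
  shows "L2_measurable M G L h"
proof -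
  have ex: "\<exists>\<omega>. P \<omega>"
  proof (rule ccontr)
    assume "\<nexists>\<omega>. P \<omega>"
    then have "AE \<omega> in M. False" using P by simp
    then show False using prob_space.AE_False[OF M] by simp
  qed
  \<comment> \<open>The infimum over sample points need not be attained; the tolerance
    \<open>1 / (real j + 1)\<close> disappears in the limit.\<close>
  have "\<exists>\<omega>. P \<omega> \<and> (\<forall>\<omega>'. P \<omega>' \<longrightarrow> \<rho> y \<omega> \<le> \<rho> y \<omega>' + 1 / (real j + 1))" for y and j :: nat
  proof -
    let ?I = "INF \<omega>\<in>Collect P. \<rho> y \<omega>"
    have bdd: "bdd_below (\<rho> y ` Collect P)" using nn by (intro bdd_belowI[of _ 0]) auto
    have "?I < ?I + 1 / (real j + 1)" by simp
    then have "\<exists>\<omega>\<in>Collect P. \<rho> y \<omega> < ?I + 1 / (real j + 1)"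
      using ex by (subst cINF_less_iff[OF _ bdd, symmetric]) auto
    then obtain \<omega> where \<omega>: "P \<omega>" "\<rho> y \<omega> < ?I + 1 / (real j + 1)" by auto
    have "?I \<le> \<rho> y \<omega>'" if "P \<omega>'" for \<omega>' using bdd that by (intro cINF_lower) auto
    then show ?thesis using \<omega> by (meson add_right_mono less_imp_le order_trans)
  qed
  then have "\<forall>j y. \<exists>\<omega>. P \<omega> \<and> (\<forall>\<omega>'. P \<omega>' \<longrightarrow> \<rho> y \<omega> \<le> \<rho> y \<omega>' + 1 / (real j + 1))" by blast
  then obtain c where "\<forall>j y. P (c j y) \<and> (\<forall>\<omega>'. P \<omega>' \<longrightarrow> \<rho> y (c j y) \<le> \<rho> y \<omega>' + 1 / (real j + 1))"
    unfolding choice_iff by blast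
  then have c: "\<And>j y. P (c j y)" "\<And>j y \<omega>'. P \<omega>' \<Longrightarrow> \<rho> y (c j y) \<le> \<rho> y \<omega>' + 1 / (real j + 1)"
    by blast+
  \<comment> \<open>The sample point depends on \<open>\<omega>\<close> only through the value
    \<open>S j \<omega>\<close>, which keeps \<open>s j\<close> simple.\<close>
  define s where "s j \<omega> = h (c j (S j \<omega>))" for j \<omega>
  have "simple_function G (s j)" for j unfolding s_def by (rule simple_function_compose1[OF S(1)])
  moreover have "s j ` space G \<subseteq> L2per L" for j unfolding s_def using h c(1) by auto
  moreover have "AE \<omega> in M. (\<lambda>j. L2norm L (h \<omega> - s j \<omega>)) \<longlonglongrightarrow> 0"
    using P lim AE_space
  proof eventually_elim
    case (elim \<omega>)
    show ?case
    proof (rule Lim_null_comparison)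
      have "L2norm L (h \<omega> - s j \<omega>) \<le> 2 * \<rho> (S j \<omega>) \<omega> + 1 / (real j + 1)" for j
        using lip[OF elim(1) c(1)[of j "S j \<omega>"] S(2)[OF elim(3), of j]] c(2)[OF elim(1), of "S j \<omega>" j]
        unfolding s_def by linarith
      then show "\<forall>\<^sub>F j in sequentially. norm (L2norm L (h \<omega> - s j \<omega>)) \<le> 2 * \<rho> (S j \<omega>) \<omega> + 1 / (real j + 1)"
        by (simp add: always_eventually)
      have "(\<lambda>j. 1 / (real j + 1)) \<longlonglongrightarrow> 0"
        using LIMSEQ_ignore_initial_segment[OF lim_const_over_n[of "1::real"], of 1] by (simp add: add.commute)
      from tendsto_add[OF tendsto_mult_left[OF elim(2), of 2] this]
      show "(\<lambda>j. 2 * \<rho> (S j \<omega>) \<omega> + 1 / (real j + 1)) \<longlonglongrightarrow> 0" by simp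
    qed
  qed
  moreover have "AE \<omega> in M. h \<omega> \<in> L2per L" using P by eventually_elim (rule h)
  ultimately show ?thesis unfolding strongly_measurable_def by (intro conjI exI[of _ s]) auto
qed

lemma strongly_measurable_Lipschitz:
  fixes u :: "'a \<Rightarrow> real^'d \<Rightarrow> 'b::euclidean_space" and h :: "'a \<Rightarrow> real^'d \<Rightarrow> 'b"
  assumes M: "prob_space M" and G: "subalgebra M G" and P: "AE \<omega> in M. P \<omega>"
    and sm: "L2_measurable M G L u"
    and mem: "\<And>\<omega>. P \<omega> \<Longrightarrow> h \<omega> \<in> L2per L \<and> u \<omega> \<in> L2per L"
    and C: "0 \<le> C" and lip: "\<And>\<omega> \<omega>'. P \<omega> \<Longrightarrow> P \<omega>' \<Longrightarrow> L2norm L (h \<omega> - h \<omega>') \<le> C * L2norm L (u \<omega> - u \<omega>')"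
  shows "L2_measurable M G L h"
proof -
  obtain s where s: "\<And>j. simple_function G (s j)" "\<And>j. s j ` space G \<subseteq> L2per L"
    "AE \<omega> in M. (\<lambda>j. L2norm L (u \<omega> - s j \<omega>)) \<longlonglongrightarrow> 0"
    using sm unfolding strongly_measurable_def by blast
  have sp: "space G = space M" using G by (simp add: subalgebra_def)
  show ?thesis
  proof (rule strongly_measurable_transfer[OF M G P, where S=s and \<rho>="\<lambda>y \<omega>. C * L2norm L (u \<omega> - y)" and Y="L2per L"])
    show "AE \<omega> in M. (\<lambda>j. C * L2norm L (u \<omega> - s j \<omega>)) \<longlonglongrightarrow> 0"
      using s(3) by eventually_elim (use tendsto_mult_left in fastforce)
    show "s j \<omega> \<in> L2per L" if "\<omega> \<in> space M" for j \<omega> using s(2)[of j] that sp by auto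
    fix \<omega> \<omega>' and y :: "real^'d \<Rightarrow> 'b" assume P: "P \<omega>" "P \<omega>'" and y: "y \<in> L2per L"
    have "L2norm L (h \<omega> - h \<omega>') \<le> C * L2norm L (u \<omega> - u \<omega>')" by (rule lip[OF P])
    also have "\<dots> \<le> C * (L2norm L (u \<omega> - y) + L2norm L (u \<omega>' - y))"
      using L2norm_triangle_diff[of "u \<omega>" L "u \<omega>'" y] mem P y C
      by (intro mult_left_mono) (auto simp: L2norm_minus_commute[of L y])
    finally show "L2norm L (h \<omega> - h \<omega>') \<le> C * L2norm L (u \<omega> - y) + C * L2norm L (u \<omega>' - y)"
      by (simp add: distrib_left)
  qed (use mem s C in auto)
qed

text \<open>Multiplication by an unbounded random scalar is not globally Lipschitz in the pair of
  factors, so the product of simple approximations is estimated directly.\<close>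

lemma strongly_measurable_scaleR:
  fixes u :: "'a \<Rightarrow> real^'d \<Rightarrow> 'b::euclidean_space"
  assumes G: "subalgebra M G"
    and sm: "L2_measurable M G L u" and w: "w \<in> borel_measurable G"
  shows "L2_measurable M G L (\<lambda>\<omega> x. w \<omega> *\<^sub>R u \<omega> x)"
proof -
  obtain s where u: "AE \<omega> in M. u \<omega> \<in> L2per L" and s: "\<And>j. simple_function G (s j)" "\<And>j. s j ` space G \<subseteq> L2per L"
    "AE \<omega> in M. (\<lambda>j. L2norm L (u \<omega> - s j \<omega>)) \<longlonglongrightarrow> 0"
    using sm unfolding strongly_measurable_def by blast
  obtain a where a: "\<And>j. simple_function G (a j)" "\<And>\<omega>. \<omega> \<in> space G \<Longrightarrow> (\<lambda>j. a j \<omega>) \<longlonglongrightarrow> w \<omega>"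
    using borel_measurable_implies_sequence_metric[OF w, of 0] by blast
  have sp: "space G = space M" using G by (simp add: subalgebra_def)
  have "simple_function G (\<lambda>\<omega> x. a j \<omega> *\<^sub>R s j \<omega> x)" for j
    by (rule simple_function_compose2[OF a(1) s(1), where h="\<lambda>r v x. r *\<^sub>R v x"])
  moreover have "(\<lambda>\<omega> x. a j \<omega> *\<^sub>R s j \<omega> x) ` space G \<subseteq> L2per L" for j
    using s(2)[of j] by (auto intro!: L2per_scaleR)
  moreover have "AE \<omega> in M. (\<lambda>j. L2norm L ((\<lambda>x. w \<omega> *\<^sub>R u \<omega> x) - (\<lambda>x. a j \<omega> *\<^sub>R s j \<omega> x))) \<longlonglongrightarrow> 0"
    using u s(3) AE_space
  proof eventually_elim
    case (elim \<omega>)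
    have sj: "s j \<omega> \<in> L2per L" for j using s(2)[of j] elim(3) sp by auto
    have le: "L2norm L ((\<lambda>x. w \<omega> *\<^sub>R u \<omega> x) - (\<lambda>x. a j \<omega> *\<^sub>R s j \<omega> x))
        \<le> \<bar>w \<omega> - a j \<omega>\<bar> * L2norm L (u \<omega>) + \<bar>a j \<omega>\<bar> * L2norm L (u \<omega> - s j \<omega>)" for j
    proof -
      have "(\<lambda>x. w \<omega> *\<^sub>R u \<omega> x) - (\<lambda>x. a j \<omega> *\<^sub>R s j \<omega> x)
          = (\<lambda>x. (w \<omega> - a j \<omega>) *\<^sub>R u \<omega> x + a j \<omega> *\<^sub>R (u \<omega> - s j \<omega>) x)"
        by (simp add: fun_eq_iff algebra_simps)
      then show ?thesis
        using L2norm_triangle[OF L2per_scaleR[OF elim(1), of "w \<omega> - a j \<omega>"]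
            L2per_scaleR[OF L2per_diff'[OF elim(1) sj], of "a j \<omega>" j]]
        by (simp only: L2norm_scaleR)
    qed
    have aw: "(\<lambda>j. a j \<omega>) \<longlonglongrightarrow> w \<omega>" using a(2) elim(3) sp by simp
    have "(\<lambda>j. \<bar>w \<omega> - a j \<omega>\<bar> * L2norm L (u \<omega>) + \<bar>a j \<omega>\<bar> * L2norm L (u \<omega> - s j \<omega>))
        \<longlonglongrightarrow> \<bar>w \<omega> - w \<omega>\<bar> * L2norm L (u \<omega>) + \<bar>w \<omega>\<bar> * 0"
      by (intro tendsto_intros aw elim(2))
    then have "(\<lambda>j. \<bar>w \<omega> - a j \<omega>\<bar> * L2norm L (u \<omega>) + \<bar>a j \<omega>\<bar> * L2norm L (u \<omega> - s j \<omega>)) \<longlonglongrightarrow> 0" by simp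
    then show ?case by (rule Lim_null_comparison[rotated]) (simp add: le always_eventually)
  qed
  moreover have "AE \<omega> in M. (\<lambda>x. w \<omega> *\<^sub>R u \<omega> x) \<in> L2per L"
    using u by eventually_elim (rule L2per_scaleR)
  ultimately show ?thesis unfolding strongly_measurable_def
    by (intro conjI exI[of _ "\<lambda>j \<omega> x. a j \<omega> *\<^sub>R s j \<omega> x"]) auto
qed

lemma strongly_measurable_diff:
  fixes u v :: "'a \<Rightarrow> real^'d \<Rightarrow> 'b::euclidean_space"
  assumes G: "subalgebra M G"
    and u: "L2_measurable M G L u"
    and v: "L2_measurable M G L v"
  shows "L2_measurable M G L (\<lambda>\<omega>. u \<omega> - v \<omega>)"
proof -
  obtain s where uL: "AE \<omega> in M. u \<omega> \<in> L2per L" and s: "\<And>j. simple_function G (s j)" "\<And>j. s j ` space G \<subseteq> L2per L"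
    "AE \<omega> in M. (\<lambda>j. L2norm L (u \<omega> - s j \<omega>)) \<longlonglongrightarrow> 0"
    using u unfolding strongly_measurable_def by blast
  obtain t where vL: "AE \<omega> in M. v \<omega> \<in> L2per L" and t: "\<And>j. simple_function G (t j)" "\<And>j. t j ` space G \<subseteq> L2per L"
    "AE \<omega> in M. (\<lambda>j. L2norm L (v \<omega> - t j \<omega>)) \<longlonglongrightarrow> 0"
    using v unfolding strongly_measurable_def by blast
  have sp: "space G = space M" using G by (simp add: subalgebra_def)
  have "simple_function G (\<lambda>\<omega>. s j \<omega> - t j \<omega>)" for j
    by (rule simple_function_compose2[OF s(1) t(1), where h="(-)"])
  moreover have "(\<lambda>\<omega>. s j \<omega> - t j \<omega>) ` space G \<subseteq> L2per L" for j
    using s(2)[of j] t(2)[of j] by (auto intro!: L2per_diff')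
  moreover have "AE \<omega> in M. (\<lambda>j. L2norm L ((u \<omega> - v \<omega>) - (s j \<omega> - t j \<omega>))) \<longlonglongrightarrow> 0"
    using uL vL s(3) t(3) AE_space
  proof eventually_elim
    case (elim \<omega>)
    have st: "s j \<omega> \<in> L2per L" "t j \<omega> \<in> L2per L" for j using s(2)[of j] t(2)[of j] elim(5) sp by auto
    have le: "L2norm L ((u \<omega> - v \<omega>) - (s j \<omega> - t j \<omega>)) \<le> L2norm L (u \<omega> - s j \<omega>) + L2norm L (v \<omega> - t j \<omega>)" for j
    proof -
      have "(u \<omega> - v \<omega>) - (s j \<omega> - t j \<omega>) = (\<lambda>x. (u \<omega> - s j \<omega>) x + (t j \<omega> - v \<omega>) x)" by (simp add: fun_eq_iff)
      then show ?thesis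
        using L2norm_triangle[OF L2per_diff'[OF elim(1) st(1)] L2per_diff'[OF st(2) elim(2)], of j j]
        by (simp only: L2norm_minus_commute[of L "t j \<omega>"])
    qed
    have "(\<lambda>j. L2norm L (u \<omega> - s j \<omega>) + L2norm L (v \<omega> - t j \<omega>)) \<longlonglongrightarrow> 0"
      using tendsto_add[OF elim(3,4)] by simp
    then show ?case by (rule Lim_null_comparison[rotated]) (simp add: le always_eventually)
  qed
  moreover have "AE \<omega> in M. u \<omega> - v \<omega> \<in> L2per L"
    using uL vL by eventually_elim (rule L2per_diff')
  ultimately show ?thesis unfolding strongly_measurable_def
    by (intro conjI exI[of _ "\<lambda>j \<omega>. s j \<omega> - t j \<omega>"]) auto
qed

text \<open>The inner product is only an almost sure limit of \<open>G\<close>-measurable functions,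
  and \<open>G\<close> may lack null sets. A version \<open>Y\<close> is therefore what independence
  can be applied to.\<close>

lemma strongly_measurable_L2inner:
  fixes u v :: "'a \<Rightarrow> real^'d \<Rightarrow> 'b::euclidean_space"
  assumes G: "subalgebra M G"
    and u: "L2_measurable M G L u"
    and v: "L2_measurable M G L v"
  shows "\<exists>Y\<in>borel_measurable G. AE \<omega> in M. Y \<omega> = L2inner L (u \<omega>) (v \<omega>)"
proof -
  obtain s where uL: "AE \<omega> in M. u \<omega> \<in> L2per L" and s: "\<And>j. simple_function G (s j)" "\<And>j. s j ` space G \<subseteq> L2per L"
    "AE \<omega> in M. (\<lambda>j. L2norm L (u \<omega> - s j \<omega>)) \<longlonglongrightarrow> 0"
    using u unfolding strongly_measurable_def by blast
  obtain t where vL: "AE \<omega> in M. v \<omega> \<in> L2per L" and t: "\<And>j. simple_function G (t j)" "\<And>j. t j ` space G \<subseteq> L2per L"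
    "AE \<omega> in M. (\<lambda>j. L2norm L (v \<omega> - t j \<omega>)) \<longlonglongrightarrow> 0"
    using v unfolding strongly_measurable_def by blast
  have sp: "space G = space M" using G by (simp add: subalgebra_def)
  define y where "y j \<omega> = L2inner L (s j \<omega>) (t j \<omega>)" for j \<omega>
  have [measurable]: "y j \<in> borel_measurable G" for j
    unfolding y_def by (intro borel_measurable_simple_function simple_function_compose2[OF s(1) t(1)])
  have "AE \<omega> in M. (\<lambda>j. y j \<omega>) \<longlonglongrightarrow> L2inner L (u \<omega>) (v \<omega>)"
    using uL vL s(3) t(3) AE_space
  proof eventually_elim
    case (elim \<omega>)
    have st: "s j \<omega> \<in> L2per L" "t j \<omega> \<in> L2per L" for j using s(2)[of j] t(2)[of j] elim(5) sp by auto
    have le: "\<bar>y j \<omega> - L2inner L (u \<omega>) (v \<omega>)\<bar> \<le> L2norm L (u \<omega> - s j \<omega>) * L2norm L (v \<omega>)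
      + (L2norm L (u \<omega>) + L2norm L (u \<omega> - s j \<omega>)) * L2norm L (v \<omega> - t j \<omega>)" for j
    proof -
      have "L2norm L (s j \<omega>) \<le> L2norm L (u \<omega>) + L2norm L (u \<omega> - s j \<omega>)"
        using L2norm_triangle[OF elim(1) L2per_diff'[OF st(1) elim(1)], of j]
        by (simp add: L2norm_minus_commute[of L "s j \<omega>"])
      then have "L2norm L (s j \<omega>) * L2norm L (v \<omega> - t j \<omega>)
          \<le> (L2norm L (u \<omega>) + L2norm L (u \<omega> - s j \<omega>)) * L2norm L (v \<omega> - t j \<omega>)"
        by (intro mult_right_mono) auto
      moreover have "L2inner L (u \<omega>) (v \<omega>) - y j \<omega> = L2inner L (u \<omega> - s j \<omega>) (v \<omega>) + L2inner L (s j \<omega>) (v \<omega> - t j \<omega>)"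
        using elim st by (simp add: y_def L2inner_diff_left L2inner_diff_right)
      moreover have "\<bar>L2inner L (u \<omega> - s j \<omega>) (v \<omega>)\<bar> \<le> L2norm L (u \<omega> - s j \<omega>) * L2norm L (v \<omega>)"
        "\<bar>L2inner L (s j \<omega>) (v \<omega> - t j \<omega>)\<bar> \<le> L2norm L (s j \<omega>) * L2norm L (v \<omega> - t j \<omega>)"
        using elim st by (auto intro!: L2_Cauchy_Schwarz L2per_diff')
      ultimately show ?thesis by linarith
    qed
    have "(\<lambda>j. L2norm L (u \<omega> - s j \<omega>) * L2norm L (v \<omega>)
      + (L2norm L (u \<omega>) + L2norm L (u \<omega> - s j \<omega>)) * L2norm L (v \<omega> - t j \<omega>))
      \<longlonglongrightarrow> 0 * L2norm L (v \<omega>) + (L2norm L (u \<omega>) + 0) * 0"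
      by (intro tendsto_intros elim(3,4))
    then have "(\<lambda>j. L2norm L (u \<omega> - s j \<omega>) * L2norm L (v \<omega>)
      + (L2norm L (u \<omega>) + L2norm L (u \<omega> - s j \<omega>)) * L2norm L (v \<omega> - t j \<omega>)) \<longlonglongrightarrow> 0" by simp
    then have "(\<lambda>j. y j \<omega> - L2inner L (u \<omega>) (v \<omega>)) \<longlonglongrightarrow> 0"
      by (rule Lim_null_comparison[rotated]) (simp add: le always_eventually)
    then show ?case by (rule LIM_zero_cancel)
  qed
  then have "AE \<omega> in M. lim (\<lambda>j. y j \<omega>) = L2inner L (u \<omega>) (v \<omega>)"
    by eventually_elim (rule limI)
  moreover have "(\<lambda>\<omega>. lim (\<lambda>j. y j \<omega>)) \<in> borel_measurable G" by measurable
  ultimately show ?thesis by (intro bexI[of _ "\<lambda>\<omega>. lim (\<lambda>j. y j \<omega>)"])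
qed

section \<open>Adaptedness of the discrete solutions\<close>

text \<open>The two conclusions refer to different times: the projected coefficient is measurable at
  the old time, hence later independent of the increment, the velocity only at the new one.
  \<open>P\<close> collects the sample points at which all pathwise relations hold together.\<close>

lemma time_step_adapted:
  fixes u u' g :: "'a \<Rightarrow> real^'d \<Rightarrow> real^'d" and r \<xi> :: "'a \<Rightarrow> real^'d \<Rightarrow> real"
  assumes M: "prob_space M" and G: "subalgebra M G0" "subalgebra M G1" "subalgebra G1 G0"
    and L: "0 < L" and k: "0 < k" and C: "0 \<le> C"
    and B: "\<And>v. v \<in> L2per L \<Longrightarrow> B v \<in> L2per L"
      "\<And>v w. v \<in> L2per L \<Longrightarrow> w \<in> L2per L \<Longrightarrow> L2norm L (B v - B w) \<le> C * L2norm L (v - w)"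
    and u: "L2_measurable M G0 L u"
    and g: "L2_measurable M G1 L g"
    and dW: "dW \<in> borel_measurable G1"
    and P: "AE \<omega> in M. P \<omega>"
    and mem: "\<And>\<omega>. P \<omega> \<Longrightarrow> u \<omega> \<in> L2per L \<and> g \<omega> \<in> L2per L \<and> \<xi> \<omega> \<in> Hper L 1 \<and> u' \<omega> \<in> Hper L 1 \<and> r \<omega> \<in> L2per L"
    and hel: "\<And>\<omega> \<phi>. P \<omega> \<Longrightarrow> \<phi> \<in> Hper L 1 \<Longrightarrow>
      L2inner L (wgrad L (\<xi> \<omega>)) (wgrad L \<phi>) = L2inner L (B (u \<omega>)) (wgrad L \<phi>)"
    and mom: "\<And>\<omega>. P \<omega> \<Longrightarrow>
      momentum_eq L k (u \<omega>) (u' \<omega>) (r \<omega>) (g \<omega>) (B (u \<omega>) - wgrad L (\<xi> \<omega>)) (dW \<omega>)"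
    and sign: "\<And>\<omega> \<omega>'. P \<omega> \<Longrightarrow> P \<omega>' \<Longrightarrow> L2inner L (wdiv L (u' \<omega> - u' \<omega>')) (r \<omega> - r \<omega>') \<le> 0"
  shows "L2_measurable M G0 L (\<lambda>\<omega>. B (u \<omega>) - wgrad L (\<xi> \<omega>))"
    and "L2_measurable M G1 L u'"
proof -
  define \<eta> where "\<eta> \<omega> = B (u \<omega>) - wgrad L (\<xi> \<omega>)" for \<omega>
  have \<eta>L: "\<eta> \<omega> \<in> L2per L" if "P \<omega>" for \<omega>
    unfolding \<eta>_def using mem[OF that] B(1) by (intro L2per_diff' wgrad_L2per) auto
  show \<eta>: "L2_measurable M G0 L (\<lambda>\<omega>. B (u \<omega>) - wgrad L (\<xi> \<omega>))"
    unfolding \<eta>_def[symmetric]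
  proof (rule strongly_measurable_Lipschitz[OF M G(1) P u _ C])
    show "\<eta> \<omega> \<in> L2per L \<and> u \<omega> \<in> L2per L" if "P \<omega>" for \<omega> using \<eta>L mem that by simp
    fix \<omega> \<omega>' assume p: "P \<omega>" "P \<omega>'"
    have "L2norm L (\<eta> \<omega> - \<eta> \<omega>') \<le> L2norm L (B (u \<omega>) - B (u \<omega>'))"
      unfolding \<eta>_def using p mem B(1) hel
      by (intro Helmholtz_projection_contraction[OF L]) auto
    also have "\<dots> \<le> C * L2norm L (u \<omega> - u \<omega>')" using p mem B(2) by auto
    finally show "L2norm L (\<eta> \<omega> - \<eta> \<omega>') \<le> C * L2norm L (u \<omega> - u \<omega>')" .
  qed
  have "L2_measurable M G1 L \<eta>"
    using strongly_measurable_mono[OF \<eta> G(3)] by (simp add: \<eta>_def[abs_def])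
  then have W: "L2_measurable M G1 L (\<lambda>\<omega> x. dW \<omega> *\<^sub>R \<eta> \<omega> x)"
    by (rule strongly_measurable_scaleR[OF G(2) _ dW])
  define z where "z \<omega> = (\<lambda>x. dW \<omega> *\<^sub>R \<eta> \<omega> x)" for \<omega>
  have zL: "z \<omega> \<in> L2per L" if "P \<omega>" for \<omega> unfolding z_def by (rule L2per_scaleR[OF \<eta>L[OF that]])
  have u1: "L2_measurable M G1 L u" by (rule strongly_measurable_mono[OF u G(3)])
  obtain su where su: "\<And>j. simple_function G1 (su j)" "\<And>j. su j ` space G1 \<subseteq> L2per L"
    "AE \<omega> in M. (\<lambda>j. L2norm L (u \<omega> - su j \<omega>)) \<longlonglongrightarrow> 0"
    using u1 unfolding strongly_measurable_def by blast
  obtain sg where sg: "\<And>j. simple_function G1 (sg j)" "\<And>j. sg j ` space G1 \<subseteq> L2per L"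
    "AE \<omega> in M. (\<lambda>j. L2norm L (g \<omega> - sg j \<omega>)) \<longlonglongrightarrow> 0"
    using g unfolding strongly_measurable_def by blast
  obtain sz where sz: "\<And>j. simple_function G1 (sz j)" "\<And>j. sz j ` space G1 \<subseteq> L2per L"
    "AE \<omega> in M. (\<lambda>j. L2norm L (z \<omega> - sz j \<omega>)) \<longlonglongrightarrow> 0"
    using W unfolding strongly_measurable_def z_def by blast
  have sp: "space G1 = space M" using G by (simp add: subalgebra_def)
  let ?S = "\<lambda>j \<omega>. (su j \<omega>, sg j \<omega>, sz j \<omega>)"
  \<comment> \<open>The weights are those of \<open>momentum_eq_stability\<close>; coefficient and
    increment enter jointly through their product \<open>z\<close>.\<close>
  let ?\<rho> = "\<lambda>(a, b, c) \<omega>. L2norm L (u \<omega> - a) + k * L2norm L (g \<omega> - b) + L2norm L (z \<omega> - c)"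
  show "L2_measurable M G1 L u'"
  proof (rule strongly_measurable_transfer[OF M G(2) P, where S="?S" and \<rho>="?\<rho>" and Y="L2per L \<times> L2per L \<times> L2per L"])
    show "u' \<omega> \<in> L2per L" if "P \<omega>" for \<omega> using mem[OF that] Hper1D(1) by blast
    show "simple_function G1 (?S j)" for j using su(1) sg(1) sz(1) by (intro simple_function_Pair)
    show "?S j \<omega> \<in> L2per L \<times> L2per L \<times> L2per L" if "\<omega> \<in> space M" for j \<omega>
      using su(2)[of j] sg(2)[of j] sz(2)[of j] that sp by auto
    show "AE \<omega> in M. (\<lambda>j. ?\<rho> (?S j \<omega>) \<omega>) \<longlonglongrightarrow> 0"
      using su(3) sg(3) sz(3)
    proof eventually_elim
      case (elim \<omega>)
      have "(\<lambda>j. L2norm L (u \<omega> - su j \<omega>) + k * L2norm L (g \<omega> - sg j \<omega>) + L2norm L (z \<omega> - sz j \<omega>))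
          \<longlonglongrightarrow> 0 + k * 0 + 0"
        by (intro tendsto_intros elim)
      then show ?case by simp
    qed
    show "0 \<le> ?\<rho> y \<omega>" for y \<omega> using k by (cases y) simp
    fix \<omega> \<omega>' and y :: "(real^'d \<Rightarrow> real^'d) \<times> (real^'d \<Rightarrow> real^'d) \<times> (real^'d \<Rightarrow> real^'d)"
    assume p: "P \<omega>" "P \<omega>'" and "y \<in> L2per L \<times> L2per L \<times> L2per L"
    then obtain a b c :: "real^'d \<Rightarrow> real^'d" where y: "y = (a, b, c)" and abc: "a \<in> L2per L" "b \<in> L2per L" "c \<in> L2per L" by auto
    have "L2norm L (u' \<omega> - u' \<omega>') \<le> L2norm L (u \<omega> - u \<omega>') + k * L2norm L (g \<omega> - g \<omega>') + L2norm L (z \<omega> - z \<omega>')"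
      unfolding z_def
      by (rule momentum_eq_stability[OF L k mom[OF p(1), folded \<eta>_def] mom[OF p(2), folded \<eta>_def]])
        (use p mem \<eta>L sign in auto)
    also have "\<dots> \<le> (L2norm L (u \<omega> - a) + L2norm L (u \<omega>' - a)) + k * (L2norm L (g \<omega> - b) + L2norm L (g \<omega>' - b))
        + (L2norm L (z \<omega> - c) + L2norm L (z \<omega>' - c))"
    proof (intro add_mono mult_left_mono)
      show "L2norm L (u \<omega> - u \<omega>') \<le> L2norm L (u \<omega> - a) + L2norm L (u \<omega>' - a)"
        using L2norm_triangle_diff[of "u \<omega>" L "u \<omega>'" a] mem p abc by (simp add: L2norm_minus_commute[of L a])
      show "L2norm L (g \<omega> - g \<omega>') \<le> L2norm L (g \<omega> - b) + L2norm L (g \<omega>' - b)"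
        using L2norm_triangle_diff[of "g \<omega>" L "g \<omega>'" b] mem p abc by (simp add: L2norm_minus_commute[of L b])
      show "L2norm L (z \<omega> - z \<omega>') \<le> L2norm L (z \<omega> - c) + L2norm L (z \<omega>' - c)"
        using L2norm_triangle_diff[of "z \<omega>" L "z \<omega>'" c] zL p abc by (simp add: L2norm_minus_commute[of L c])
    qed (use k in simp)
    finally show "L2norm L (u' \<omega> - u' \<omega>') \<le> ?\<rho> y \<omega> + ?\<rho> y \<omega>'" by (simp add: y distrib_left)
  qed
qed

section \<open>Comparison of the Sobolev and Hoelder norms with the L2 norm\<close>

lemma L2norm_le_Hnorm_Suc: "L2norm L v \<le> Hnorm L (Suc m) v"
  by (simp add: real_le_rsqrt sum_nonneg)

lemma L2norm_le_Hnorm_1: "L2norm L v \<le> Hnorm L 1 v"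
  using L2norm_le_Hnorm_Suc[of L v 0] by (simp add: One_nat_def)

lemma L2norm_le_Hnorm_2: "L2norm L v \<le> Hnorm L 2 v"
  using L2norm_le_Hnorm_Suc[of L v 1] by (simp only: numeral_2_eq_2 One_nat_def)

lemma Hnorm_1: "Hnorm L 1 v = sqrt ((L2norm L v)\<^sup>2 + (\<Sum>i\<in>UNIV. (L2norm L (wpd L i v))\<^sup>2))"
  by (simp add: One_nat_def)

lemma Hnorm_1_nonneg: "0 \<le> Hnorm L 1 v"
  by (simp add: Hnorm_1 sum_nonneg)

lemma L2norm_wpd_le_Hnorm_1: "L2norm L (wpd L i v) \<le> Hnorm L 1 v"
proof -
  have "(L2norm L (wpd L i v))\<^sup>2 \<le> (\<Sum>i\<in>UNIV. (L2norm L (wpd L i v))\<^sup>2)" by (intro member_le_sum) auto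
  then show ?thesis unfolding Hnorm_1 by (intro real_le_rsqrt) (smt (verit) zero_le_power2)
qed

lemma Hnorm_1_le_sum: "Hnorm L 1 v \<le> L2norm L v + (\<Sum>i\<in>UNIV. L2norm L (wpd L i v))"
proof -
  have "Hnorm L 1 v \<le> sqrt ((L2norm L v)\<^sup>2) + sqrt (\<Sum>i\<in>UNIV. (L2norm L (wpd L i v))\<^sup>2)"
    unfolding Hnorm_1 by (intro sqrt_add_le_add_sqrt sum_nonneg) auto
  moreover have "sqrt (\<Sum>i\<in>UNIV. (L2norm L (wpd L i v))\<^sup>2) \<le> (\<Sum>i\<in>UNIV. L2norm L (wpd L i v))"
    using L2_set_le_sum[of UNIV "\<lambda>i. L2norm L (wpd L i v)"] by (simp add: L2_set_def)
  ultimately show ?thesis by simp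
qed

text \<open>A real supremum dominates the members of a family only if the family is bounded above.
  Most of the proof supplies such a bound from the value at time 0 and the Hoelder constant.\<close>

lemma L2norm_le_HoelderH1_norm:
  fixes g :: "real \<Rightarrow> real^'d \<Rightarrow> real^'d"
  assumes L: "0 < L" and T: "0 < T" and g: "g \<in> HoelderH1 L T" and t: "t \<in> {0..T}"
  shows "L2norm L (g t) \<le> HoelderH1_norm L T g"
proof -
  have gH: "g s \<in> Hper L 1" if "s \<in> {0..T}" for s using g that by (simp add: HoelderH1_def)
  obtain K where K: "\<And>s t. s \<in> {0..T} \<Longrightarrow> t \<in> {0..T} \<Longrightarrow> Hnorm L 1 (g t - g s) \<le> K * sqrt \<bar>t - s\<bar>"
    using g unfolding HoelderH1_def by blast
  define b where "b = \<bar>K\<bar> * sqrt T"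
  have b: "Hnorm L 1 (g s - g 0) \<le> b" if "s \<in> {0..T}" for s
  proof -
    have "Hnorm L 1 (g s - g 0) \<le> K * sqrt \<bar>s - 0\<bar>" using K[of 0 s] that T by simp
    also have "\<dots> \<le> b" unfolding b_def using that by (intro mult_mono) auto
    finally show ?thesis .
  qed
  have bdd: "Hnorm L 1 (g s) \<le> (b + L2norm L (g 0)) + (\<Sum>i\<in>UNIV. b + L2norm L (wpd L i (g 0)))"
    if s: "s \<in> {0..T}" for s
  proof -
    have 0: "0 \<in> {0..T}" using T by simp
    have "L2norm L (g s) \<le> L2norm L (g s - g 0) + L2norm L (g 0)"
      using L2norm_triangle[OF L2per_diff'[OF Hper1D(1)[OF gH[OF s]] Hper1D(1)[OF gH[OF 0]]] Hper1D(1)[OF gH[OF 0]]] by simp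
    then have 1: "L2norm L (g s) \<le> b + L2norm L (g 0)"
      using b[OF s] L2norm_le_Hnorm_1[of L "g s - g 0"] by linarith
    have 2: "L2norm L (wpd L i (g s)) \<le> b + L2norm L (wpd L i (g 0))" for i
    proof -
      note w = Hper1D(3)[OF gH[OF s], of i] Hper1D(3)[OF gH[OF 0], of i]
      have "L2norm L (wpd L i (g s - g 0)) = L2norm L (wpd L i (g s) - wpd L i (g 0))"
        using wpd_diff_AE[OF L gH[OF s] gH[OF 0], of i] w Hper1D(3)[OF Hper1_diff[OF gH[OF s] gH[OF 0]], of i]
        by (intro L2norm_cong_AE L2per_diff') auto
      then have "L2norm L (wpd L i (g s) - wpd L i (g 0)) \<le> b"
        using b[OF s] L2norm_wpd_le_Hnorm_1[of L i "g s - g 0"] by simp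
      moreover have "L2norm L (wpd L i (g s)) \<le> L2norm L (wpd L i (g s) - wpd L i (g 0)) + L2norm L (wpd L i (g 0))"
        using L2norm_triangle[OF L2per_diff'[OF w] w(2)] by simp
      ultimately show ?thesis by linarith
    qed
    have "(\<Sum>i\<in>UNIV. L2norm L (wpd L i (g s))) \<le> (\<Sum>i\<in>UNIV. b + L2norm L (wpd L i (g 0)))"
      by (intro sum_mono 2)
    then show ?thesis using Hnorm_1_le_sum[of L "g s"] 1 by linarith
  qed
  have "Hnorm L 1 (g t) \<le> (SUP t\<in>{0..T}. Hnorm L 1 (g t))"
    using t bdd by (intro cSUP_upper bdd_aboveI2) auto
  moreover have "0 \<le> (SUP (s, t)\<in>{(s, t). s \<in> {0..T} \<and> t \<in> {0..T} \<and> s \<noteq> t}. Hnorm L 1 (g t - g s) / sqrt \<bar>t - s\<bar>)"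
  \<comment> \<open>The pair \<open>(0, T)\<close> is a witness with distinct entries whose quotient
    is nonnegative.\<close>
  proof (rule cSUP_upper2[of _ _ "(0, T)"])
    have "Hnorm L 1 (g t - g s) / sqrt \<bar>t - s\<bar> \<le> K" if "s \<in> {0..T}" "t \<in> {0..T}" "s \<noteq> t" for s t
      using K[OF that(1,2)] that(3) by (simp add: divide_le_eq)
    then show "bdd_above ((\<lambda>(s, t). Hnorm L 1 (g t - g s) / sqrt \<bar>t - s\<bar>) ` {(s, t). s \<in> {0..T} \<and> t \<in> {0..T} \<and> s \<noteq> t})"
      by (intro bdd_aboveI2[where M=K]) auto
  qed (use T Hnorm_1_nonneg[of L "g T - g 0"] in auto)
  ultimately show ?thesis
    using L2norm_le_Hnorm_1[of L "g t"] unfolding HoelderH1_norm_def by linarith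
qed

lemma L2Omega_integrable_L2norm:
  fixes u :: "'a \<Rightarrow> real^'d \<Rightarrow> 'b::euclidean_space"
  assumes G: "subalgebra M G" and sm: "L2_measurable M G L u"
    and fin: "(\<integral>\<^sup>+\<omega>. ennreal ((nrm (u \<omega>))\<^sup>2) \<partial>M) < \<infinity>" and le: "\<And>v. L2norm L v \<le> nrm v"
  shows "\<exists>Y\<in>borel_measurable G. (AE \<omega> in M. Y \<omega> = (L2norm L (u \<omega>))\<^sup>2) \<and> integrable M Y"
proof -
  obtain Y where Y: "Y \<in> borel_measurable G" "AE \<omega> in M. Y \<omega> = (L2norm L (u \<omega>))\<^sup>2"
    using strongly_measurable_L2inner[OF G sm sm] unfolding L2norm_sq by blast
  have "(\<integral>\<^sup>+\<omega>. ennreal (norm (Y \<omega>)) \<partial>M) \<le> (\<integral>\<^sup>+\<omega>. ennreal ((nrm (u \<omega>))\<^sup>2) \<partial>M)"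
  proof (rule nn_integral_mono_AE)
    show "AE \<omega> in M. ennreal (norm (Y \<omega>)) \<le> ennreal ((nrm (u \<omega>))\<^sup>2)"
      using Y(2)
    proof eventually_elim
      case (elim \<omega>)
      have "(L2norm L (u \<omega>))\<^sup>2 \<le> (nrm (u \<omega>))\<^sup>2" by (intro power_mono le) simp
      then show ?case using elim by (simp add: ennreal_leI)
    qed
  qed
  then have "integrable M Y"
    using fin measurable_from_subalg[OF G Y(1)] by (intro integrableI_bounded) auto
  with Y show ?thesis by blast
qed

section \<open>Moments of Wiener increments\<close>

text \<open>Independence makes the products integrable when \<open>Y\<close> is merely integrable.
  This matters because \<open>Y\<close> will be quadratic in fields with finite second
  moments.\<close>

lemma (in prob_space) independent_normal_moments:
  fixes X Y :: "'a \<Rightarrow> real"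
  assumes G: "subalgebra M G" and h: "0 < h"
    and D: "distributed M lborel X (normal_density 0 (sqrt h))"
    and ind: "indep_set (sets G) (sets (vimage_algebra (space M) X borel))"
    and Y: "Y \<in> borel_measurable G" "integrable M Y"
  shows "integrable M (\<lambda>\<omega>. X \<omega> * Y \<omega>)" "expectation (\<lambda>\<omega>. X \<omega> * Y \<omega>) = 0"
    "integrable M (\<lambda>\<omega>. (X \<omega>)\<^sup>2 * Y \<omega>)" "expectation (\<lambda>\<omega>. (X \<omega>)\<^sup>2 * Y \<omega>) = h * expectation Y"
proof -
  have sp: "space G = space M" using G by (simp add: subalgebra_def)
  have X: "X \<in> borel_measurable M" using distributed_measurable[OF D] by simp
  have YM: "Y \<in> borel_measurable M" using Y(2) by auto
  have "sigma_sets (space M) {Y -` A \<inter> space M |A. A \<in> sets borel} \<subseteq> sets G"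
    using measurable_sets[OF Y(1)] unfolding sp[symmetric] by (intro sets.sigma_sets_subset) auto
  moreover have "sigma_sets (space M) {X -` A \<inter> space M |A. A \<in> sets borel} \<subseteq> sets (vimage_algebra (space M) X borel)"
    by (simp add: sets_vimage_algebra)
  ultimately have "indep_set (sigma_sets (space M) {Y -` A \<inter> space M |A. A \<in> sets borel})
      (sigma_sets (space M) {X -` A \<inter> space M |A. A \<in> sets borel})"
    using ind unfolding indep_sets2_eq by blast
  then have iv: "indep_var borel Y borel X" unfolding indep_var_eq using X YM by simp
  have iv2: "indep_var borel Y borel (\<lambda>\<omega>. (X \<omega>)\<^sup>2)"
    using indep_var_compose[OF iv, of "\<lambda>x. x" borel "\<lambda>x. x\<^sup>2" borel] by (simp add: comp_def)
  have s: "0 < sqrt h" using h by simp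
  have m1: "has_bochner_integral lborel (\<lambda>x. normal_density 0 (sqrt h) x * x) 0"
    using normal_moment_nz_1[OF s, of 0] .
  have m2: "has_bochner_integral lborel (\<lambda>x. normal_density 0 (sqrt h) x * x\<^sup>2) h"
    using normal_moment_even[OF s, of 0 1] h by (simp add: field_simps)
  have i1: "integrable M X" "expectation X = 0"
    using distributed_integrable[OF D, of "\<lambda>x. x"] distributed_integral[OF D, of "\<lambda>x. x"] m1
    by (auto simp: has_bochner_integral_iff)
  have i2: "integrable M (\<lambda>\<omega>. (X \<omega>)\<^sup>2)" "expectation (\<lambda>\<omega>. (X \<omega>)\<^sup>2) = h"
    using distributed_integrable[OF D, of "\<lambda>x. x\<^sup>2"] distributed_integral[OF D, of "\<lambda>x. x\<^sup>2"] m2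
    by (auto simp: has_bochner_integral_iff)
  show "integrable M (\<lambda>\<omega>. X \<omega> * Y \<omega>)" "expectation (\<lambda>\<omega>. X \<omega> * Y \<omega>) = 0"
    using indep_var_integrable[OF iv Y(2) i1(1)] indep_var_lebesgue_integral[OF iv Y(2) i1(1)] i1
    by (simp_all add: mult.commute)
  show "integrable M (\<lambda>\<omega>. (X \<omega>)\<^sup>2 * Y \<omega>)" "expectation (\<lambda>\<omega>. (X \<omega>)\<^sup>2 * Y \<omega>) = h * expectation Y"
    using indep_var_integrable[OF iv2 Y(2) i2(1)] indep_var_lebesgue_integral[OF iv2 Y(2) i2(1)] i2
    by (simp_all add: mult.commute)
qed

text \<open>\<open>b\<close> carries no measurability: its integral is only bounded from above, by
  that of an integrable majorant. The second conclusion ensures that \<open>ennreal\<close> in the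
  first one does not truncate a negative number.\<close>

lemma (in prob_space) expected_error_step:
  fixes X Y0 Y1 Z I \<Phi> :: "'a \<Rightarrow> real" and b :: "'a \<Rightarrow> ennreal"
  assumes G: "subalgebra M G" and k: "0 < k" and \<epsilon>: "0 < \<epsilon>"
    and D: "distributed M lborel X (normal_density 0 (sqrt k))"
    and ind: "indep_set (sets G) (sets (vimage_algebra (space M) X borel))"
    and m: "Z \<in> borel_measurable G" "I \<in> borel_measurable G"
    and i: "integrable M Y0" "integrable M Y1" "integrable M \<Phi>"
    and Z: "AE \<omega> in M. 0 \<le> Z \<omega> \<and> Z \<omega> \<le> c * Y0 \<omega>" and I: "AE \<omega> in M. \<bar>I \<omega>\<bar> \<le> Z \<omega> + Y0 \<omega>"
    and \<Phi>: "expectation \<Phi> \<le> Fb"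
    and b: "AE \<omega> in M. b \<omega> \<le> ennreal ((Y0 \<omega> - Y1 \<omega> + k * \<epsilon> * \<Phi> \<omega> + (X \<omega>)\<^sup>2 * Z \<omega> + 2 * (X \<omega> * I \<omega>)) / k)"
    and nn: "AE \<omega> in M. 0 \<le> Y0 \<omega> - Y1 \<omega> + k * \<epsilon> * \<Phi> \<omega> + (X \<omega>)\<^sup>2 * Z \<omega> + 2 * (X \<omega> * I \<omega>)"
  shows "ennreal k * (\<integral>\<^sup>+\<omega>. b \<omega> \<partial>M)
      \<le> ennreal (expectation Y0 - expectation Y1 + k * \<epsilon> * Fb + k * c * expectation Y0)"
    "0 \<le> expectation Y0 - expectation Y1 + k * \<epsilon> * Fb + k * c * expectation Y0"
proof -
  have iZ: "integrable M Z"
    by (rule Bochner_Integration.integrable_bound[of M "\<lambda>\<omega>. c * Y0 \<omega>"])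
      (use i Z measurable_from_subalg[OF G m(1)] in auto)
  have iI: "integrable M I"
    by (rule Bochner_Integration.integrable_bound[of M "\<lambda>\<omega>. Z \<omega> + Y0 \<omega>"])
      (use i iZ I measurable_from_subalg[OF G m(2)] in auto)
  define H where "H \<omega> = Y0 \<omega> - Y1 \<omega> + k * \<epsilon> * \<Phi> \<omega> + (X \<omega>)\<^sup>2 * Z \<omega> + 2 * (X \<omega> * I \<omega>)" for \<omega>
  note mZ = independent_normal_moments(3,4)[OF G k D ind m(1) iZ]
  note mI = independent_normal_moments(1,2)[OF G k D ind m(2) iI]
  have iH: "integrable M H" unfolding H_def using i mZ mI by auto
  have "expectation H = expectation Y0 - expectation Y1 + k * \<epsilon> * expectation \<Phi> + k * expectation Z"
    unfolding H_def using i mZ mI by simp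
  moreover have "expectation Z \<le> c * expectation Y0"
    using integral_mono_AE[OF iZ, of "\<lambda>\<omega>. c * Y0 \<omega>"] i Z by auto
  then have "k * expectation Z \<le> k * c * expectation Y0" using k by (simp add: mult.assoc)
  moreover have "k * \<epsilon> * expectation \<Phi> \<le> k * \<epsilon> * Fb" using \<Phi> k \<epsilon> by (intro mult_left_mono) auto
  ultimately have le: "expectation H \<le> expectation Y0 - expectation Y1 + k * \<epsilon> * Fb + k * c * expectation Y0" by linarith
  have H0: "AE \<omega> in M. 0 \<le> H \<omega>" using nn unfolding H_def .
  then have "0 \<le> expectation H" by (rule integral_nonneg_AE)
  with le show "0 \<le> expectation Y0 - expectation Y1 + k * \<epsilon> * Fb + k * c * expectation Y0" by linarith
  have "(\<integral>\<^sup>+\<omega>. b \<omega> \<partial>M) \<le> (\<integral>\<^sup>+\<omega>. ennreal (H \<omega> / k) \<partial>M)"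
    using b unfolding H_def by (rule nn_integral_mono_AE)
  also have "\<dots> = ennreal (expectation (\<lambda>\<omega>. H \<omega> / k))"
    using iH H0 k by (intro nn_integral_eq_integral) (auto elim: eventually_mono)
  also have "\<dots> = ennreal (expectation H / k)" by simp
  finally have "ennreal k * (\<integral>\<^sup>+\<omega>. b \<omega> \<partial>M) \<le> ennreal k * ennreal (expectation H / k)"
    by (rule mult_left_mono) simp
  also have "\<dots> = ennreal (expectation H)" using k \<open>0 \<le> expectation H\<close> by (simp add: ennreal_mult[symmetric])
  also have "\<dots> \<le> ennreal (expectation Y0 - expectation Y1 + k * \<epsilon> * Fb + k * c * expectation Y0)"
    using le by (rule ennreal_leI)
  finally show "ennreal k * (\<integral>\<^sup>+\<omega>. b \<omega> \<partial>M)
      \<le> ennreal (expectation Y0 - expectation Y1 + k * \<epsilon> * Fb + k * c * expectation Y0)" .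
qed

text \<open>\<open>d n\<close> stands for the bound on the gradient energy of a step. The sum
  \<open>a n\<close> plus all earlier \<open>d j\<close> is what grows by the factor
  \<open>1 + \<kappa>\<close>; nonnegativity of \<open>d\<close> lets this sum dominate
  \<open>a n\<close>.\<close>

lemma discrete_Gronwall:
  fixes a d :: "nat \<Rightarrow> real"
  assumes a0: "a 0 = 0" and q: "0 \<le> q" and \<kappa>: "0 \<le> \<kappa>"
    and d: "\<And>n. n < N \<Longrightarrow> d n = a n - a (Suc n) + q + \<kappa> * a n" "\<And>n. n < N \<Longrightarrow> 0 \<le> d n"
    and n: "n \<le> N"
  shows "a n + (\<Sum>j<n. d j) \<le> exp (real n * \<kappa>) * (real n * q)"
proof -
  have "a n + (\<Sum>j<n. d j) \<le> (1 + \<kappa>) ^ n * (real n * q)"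
    using n
  proof (induction n)
    case (Suc n)
    define S where "S = a n + (\<Sum>j<n. d j)"
    have S: "S \<le> (1 + \<kappa>) ^ n * (real n * q)" using Suc unfolding S_def by simp
    have "0 \<le> (\<Sum>j<n. d j)" using d(2) Suc.prems by (intro sum_nonneg) auto
    then have "\<kappa> * a n \<le> \<kappa> * S" unfolding S_def using \<kappa> by (intro mult_left_mono) auto
    moreover have "a (Suc n) + (\<Sum>j<Suc n. d j) = S + q + \<kappa> * a n"
      using d(1)[of n] Suc.prems by (simp add: S_def)
    ultimately have "a (Suc n) + (\<Sum>j<Suc n. d j) \<le> (1 + \<kappa>) * S + q" by (simp add: distrib_right)
    also have "\<dots> \<le> (1 + \<kappa>) * ((1 + \<kappa>) ^ n * (real n * q)) + (1 + \<kappa>) ^ Suc n * q"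
    proof (rule add_mono)
      show "(1 + \<kappa>) * S \<le> (1 + \<kappa>) * ((1 + \<kappa>) ^ n * (real n * q))" using S \<kappa> by (intro mult_left_mono) auto
      have "1 \<le> (1 + \<kappa>) ^ Suc n" using \<kappa> by (intro one_le_power) simp
      \<comment> \<open>The new source term is enlarged by a factor at least 1 to fit the product
        form of the claim.\<close>
      then show "q \<le> (1 + \<kappa>) ^ Suc n * q" using q mult_right_mono[of 1 "(1 + \<kappa>) ^ Suc n" q] by simp
    qed
    also have "\<dots> = (1 + \<kappa>) ^ Suc n * (real (Suc n) * q)" by (simp add: algebra_simps)
    finally show ?case .
  qed (simp add: a0)
  also have "\<dots> \<le> exp (real n * \<kappa>) * (real n * q)"
  proof (rule mult_right_mono)
    have "(1 + \<kappa>) ^ n \<le> exp \<kappa> ^ n" using \<kappa> by (intro power_mono exp_ge_add_one_self) auto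
    then show "(1 + \<kappa>) ^ n \<le> exp (real n * \<kappa>)" by (simp add: exp_of_nat_mult)
  qed (use q in simp)
  finally show ?thesis .
qed

section \<open>One step of the two algorithms\<close>

text \<open>What the two algorithms share at one sample point; only the divergence constraint tells
  them apart.\<close>

definition mixed_step ::
  "real \<Rightarrow> real \<Rightarrow> (real^'d \<Rightarrow> real^'d) \<Rightarrow> (real^'d \<Rightarrow> real^'d) \<Rightarrow> (real^'d \<Rightarrow> real) \<Rightarrow>
   (real^'d \<Rightarrow> real^'d) \<Rightarrow> (real^'d \<Rightarrow> real^'d) \<Rightarrow> (real^'d \<Rightarrow> real) \<Rightarrow> real \<Rightarrow> bool" where
  "mixed_step L k u u' r g b \<xi> dW \<longleftrightarrow>
     u \<in> Hper L 1 \<and> u' \<in> Hper L 1 \<and> r \<in> L2per L \<and> g \<in> L2per L \<and> b \<in> L2per L \<and> \<xi> \<in> Hper L 1 \<and>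
     (\<forall>\<phi>\<in>Hper L 1. L2inner L (wgrad L \<xi>) (wgrad L \<phi>) = L2inner L b (wgrad L \<phi>)) \<and>
     momentum_eq L k u u' r g (b - wgrad L \<xi>) dW"

definition exact_divergence :: "real \<Rightarrow> (real^'d \<Rightarrow> real^'d) \<Rightarrow> bool" where
  "exact_divergence L u \<longleftrightarrow> (\<forall>q\<in>L2per L. L2inner L (wdiv L u) q = 0)"

definition penalized_divergence :: "real \<Rightarrow> real \<Rightarrow> (real^'d \<Rightarrow> real^'d) \<Rightarrow> (real^'d \<Rightarrow> real) \<Rightarrow> bool" where
  "penalized_divergence L \<epsilon> u r \<longleftrightarrow> r \<in> Hper L 1 \<and>
     (\<forall>q\<in>Hper L 1. L2inner L (wdiv L u) q + \<epsilon> * L2inner L (wgrad L r) (wgrad L q) = 0)"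

text \<open>This provides the constraint for the initial datum, about which the equations of the
  algorithm say nothing.\<close>

lemma Vper_exact_divergence:
  fixes u :: "real^'d \<Rightarrow> real^'d"
  assumes "u \<in> Vper L" shows "u \<in> Hper L 1" "exact_divergence L u"
proof -
  show u: "u \<in> Hper L 1" using assms by (simp add: Vper_def)
  have "AE x in cell_measure L. wdiv L u x = 0"
    using assms by (intro AE_lborel_cell_measure) (simp add: Vper_def)
  then have "L2inner L (wdiv L u) q = L2inner L (\<lambda>x. 0) q" if "q \<in> L2per L" for q
    using that u by (intro L2inner_cong_AE wdiv_L2per) auto
  then show "exact_divergence L u" by (simp add: exact_divergence_def L2inner_eq)
qed

lemma exact_divergence_sign:
  fixes u u' :: "real^'d \<Rightarrow> real^'d"
  assumes L: "0 < L" and u: "u \<in> Hper L 1" "u' \<in> Hper L 1" and d: "exact_divergence L u" "exact_divergence L u'"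
    and r: "r \<in> L2per L" "r' \<in> L2per L"
  shows "L2inner L (wdiv L (u - u')) (r - r') \<le> 0"
  using L2inner_wdiv_diff[OF L u L2per_diff'[OF r]] d L2per_diff'[OF r] by (simp add: exact_divergence_def)

text \<open>Testing the difference of the constraints with \<open>r - r'\<close> gives
  \<open>- \<epsilon>\<close> times the squared norm of its gradient.\<close>

lemma penalized_divergence_sign:
  fixes u u' :: "real^'d \<Rightarrow> real^'d"
  assumes L: "0 < L" and \<epsilon>: "0 < \<epsilon>" and u: "u \<in> Hper L 1" "u' \<in> Hper L 1"
    and d: "penalized_divergence L \<epsilon> u r" "penalized_divergence L \<epsilon> u' r'"
  shows "L2inner L (wdiv L (u - u')) (r - r') \<le> 0"
proof -
  have r: "r \<in> Hper L 1" "r' \<in> Hper L 1" using d by (auto simp: penalized_divergence_def)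
  note q = Hper1_diff[OF r]
  have w: "wgrad L r \<in> L2per L" "wgrad L r' \<in> L2per L" "wgrad L (r - r') \<in> L2per L"
    using r q by (auto intro: wgrad_L2per)
  have "L2inner L (wdiv L (u - u')) (r - r')
      = - \<epsilon> * (L2inner L (wgrad L r) (wgrad L (r - r')) - L2inner L (wgrad L r') (wgrad L (r - r')))"
  proof -
    have "L2inner L (wdiv L u) (r - r') + \<epsilon> * L2inner L (wgrad L r) (wgrad L (r - r')) = 0"
      "L2inner L (wdiv L u') (r - r') + \<epsilon> * L2inner L (wgrad L r') (wgrad L (r - r')) = 0"
      using d q unfolding penalized_divergence_def by blast+
    then show ?thesis
      using L2inner_wdiv_diff[OF L u Hper1D(1)[OF q]] unfolding right_diff_distrib by linarith
  qed
  also have "L2inner L (wgrad L r) (wgrad L (r - r')) - L2inner L (wgrad L r') (wgrad L (r - r'))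
      = L2inner L (wgrad L (r - r')) (wgrad L (r - r'))"
    using L2inner_wgrad_diff[OF L r w(3)] by (simp add: L2inner_commute)
  also have "- \<epsilon> * L2inner L (wgrad L (r - r')) (wgrad L (r - r')) \<le> 0"
    using mult_nonneg_nonneg[OF less_imp_le[OF \<epsilon>] L2inner_self_nonneg[of L "wgrad L (r - r')"]] by linarith
  finally show ?thesis .
qed

text \<open>Pressure regularity enters twice: it bounds the consistency error, and it puts
  \<open>r - re\<close> into \<open>Hper L 1\<close>, without which \<open>grad_normsq\<close> would
  be infinite.\<close>

lemma pathwise_error_step:
  fixes u u' ue ue' g :: "real^'d \<Rightarrow> real^'d" and r re :: "real^'d \<Rightarrow> real"
  assumes L: "0 < L" and k: "0 < k" and \<epsilon>: "0 < \<epsilon>"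
    and s: "mixed_step L k u u' r g b \<xi> dW" "exact_divergence L u" "exact_divergence L u'"
    and se: "mixed_step L k ue ue' re g be \<xi>e dW" "penalized_divergence L \<epsilon> ue' re"
  defines "H \<equiv> (L2norm L (u - ue))\<^sup>2 - (L2norm L (u' - ue'))\<^sup>2 + k * \<epsilon> * (L2norm L g)\<^sup>2
      + dW\<^sup>2 * (L2norm L ((b - wgrad L \<xi>) - (be - wgrad L \<xi>e)))\<^sup>2
      + 2 * (dW * L2inner L ((b - wgrad L \<xi>) - (be - wgrad L \<xi>e)) (u - ue))"
  shows "0 \<le> H" "grad_normsq L (u' - ue') + ennreal \<epsilon> * grad_normsq L (r - re) \<le> ennreal (H / k)"
    and "L2norm L ((b - wgrad L \<xi>) - (be - wgrad L \<xi>e)) \<le> L2norm L (b - be)"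
proof -
  have 1: "u \<in> Hper L 1" "u' \<in> Hper L 1" "r \<in> L2per L" "g \<in> L2per L" "b \<in> L2per L" "\<xi> \<in> Hper L 1"
    "\<And>\<phi>. \<phi> \<in> Hper L 1 \<Longrightarrow> L2inner L (wgrad L \<xi>) (wgrad L \<phi>) = L2inner L b (wgrad L \<phi>)"
    "momentum_eq L k u u' r g (b - wgrad L \<xi>) dW"
    using s(1) by (auto simp: mixed_step_def)
  have 2: "ue \<in> Hper L 1" "ue' \<in> Hper L 1" "be \<in> L2per L" "\<xi>e \<in> Hper L 1"
    "\<And>\<phi>. \<phi> \<in> Hper L 1 \<Longrightarrow> L2inner L (wgrad L \<xi>e) (wgrad L \<phi>) = L2inner L be (wgrad L \<phi>)"
    "momentum_eq L k ue ue' re g (be - wgrad L \<xi>e) dW"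
    using se(1) by (auto simp: mixed_step_def)
  have re: "re \<in> Hper L 1" using se(2) by (simp add: penalized_divergence_def)
  have rr: "r \<in> Hper L 1" "(\<Sum>i\<in>UNIV. (L2norm L (wpd L i r))\<^sup>2) \<le> (L2norm L g)\<^sup>2"
    using pressure_regularity[OF L k 1(8,1,2,3,4,5,6,7)] s(2,3) by (auto simp: exact_divergence_def)
  let ?E = "\<Sum>i\<in>UNIV. (L2norm L (wpd L i (u' - ue')))\<^sup>2"
  let ?P = "\<Sum>i\<in>UNIV. (L2norm L (wpd L i (r - re)))\<^sup>2"
  have le: "k * (?E + \<epsilon> * ?P) \<le> H"
    unfolding H_def
    by (rule error_step[OF L k \<epsilon> 1(8) 2(6) Hper1D(1)[OF 1(1)] Hper1D(1)[OF 2(1)] 1(4) _ _ 1(2) 2(2) rr(1) re rr(2)])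
      (use 1 2 s se in \<open>auto simp: exact_divergence_def penalized_divergence_def intro: L2per_diff' wgrad_L2per\<close>)
  have nn: "0 \<le> ?E" "0 \<le> ?P" by (auto intro: sum_nonneg)
  then show "0 \<le> H" using le k \<epsilon> by (smt (verit) mult_nonneg_nonneg)
  have "grad_normsq L (u' - ue') + ennreal \<epsilon> * grad_normsq L (r - re) = ennreal (?E + \<epsilon> * ?P)"
    using nn \<epsilon> by (simp add: grad_normsq_eq[OF Hper1_diff[OF 1(2) 2(2)]] grad_normsq_eq[OF Hper1_diff[OF rr(1) re]]
        ennreal_mult[symmetric])
  also have "\<dots> \<le> ennreal (H / k)" using le k by (intro ennreal_leI) (simp add: le_divide_eq mult.commute)
  finally show "grad_normsq L (u' - ue') + ennreal \<epsilon> * grad_normsq L (r - re) \<le> ennreal (H / k)" .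
  show "L2norm L ((b - wgrad L \<xi>) - (be - wgrad L \<xi>e)) \<le> L2norm L (b - be)"
    by (rule Helmholtz_projection_contraction[OF L 1(5) 2(3) 1(6) 2(4) 1(7) 2(5)])
qed

section \<open>The error estimate\<close>

locale stochastic_Stokes_data = prob_space M
  for M :: "'a measure" +
  fixes F :: "real \<Rightarrow> 'a measure" and W :: "real \<Rightarrow> 'a \<Rightarrow> real" and L T C :: real
    and u0 :: "'a \<Rightarrow> real^'d \<Rightarrow> real^'d" and f :: "'a \<Rightarrow> real \<Rightarrow> real^'d \<Rightarrow> real^'d"
    and B :: "(real^'d \<Rightarrow> real^'d) \<Rightarrow> (real^'d \<Rightarrow> real^'d)"
  assumes L: "0 < L" and T: "0 < T" and C: "0 < C"
    and filtration: "continuous_filtration M T F" and wiener: "wiener_process M T F W"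
    and initial: "initial_datum M F L u0" and forcing: "forcing M F L T f"
    and B_L2: "v \<in> L2per L \<Longrightarrow> B v \<in> L2per L"
    and B_Lipschitz: "v \<in> L2per L \<Longrightarrow> w \<in> L2per L \<Longrightarrow> L2norm L (B v - B w) \<le> C * L2norm L (v - w)"
begin

lemma F_subalgebra: "t \<in> {0..T} \<Longrightarrow> subalgebra M (F t)"
  using filtration by (simp add: continuous_filtration_def)

lemma F_mono: "0 \<le> s \<Longrightarrow> s \<le> t \<Longrightarrow> t \<le> T \<Longrightarrow> subalgebra (F t) (F s)"
  using filtration F_subalgebra[of s] F_subalgebra[of t]
  by (simp add: continuous_filtration_def subalgebra_def)

lemma W_measurable: "t \<in> {0..T} \<Longrightarrow> W t \<in> borel_measurable (F t)"
  using wiener by (simp add: wiener_process_def)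

lemma increment_measurable:
  assumes "0 \<le> s" "s \<le> t" "t \<le> T" shows "(\<lambda>\<omega>. W t \<omega> - W s \<omega>) \<in> borel_measurable (F t)"
  using measurable_from_subalg[OF F_mono[OF assms] W_measurable] W_measurable[of t] assms by auto

lemma increment_distribution:
  assumes "0 \<le> s" "s < t" "t \<le> T"
  shows "distributed M lborel (\<lambda>\<omega>. W t \<omega> - W s \<omega>) (normal_density 0 (sqrt (t - s)))"
    "indep_set (sets (F s)) (sets (vimage_algebra (space M) (\<lambda>\<omega>. W t \<omega> - W s \<omega>) borel))"
  using wiener assms by (simp_all add: wiener_process_def)

lemma Vper_Hper_2_L2per: "Vper L \<inter> Hper L 2 \<subseteq> L2per L"
  using Vper_exact_divergence(1) Hper1D(1) by blast

lemma initial_adapted: "L2_measurable M (F 0) L u0"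
  using initial unfolding initial_datum_def
  by (intro strongly_measurable_L2per[OF _ Vper_Hper_2_L2per L2norm_le_Hnorm_2]) auto

lemma forcing_adapted:
  assumes "t \<in> {0..T}"
  shows "L2_measurable M (F t) L (\<lambda>\<omega>. f \<omega> t)"
proof (rule strongly_measurable_L2per)
  show "strongly_measurable M (F t) (Hper L 1) (Hnorm L 1) (\<lambda>\<omega>. f \<omega> t)"
    using forcing assms by (simp add: forcing_def)
  show "Hper L 1 \<subseteq> (L2per L :: (real^'d \<Rightarrow> real^'d) set)" using Hper1D(1) by blast
qed (rule L2norm_le_Hnorm_1)

text \<open>The Hoelder norm dominates the L2 norm at every time, so this single number serves all
  nodes of all meshes. It is finite by assumption, hence \<open>enn2real\<close> loses
  nothing.\<close>

definition forcing_bound :: real where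
  "forcing_bound = enn2real (\<integral>\<^sup>+\<omega>. ennreal ((HoelderH1_norm L T (f \<omega>))\<^sup>2) \<partial>M)"

lemma forcing_energy:
  assumes t: "t \<in> {0..T}"
  obtains \<Phi> where "AE \<omega> in M. \<Phi> \<omega> = (L2norm L (f \<omega> t))\<^sup>2" "integrable M \<Phi>" "expectation \<Phi> \<le> forcing_bound"
proof -
  let ?I = "\<integral>\<^sup>+\<omega>. ennreal ((HoelderH1_norm L T (f \<omega>))\<^sup>2) \<partial>M"
  obtain \<Phi> where m: "\<Phi> \<in> borel_measurable (F t)" and \<Phi>: "AE \<omega> in M. \<Phi> \<omega> = L2inner L (f \<omega> t) (f \<omega> t)"
    using strongly_measurable_L2inner[OF F_subalgebra[OF t] forcing_adapted[OF t] forcing_adapted[OF t]] by blast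
  have fin: "?I < \<infinity>" and fH: "AE \<omega> in M. f \<omega> \<in> HoelderH1 L T"
    using forcing by (auto simp: forcing_def L2Omega_def strongly_measurable_def)
  have le: "(\<integral>\<^sup>+\<omega>. ennreal (norm (\<Phi> \<omega>)) \<partial>M) \<le> ?I"
  proof (rule nn_integral_mono_AE)
    show "AE \<omega> in M. ennreal (norm (\<Phi> \<omega>)) \<le> ennreal ((HoelderH1_norm L T (f \<omega>))\<^sup>2)"
      using \<Phi> fH
    proof eventually_elim
      case (elim \<omega>)
      have "(L2norm L (f \<omega> t))\<^sup>2 \<le> (HoelderH1_norm L T (f \<omega>))\<^sup>2"
        by (intro power_mono L2norm_le_HoelderH1_norm[OF L T elim(2) t]) simp
      then show ?case using elim(1) by (intro ennreal_leI) (simp add: L2norm_sq)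
    qed
  qed
  then have i: "integrable M \<Phi>"
    using fin measurable_from_subalg[OF F_subalgebra[OF t] m] by (intro integrableI_bounded) auto
  have "ennreal (expectation (\<lambda>\<omega>. norm (\<Phi> \<omega>))) \<le> ?I"
    using le i by (subst nn_integral_eq_integral[symmetric]) auto
  also have "?I = ennreal forcing_bound" unfolding forcing_bound_def using fin by simp
  finally have "expectation (\<lambda>\<omega>. norm (\<Phi> \<omega>)) \<le> forcing_bound"
    by (simp add: forcing_bound_def)
  moreover have "expectation \<Phi> \<le> expectation (\<lambda>\<omega>. norm (\<Phi> \<omega>))"
    using i by (intro integral_mono) auto
  ultimately have "expectation \<Phi> \<le> forcing_bound" by linarith
  with \<Phi> i show ?thesis by (intro that) (auto simp: L2norm_sq)
qed

section \<open>Time nodes and the almost sure relations of one step\<close>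

definition node :: "nat \<Rightarrow> nat \<Rightarrow> real" where
  "node N n = real n * (T / real N)"

lemma node_bounds:
  assumes "1 \<le> N" "n \<le> N"
  shows "0 \<le> node N n" "node N n \<le> T" "node N n \<in> {0..T}"
proof -
  show 0: "0 \<le> node N n" using T by (simp add: node_def)
  have "real n * (T / real N) \<le> real N * (T / real N)" using assms T by (intro mult_right_mono) auto
  then show 1: "node N n \<le> T" using assms by (simp add: node_def)
  show "node N n \<in> {0..T}" using 0 1 by simp
qed

lemma node_Suc: "node N (Suc n) = node N n + T / real N"
  by (simp add: node_def distrib_right add_divide_distrib)

lemma node_mono: "node N n \<le> node N (Suc n)"
  using T by (simp add: node_Suc)

abbreviation increment :: "nat \<Rightarrow> nat \<Rightarrow> 'a \<Rightarrow> real" where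
  "increment N n \<omega> \<equiv> W (node N (Suc n)) \<omega> - W (node N n) \<omega>"

lemma AE_forcing:
  assumes "1 \<le> N" "n < N"
  shows "AE \<omega> in M. f \<omega> (node N (Suc n)) \<in> L2per L"
  using forcing_adapted[OF node_bounds(3)[of N "Suc n"]] assms by (simp add: strongly_measurable_def)

lemma L2Omega_second_moment:
  assumes "v \<in> L2Omega M X nrm" "\<And>w. L2norm L w \<le> nrm w"
  shows "(\<integral>\<^sup>+\<omega>. ennreal ((L2norm L (v \<omega>))\<^sup>2) \<partial>M) < \<infinity>"
proof -
  have "(\<integral>\<^sup>+\<omega>. ennreal ((L2norm L (v \<omega>))\<^sup>2) \<partial>M) \<le> (\<integral>\<^sup>+\<omega>. ennreal ((nrm (v \<omega>))\<^sup>2) \<partial>M)"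
    by (intro nn_integral_mono ennreal_leI power_mono assms(2)) simp
  then show ?thesis using assms(1) by (auto simp: L2Omega_def)
qed

lemma initial_second_moment: "(\<integral>\<^sup>+\<omega>. ennreal ((L2norm L (u0 \<omega>))\<^sup>2) \<partial>M) < \<infinity>"
  using initial unfolding initial_datum_def by (intro L2Omega_second_moment[OF _ L2norm_le_Hnorm_2]) auto

lemma AE_initial: "AE \<omega> in M. u0 \<omega> \<in> Vper L"
  using initial by (auto simp: initial_datum_def L2Omega_def strongly_measurable_def)

lemma AE_L2Omega: "v \<in> L2Omega M X nrm \<Longrightarrow> AE \<omega> in M. v \<omega> \<in> X"
  by (simp add: L2Omega_def strongly_measurable_def)

abbreviation scheme_step where
  "scheme_step N n u r \<xi> \<omega> \<equiv> mixed_step L (T / real N) (u n \<omega>) (u (Suc n) \<omega>) (r (Suc n) \<omega>)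
    (f \<omega> (node N (Suc n))) (B (u n \<omega>)) (\<xi> \<omega>) (increment N n \<omega>)"

text \<open>Covers both algorithms: \<open>X\<close> and \<open>R\<close> are the velocity and
  pressure spaces, \<open>Q\<close> is the divergence constraint. Merging all almost sure relations
  of a step allows later arguments to fix one sample point.\<close>

lemma scheme_stepsI:
  assumes N: "1 \<le> N" and u0: "u 0 = u0" and X: "X \<subseteq> Hper L 1" "AE \<omega> in M. u0 \<omega> \<in> X" and R: "R \<subseteq> L2per L"
    and step: "\<And>n. n < N \<Longrightarrow> \<exists>\<xi>. helmholtz_potential M L (\<lambda>\<omega>. B (u n \<omega>)) \<xi> \<and>
      u (Suc n) \<in> L2Omega M X (Hnorm L 1) \<and> r (Suc n) \<in> L2Omega M R nrm \<and>
      (AE \<omega> in M. momentum_eq L (T / real N) (u n \<omega>) (u (Suc n) \<omega>) (r (Suc n) \<omega>) (f \<omega> (node N (Suc n)))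
        (B (u n \<omega>) - wgrad L (\<xi> \<omega>)) (increment N n \<omega>) \<and> Q n \<omega>)"
  shows "n \<le> N \<Longrightarrow> AE \<omega> in M. u n \<omega> \<in> X"
    and "n \<le> N \<Longrightarrow> (\<integral>\<^sup>+\<omega>. ennreal ((L2norm L (u n \<omega>))\<^sup>2) \<partial>M) < \<infinity>"
    and "n < N \<Longrightarrow> \<exists>\<xi>. AE \<omega> in M. scheme_step N n u r \<xi> \<omega>
      \<and> u n \<omega> \<in> X \<and> u (Suc n) \<omega> \<in> X \<and> r (Suc n) \<omega> \<in> R \<and> Q n \<omega>"
proof -
  have U: "u (Suc n) \<in> L2Omega M X (Hnorm L 1)" if "n < N" for n using step[OF that] by blast
  \<comment> \<open>Index 0 is the initial datum, every other index the output of the preceding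
    step.\<close>
  show V: "AE \<omega> in M. u n \<omega> \<in> X" if "n \<le> N" for n
    using that u0 X(2) AE_L2Omega[OF U] by (cases n) auto
  show "(\<integral>\<^sup>+\<omega>. ennreal ((L2norm L (u n \<omega>))\<^sup>2) \<partial>M) < \<infinity>" if "n \<le> N" for n
    using that u0 initial_second_moment L2Omega_second_moment[OF U L2norm_le_Hnorm_1] by (cases n) auto
  show "\<exists>\<xi>. AE \<omega> in M. scheme_step N n u r \<xi> \<omega>
      \<and> u n \<omega> \<in> X \<and> u (Suc n) \<omega> \<in> X \<and> r (Suc n) \<omega> \<in> R \<and> Q n \<omega>" if n: "n < N" for n
  proof -
    obtain \<xi> where \<xi>: "helmholtz_potential M L (\<lambda>\<omega>. B (u n \<omega>)) \<xi>"
      and r: "r (Suc n) \<in> L2Omega M R nrm"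
      and mom: "AE \<omega> in M. momentum_eq L (T / real N) (u n \<omega>) (u (Suc n) \<omega>) (r (Suc n) \<omega>) (f \<omega> (node N (Suc n)))
             (B (u n \<omega>) - wgrad L (\<xi> \<omega>)) (increment N n \<omega>) \<and> Q n \<omega>"
      using step[OF n] by blast
    have hel: "AE \<omega> in M. \<forall>\<phi>\<in>Hper L 1. L2inner L (wgrad L (\<xi> \<omega>)) (wgrad L \<phi>) = L2inner L (B (u n \<omega>)) (wgrad L \<phi>)"
      and \<xi>H: "AE \<omega> in M. \<xi> \<omega> \<in> Hper L 1 \<inter> mean_zero L"
      using \<xi> AE_L2Omega[of \<xi>] unfolding helmholtz_potential_def by blast+
    have "AE \<omega> in M. scheme_step N n u r \<xi> \<omega>
      \<and> u n \<omega> \<in> X \<and> u (Suc n) \<omega> \<in> X \<and> r (Suc n) \<omega> \<in> R \<and> Q n \<omega>"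
      using mom hel \<xi>H AE_L2Omega[OF r] AE_forcing[OF N n] V[OF less_imp_le[OF n]] V[OF Suc_leI[OF n]]
    proof eventually_elim
      case (elim \<omega>)
      then show ?case
        using X(1) R B_L2[OF Hper1D(1), of "u n \<omega>"] unfolding mixed_step_def by blast
    qed
    then show ?thesis by blast
  qed
qed

lemma algorithm1D:
  assumes N: "1 \<le> N" and alg: "algorithm1 M L T W u0 f B N u r"
  shows "u 0 = u0"
    and "n \<le> N \<Longrightarrow> AE \<omega> in M. u n \<omega> \<in> Hper L 1"
    and "n \<le> N \<Longrightarrow> (\<integral>\<^sup>+\<omega>. ennreal ((L2norm L (u n \<omega>))\<^sup>2) \<partial>M) < \<infinity>"
    and "n < N \<Longrightarrow> \<exists>\<xi>. AE \<omega> in M. scheme_step N n u r \<xi> \<omega>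
      \<and> exact_divergence L (u n \<omega>) \<and> exact_divergence L (u (Suc n) \<omega>)"
proof -
  show u0: "u 0 = u0" using alg by (simp add: algorithm1_def Let_def)
  have V: "Vper L \<subseteq> (Hper L 1 :: (real^'d \<Rightarrow> real^'d) set)" using Vper_exact_divergence(1) by blast
  note s = scheme_stepsI[where u=u and r=r and X="Vper L" and R="L2per L \<inter> mean_zero L" and nrm="L2norm L"
      and Q="\<lambda>n \<omega>. \<forall>q\<in>L2per L. L2inner L (wdiv L (u (Suc n) \<omega>)) q = 0", OF N u0 V AE_initial Int_lower1]
  have step: "\<exists>\<xi>. helmholtz_potential M L (\<lambda>\<omega>. B (u n \<omega>)) \<xi> \<and>
      u (Suc n) \<in> L2Omega M (Vper L) (Hnorm L 1) \<and> r (Suc n) \<in> L2Omega M (L2per L \<inter> mean_zero L) (L2norm L) \<and>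
      (AE \<omega> in M. momentum_eq L (T / real N) (u n \<omega>) (u (Suc n) \<omega>) (r (Suc n) \<omega>) (f \<omega> (node N (Suc n)))
        (B (u n \<omega>) - wgrad L (\<xi> \<omega>)) (increment N n \<omega>) \<and>
        (\<forall>q\<in>L2per L. L2inner L (wdiv L (u (Suc n) \<omega>)) q = 0))" if "n < N" for n
    using alg that unfolding algorithm1_def Let_def node_def by blast
  show "n \<le> N \<Longrightarrow> AE \<omega> in M. u n \<omega> \<in> Hper L 1"
    using s(1)[OF step, of n] V by (auto elim: eventually_mono)
  show "n \<le> N \<Longrightarrow> (\<integral>\<^sup>+\<omega>. ennreal ((L2norm L (u n \<omega>))\<^sup>2) \<partial>M) < \<infinity>" by (rule s(2)[OF step])
  assume n: "n < N"
  obtain \<xi> where "AE \<omega> in M. scheme_step N n u r \<xi> \<omega> \<and> u n \<omega> \<in> Vper L \<and> u (Suc n) \<omega> \<in> Vper L \<and>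
      r (Suc n) \<omega> \<in> L2per L \<inter> mean_zero L \<and> (\<forall>q\<in>L2per L. L2inner L (wdiv L (u (Suc n) \<omega>)) q = 0)"
    using s(3)[OF step n] by blast
  \<comment> \<open>Exactness is read off from \<open>Vper\<close>, which also covers the old level
    when \<open>n = 0\<close>.\<close>
  then have "AE \<omega> in M. scheme_step N n u r \<xi> \<omega> \<and> exact_divergence L (u n \<omega>) \<and> exact_divergence L (u (Suc n) \<omega>)"
    by eventually_elim (use Vper_exact_divergence(2) in blast)
  then show "\<exists>\<xi>. AE \<omega> in M. scheme_step N n u r \<xi> \<omega>
      \<and> exact_divergence L (u n \<omega>) \<and> exact_divergence L (u (Suc n) \<omega>)" by blast
qed

lemma algorithm3D:
  assumes N: "1 \<le> N" and alg: "algorithm3 M L T W u0 f B N \<epsilon> u r"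
  shows "u 0 = u0"
    and "n \<le> N \<Longrightarrow> AE \<omega> in M. u n \<omega> \<in> Hper L 1"
    and "n \<le> N \<Longrightarrow> (\<integral>\<^sup>+\<omega>. ennreal ((L2norm L (u n \<omega>))\<^sup>2) \<partial>M) < \<infinity>"
    and "n < N \<Longrightarrow> \<exists>\<xi>. AE \<omega> in M. scheme_step N n u r \<xi> \<omega>
      \<and> penalized_divergence L \<epsilon> (u (Suc n) \<omega>) (r (Suc n) \<omega>)"
proof -
  show u0: "u 0 = u0" using alg by (simp add: algorithm3_def Let_def)
  have u0H: "AE \<omega> in M. u0 \<omega> \<in> Hper L 1"
    using AE_initial by eventually_elim (rule Vper_exact_divergence(1))
  have R: "Hper L 1 \<inter> mean_zero L \<subseteq> (L2per L :: (real^'d \<Rightarrow> real) set)" using Hper1D(1) by blast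
  let ?Q = "\<lambda>n \<omega>. \<forall>q\<in>Hper L 1. L2inner L (wdiv L (u (Suc n) \<omega>)) q
      + \<epsilon> * L2inner L (wgrad L (r (Suc n) \<omega>)) (wgrad L q) = 0"
  note s = scheme_stepsI[where u=u and r=r and X="Hper L 1" and R="Hper L 1 \<inter> mean_zero L" and nrm="Hnorm L 1" and Q="?Q",
      OF N u0 order_refl u0H R]
  have step: "\<exists>\<xi>. helmholtz_potential M L (\<lambda>\<omega>. B (u n \<omega>)) \<xi> \<and>
      u (Suc n) \<in> L2Omega M (Hper L 1) (Hnorm L 1) \<and> r (Suc n) \<in> L2Omega M (Hper L 1 \<inter> mean_zero L) (Hnorm L 1) \<and>
      (AE \<omega> in M. momentum_eq L (T / real N) (u n \<omega>) (u (Suc n) \<omega>) (r (Suc n) \<omega>) (f \<omega> (node N (Suc n)))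
        (B (u n \<omega>) - wgrad L (\<xi> \<omega>)) (increment N n \<omega>) \<and> ?Q n \<omega>)" if "n < N" for n
    using alg that unfolding algorithm3_def Let_def node_def by blast
  show "n \<le> N \<Longrightarrow> AE \<omega> in M. u n \<omega> \<in> Hper L 1" by (rule s(1)[OF step])
  show "n \<le> N \<Longrightarrow> (\<integral>\<^sup>+\<omega>. ennreal ((L2norm L (u n \<omega>))\<^sup>2) \<partial>M) < \<infinity>" by (rule s(2)[OF step])
  assume n: "n < N"
  show "\<exists>\<xi>. AE \<omega> in M. scheme_step N n u r \<xi> \<omega>
      \<and> penalized_divergence L \<epsilon> (u (Suc n) \<omega>) (r (Suc n) \<omega>)"
    using s(3)[OF step n] unfolding penalized_divergence_def by (auto elim!: eventually_mono)
qed

text \<open>\<open>Q\<close> is the constraint of either algorithm; it acts only through the sign it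
  gives to the pressure term.\<close>

lemma mixed_step_adapted:
  fixes u u' :: "'a \<Rightarrow> real^'d \<Rightarrow> real^'d"
  assumes N: "1 \<le> N" and n: "n < N"
    and P: "AE \<omega> in M. mixed_step L (T / real N) (u \<omega>) (u' \<omega>) (r \<omega>)
      (f \<omega> (node N (Suc n))) (B (u \<omega>)) (\<xi> \<omega>) (increment N n \<omega>) \<and> Q \<omega>"
    and sign: "\<And>\<omega> \<omega>'. u' \<omega> \<in> Hper L 1 \<Longrightarrow> u' \<omega>' \<in> Hper L 1 \<Longrightarrow> r \<omega> \<in> L2per L \<Longrightarrow> r \<omega>' \<in> L2per L \<Longrightarrow>
      Q \<omega> \<Longrightarrow> Q \<omega>' \<Longrightarrow> L2inner L (wdiv L (u' \<omega> - u' \<omega>')) (r \<omega> - r \<omega>') \<le> 0"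
    and u: "L2_measurable M (F (node N n)) L u"
  shows "L2_measurable M (F (node N n)) L (\<lambda>\<omega>. B (u \<omega>) - wgrad L (\<xi> \<omega>))"
    and "L2_measurable M (F (node N (Suc n))) L u'"
proof -
  note b = node_bounds[OF N less_imp_le[OF n]] node_bounds[OF N Suc_leI[OF n]]
  have k: "0 < T / real N" using T N by simp
  note rule = time_step_adapted[where u=u and u'=u' and r=r and \<xi>=\<xi> and B=B and C=C and k="T / real N"
      and g="\<lambda>\<omega>. f \<omega> (node N (Suc n))" and dW="increment N n"
      and P="\<lambda>\<omega>. mixed_step L (T / real N) (u \<omega>) (u' \<omega>) (r \<omega>)
      (f \<omega> (node N (Suc n))) (B (u \<omega>)) (\<xi> \<omega>) (increment N n \<omega>) \<and> Q \<omega>",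
      OF prob_space_axioms F_subalgebra[OF b(3)] F_subalgebra[OF b(6)] F_mono[OF b(1) node_mono b(5)] L k
      less_imp_le[OF C] B_L2 B_Lipschitz u forcing_adapted[OF b(6)]
      increment_measurable[OF b(1) node_mono b(5)] P]
  show "L2_measurable M (F (node N n)) L (\<lambda>\<omega>. B (u \<omega>) - wgrad L (\<xi> \<omega>))"
    by (rule rule(1)) (use sign in \<open>auto simp: mixed_step_def intro: Hper1D(1)\<close>)
  show "L2_measurable M (F (node N (Suc n))) L u'"
    by (rule rule(2)) (use sign in \<open>auto simp: mixed_step_def intro: Hper1D(1)\<close>)
qed

section \<open>Adaptedness along the schemes and the recursion for the mean square error\<close>

lemma algorithm1_adapted:
  assumes N: "1 \<le> N" and alg: "algorithm1 M L T W u0 f B N u r" and n: "n \<le> N"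
  shows "L2_measurable M (F (node N n)) L (u n)"
  using n
proof (induction n)
  case 0
  then show ?case using initial_adapted algorithm1D(1)[OF N alg] by (simp add: node_def)
next
  case (Suc n)
  then have n: "n < N" and IH: "L2_measurable M (F (node N n)) L (u n)" by auto
  obtain \<xi> where "AE \<omega> in M. scheme_step N n u r \<xi> \<omega>
      \<and> exact_divergence L (u n \<omega>) \<and> exact_divergence L (u (Suc n) \<omega>)"
    using algorithm1D(4)[OF N alg n] by blast
  from mixed_step_adapted(2)[OF N n this _ IH] show ?case
    using exact_divergence_sign[OF L] by blast
qed

lemma algorithm3_adapted:
  assumes N: "1 \<le> N" and \<epsilon>: "0 < \<epsilon>" and alg: "algorithm3 M L T W u0 f B N \<epsilon> u r" and n: "n \<le> N"
  shows "L2_measurable M (F (node N n)) L (u n)"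
  using n
proof (induction n)
  case 0
  then show ?case using initial_adapted algorithm3D(1)[OF N alg] by (simp add: node_def)
next
  case (Suc n)
  then have n: "n < N" and IH: "L2_measurable M (F (node N n)) L (u n)" by auto
  obtain \<xi> where "AE \<omega> in M. scheme_step N n u r \<xi> \<omega>
      \<and> penalized_divergence L \<epsilon> (u (Suc n) \<omega>) (r (Suc n) \<omega>)"
    using algorithm3D(4)[OF N alg n] by blast
  from mixed_step_adapted(2)[OF N n this _ IH] show ?case
    using penalized_divergence_sign[OF L \<epsilon>] by blast
qed

lemma error_energy:
  fixes v w :: "'a \<Rightarrow> real^'d \<Rightarrow> real^'d"
  assumes G: "subalgebra M G"
    and v: "L2_measurable M G L v" "(\<integral>\<^sup>+\<omega>. ennreal ((L2norm L (v \<omega>))\<^sup>2) \<partial>M) < \<infinity>"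
    and w: "L2_measurable M G L w" "(\<integral>\<^sup>+\<omega>. ennreal ((L2norm L (w \<omega>))\<^sup>2) \<partial>M) < \<infinity>"
  obtains Y where "AE \<omega> in M. Y \<omega> = (L2norm L (v \<omega> - w \<omega>))\<^sup>2" "integrable M Y"
proof -
  obtain Y where Y: "Y \<in> borel_measurable G" "AE \<omega> in M. Y \<omega> = (L2norm L (v \<omega> - w \<omega>))\<^sup>2"
    using strongly_measurable_L2inner[OF G strongly_measurable_diff[OF G v(1) w(1)] strongly_measurable_diff[OF G v(1) w(1)]]
    unfolding L2norm_sq by blast
  obtain V where V: "AE \<omega> in M. V \<omega> = (L2norm L (v \<omega>))\<^sup>2" "integrable M V"
    using L2Omega_integrable_L2norm[OF G v order_refl] by blast
  obtain U where U: "AE \<omega> in M. U \<omega> = (L2norm L (w \<omega>))\<^sup>2" "integrable M U"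
    using L2Omega_integrable_L2norm[OF G w order_refl] by blast
  have mem: "AE \<omega> in M. v \<omega> \<in> L2per L" "AE \<omega> in M. w \<omega> \<in> L2per L"
    using v w by (auto simp: strongly_measurable_def)
  have "integrable M Y"
  proof (rule Bochner_Integration.integrable_bound)
    show "integrable M (\<lambda>\<omega>. 2 * V \<omega> + 2 * U \<omega>)" using V U by simp
    show "Y \<in> borel_measurable M" by (rule measurable_from_subalg[OF G Y(1)])
    show "AE \<omega> in M. norm (Y \<omega>) \<le> norm (2 * V \<omega> + 2 * U \<omega>)"
      using Y(2) V(1) U(1) mem
      by eventually_elim (simp add: L2norm_sq_diff_le)
  qed
  with Y show ?thesis by (intro that)
qed

text \<open>The Lipschitz bound of \<open>B\<close>, the contraction by the projection and the
  variance of the increment turn the quadratic noise term into \<open>T / real N * C^2\<close> times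
  the old energy. \<open>Y0\<close> and \<open>Y1\<close> are integrable versions of the error
  energies.\<close>

lemma error_recursion:
  assumes N: "1 \<le> N" and \<epsilon>: "0 < \<epsilon>" and n: "n < N"
    and alg1: "algorithm1 M L T W u0 f B N u r"
    and alg3: "algorithm3 M L T W u0 f B N \<epsilon> ue re"
    and Y0: "AE \<omega> in M. Y0 \<omega> = (L2norm L (u n \<omega> - ue n \<omega>))\<^sup>2" "integrable M Y0"
    and Y1: "AE \<omega> in M. Y1 \<omega> = (L2norm L (u (Suc n) \<omega> - ue (Suc n) \<omega>))\<^sup>2" "integrable M Y1"
  shows "ennreal (T / real N) * (\<integral>\<^sup>+\<omega>. grad_normsq L (u (Suc n) \<omega> - ue (Suc n) \<omega>)
        + ennreal \<epsilon> * grad_normsq L (r (Suc n) \<omega> - re (Suc n) \<omega>) \<partial>M)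
      \<le> ennreal (expectation Y0 - expectation Y1 + T / real N * \<epsilon> * forcing_bound + T / real N * C\<^sup>2 * expectation Y0)"
    and "0 \<le> expectation Y0 - expectation Y1 + T / real N * \<epsilon> * forcing_bound + T / real N * C\<^sup>2 * expectation Y0"
proof -
  define k where "k = T / real N"
  have k: "0 < k" using T N by (simp add: k_def)
  note b = node_bounds[OF N less_imp_le[OF n]] node_bounds[OF N Suc_leI[OF n]]
  note G = F_subalgebra[OF b(3)]
  obtain \<xi> where P1: "AE \<omega> in M. scheme_step N n u r \<xi> \<omega>
      \<and> exact_divergence L (u n \<omega>) \<and> exact_divergence L (u (Suc n) \<omega>)"
    using algorithm1D(4)[OF N alg1 n] by blast
  obtain \<xi>e where P3: "AE \<omega> in M. scheme_step N n ue re \<xi>e \<omega>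
      \<and> penalized_divergence L \<epsilon> (ue (Suc n) \<omega>) (re (Suc n) \<omega>)"
    using algorithm3D(4)[OF N alg3 n] by blast
  note u = algorithm1_adapted[OF N alg1 less_imp_le[OF n]]
  note ue = algorithm3_adapted[OF N \<epsilon> alg3 less_imp_le[OF n]]
  define \<eta> where "\<eta> \<omega> = B (u n \<omega>) - wgrad L (\<xi> \<omega>)" for \<omega>
  define \<eta>e where "\<eta>e \<omega> = B (ue n \<omega>) - wgrad L (\<xi>e \<omega>)" for \<omega>
  have \<eta>: "L2_measurable M (F (node N n)) L \<eta>"
    unfolding \<eta>_def[abs_def]
    using mixed_step_adapted(1)[OF N n P1 _ u] exact_divergence_sign[OF L] by blast
  have \<eta>e: "L2_measurable M (F (node N n)) L \<eta>e"
    unfolding \<eta>e_def[abs_def]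
    using mixed_step_adapted(1)[OF N n P3 _ ue] penalized_divergence_sign[OF L \<epsilon>] by blast
  note h = strongly_measurable_diff[OF G \<eta> \<eta>e] and e = strongly_measurable_diff[OF G u ue]
  obtain Z where Z: "Z \<in> borel_measurable (F (node N n))"
    "AE \<omega> in M. Z \<omega> = (L2norm L (\<eta> \<omega> - \<eta>e \<omega>))\<^sup>2"
    using strongly_measurable_L2inner[OF G h h] unfolding L2norm_sq by blast
  obtain I where I: "I \<in> borel_measurable (F (node N n))"
    "AE \<omega> in M. I \<omega> = L2inner L (\<eta> \<omega> - \<eta>e \<omega>) (u n \<omega> - ue n \<omega>)"
    using strongly_measurable_L2inner[OF G h e] by blast
  obtain \<Phi> where \<Phi>: "AE \<omega> in M. \<Phi> \<omega> = (L2norm L (f \<omega> (node N (Suc n))))\<^sup>2" "integrable M \<Phi>"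
    "expectation \<Phi> \<le> forcing_bound"
    by (rule forcing_energy[OF b(6)])
  have mem: "AE \<omega> in M. u n \<omega> - ue n \<omega> \<in> L2per L" "AE \<omega> in M. \<eta> \<omega> - \<eta>e \<omega> \<in> L2per L"
    using h e by (auto simp: strongly_measurable_def)
  have "node N n < node N (Suc n)" using k by (simp add: node_Suc k_def)
  note D = increment_distribution[OF b(1) this b(5)]
  have dist: "distributed M lborel (increment N n) (normal_density 0 (sqrt k))"
    using D(1) by (simp add: node_Suc k_def)
  have Zle: "AE \<omega> in M. 0 \<le> Z \<omega> \<and> Z \<omega> \<le> C\<^sup>2 * Y0 \<omega>"
    using Z(2) Y0(1) P1 P3
  proof eventually_elim
    case (elim \<omega>)
    have "L2norm L (\<eta> \<omega> - \<eta>e \<omega>) \<le> L2norm L (B (u n \<omega>) - B (ue n \<omega>))"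
      unfolding \<eta>_def \<eta>e_def using pathwise_error_step(3)[OF L k \<epsilon>, of "u n \<omega>" "u (Suc n) \<omega>"] elim[folded k_def] by blast
    also have "\<dots> \<le> C * L2norm L (u n \<omega> - ue n \<omega>)"
      using elim by (intro B_Lipschitz) (auto simp: mixed_step_def intro: Hper1D(1))
    finally have "(L2norm L (\<eta> \<omega> - \<eta>e \<omega>))\<^sup>2 \<le> (C * L2norm L (u n \<omega> - ue n \<omega>))\<^sup>2"
      by (intro power_mono) auto
    then show ?case using elim by (simp add: power_mult_distrib)
  qed
  \<comment> \<open>This bound serves only to make \<open>I\<close> integrable; the product of
    \<open>I\<close> with the increment drops out in the mean.\<close>
  have Ile: "AE \<omega> in M. \<bar>I \<omega>\<bar> \<le> Z \<omega> + Y0 \<omega>"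
    using Z(2) I(2) Y0(1) mem
  proof eventually_elim
    case (elim \<omega>)
    define p q where "p = L2norm L (\<eta> \<omega> - \<eta>e \<omega>)" and "q = L2norm L (u n \<omega> - ue n \<omega>)"
    have "\<bar>I \<omega>\<bar> \<le> p * q" unfolding elim(2) p_def q_def by (rule L2_Cauchy_Schwarz[OF elim(5,4)])
    moreover have "2 * (p * q) \<le> p\<^sup>2 + q\<^sup>2" using sum_squares_bound[of p q] by simp
    moreover have "0 \<le> p * q" by (simp add: p_def q_def)
    ultimately show ?case using elim(1,3) unfolding p_def[symmetric] q_def[symmetric] by linarith
  qed
  let ?H = "\<lambda>\<omega>. Y0 \<omega> - Y1 \<omega> + k * \<epsilon> * \<Phi> \<omega> + (increment N n \<omega>)\<^sup>2 * Z \<omega> + 2 * (increment N n \<omega> * I \<omega>)"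
  let ?b = "\<lambda>\<omega>. grad_normsq L (u (Suc n) \<omega> - ue (Suc n) \<omega>) + ennreal \<epsilon> * grad_normsq L (r (Suc n) \<omega> - re (Suc n) \<omega>)"
  have bH: "AE \<omega> in M. 0 \<le> ?H \<omega> \<and> ?b \<omega> \<le> ennreal (?H \<omega> / k)"
    using Z(2) I(2) Y0(1) Y1(1) \<Phi>(1) P1 P3
  proof eventually_elim
    case (elim \<omega>)
    note s = conjunct1[OF elim(6), folded k_def] conjunct1[OF conjunct2[OF elim(6)]] conjunct2[OF conjunct2[OF elim(6)]]
      conjunct1[OF elim(7), folded k_def] conjunct2[OF elim(7)]
    show ?case
      using pathwise_error_step(1,2)[OF L k \<epsilon> s] unfolding elim(1-5) \<eta>_def \<eta>e_def by blast
  qed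
  have "AE \<omega> in M. ?b \<omega> \<le> ennreal (?H \<omega> / k)" "AE \<omega> in M. 0 \<le> ?H \<omega>"
    using bH by (auto elim: eventually_mono)
  note * = expected_error_step[OF G k \<epsilon> dist D(2) Z(1) I(1) Y0(2) Y1(2) \<Phi>(2) Zle Ile \<Phi>(3) this]
  show "ennreal (T / real N) * (\<integral>\<^sup>+\<omega>. ?b \<omega> \<partial>M)
      \<le> ennreal (expectation Y0 - expectation Y1 + T / real N * \<epsilon> * forcing_bound + T / real N * C\<^sup>2 * expectation Y0)"
    using *(1) unfolding k_def .
  show "0 \<le> expectation Y0 - expectation Y1 + T / real N * \<epsilon> * forcing_bound + T / real N * C\<^sup>2 * expectation Y0"
    using *(2) unfolding k_def .
qed

text \<open>The factor 2 arises because the maximum and the weighted sum are each bounded by the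
  same quantity \<open>S\<close>.\<close>

theorem penalization_error:
  assumes N: "1 \<le> N" and \<epsilon>: "0 < \<epsilon>"
    and alg1: "algorithm1 M L T W u0 f B N u r"
    and alg3: "algorithm3 M L T W u0 f B N \<epsilon> ue re"
  shows "(MAX n\<in>{1..N}. \<integral>\<^sup>+\<omega>. normsq L (u n \<omega> - ue n \<omega>) \<partial>M)
      + ennreal (T / real N) *
        (\<Sum>n=1..N. \<integral>\<^sup>+\<omega>. grad_normsq L (u n \<omega> - ue n \<omega>)
                          + ennreal \<epsilon> * grad_normsq L (r n \<omega> - re n \<omega>) \<partial>M)
    \<le> ennreal (2 * (exp (C\<^sup>2 * T) * (T * forcing_bound)) * \<epsilon>)"
proof -
  define k where "k = T / real N"
  have k: "0 < k" using T N by (simp add: k_def)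
  have "\<exists>Y. (AE \<omega> in M. Y \<omega> = (L2norm L (u n \<omega> - ue n \<omega>))\<^sup>2) \<and> integrable M Y" if n: "n \<le> N" for n
    using error_energy[OF F_subalgebra[OF node_bounds(3)[OF N n]] algorithm1_adapted[OF N alg1 n]
        algorithm1D(3)[OF N alg1 n] algorithm3_adapted[OF N \<epsilon> alg3 n] algorithm3D(3)[OF N alg3 n]] by blast
  then have "\<forall>n. \<exists>Y. n \<le> N \<longrightarrow> (AE \<omega> in M. Y \<omega> = (L2norm L (u n \<omega> - ue n \<omega>))\<^sup>2) \<and> integrable M Y"
    by blast
  then obtain Y where "\<forall>n\<le>N. (AE \<omega> in M. Y n \<omega> = (L2norm L (u n \<omega> - ue n \<omega>))\<^sup>2) \<and> integrable M (Y n)"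
    unfolding choice_iff by blast
  then have Y: "\<And>n. n \<le> N \<Longrightarrow> AE \<omega> in M. Y n \<omega> = (L2norm L (u n \<omega> - ue n \<omega>))\<^sup>2"
    "\<And>n. n \<le> N \<Longrightarrow> integrable M (Y n)" by blast+
  define a where "a n = expectation (Y n)" for n
  \<comment> \<open>The upper bound of the recursion itself rather than the gradient energy, so that
    the Gronwall lemma receives an equation between finite reals.\<close>
  define d where "d n = a n - a (Suc n) + k * \<epsilon> * forcing_bound + k * C\<^sup>2 * a n" for n
  \<comment> \<open>Gronwall with \<open>\<kappa> = k * C^2\<close> and
    \<open>q = k * \<epsilon> * forcing_bound\<close>, over \<open>n\<close> steps with
    \<open>n * k\<close> at most \<open>T\<close>.\<close>
  define S where "S = exp (C\<^sup>2 * T) * (T * forcing_bound) * \<epsilon>"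
  have a_nn: "0 \<le> a n" if "n \<le> N" for n
    unfolding a_def using Y(1)[OF that] by (intro integral_nonneg_AE) (auto elim: eventually_mono)
  have "AE \<omega> in M. Y 0 \<omega> = 0"
    using Y(1)[OF le0] by eventually_elim (simp add: algorithm1D(1)[OF N alg1] algorithm3D(1)[OF N alg3] fun_diff_def)
  then have a0: "a 0 = 0" unfolding a_def by (rule integral_eq_zero_AE)
  have rec: "ennreal k * (\<integral>\<^sup>+\<omega>. grad_normsq L (u (Suc n) \<omega> - ue (Suc n) \<omega>)
        + ennreal \<epsilon> * grad_normsq L (r (Suc n) \<omega> - re (Suc n) \<omega>) \<partial>M) \<le> ennreal (d n)" "0 \<le> d n" if n: "n < N" for n
    using error_recursion[OF N \<epsilon> n alg1 alg3 Y(1)[OF less_imp_le[OF n]] Y(2)[OF less_imp_le[OF n]]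
        Y(1)[OF Suc_leI[OF n]] Y(2)[OF Suc_leI[OF n]]]
    unfolding d_def a_def k_def by blast+
  have fb: "0 \<le> forcing_bound" by (simp add: forcing_bound_def)
  have bound: "a n + (\<Sum>j<n. d j) \<le> S" if n: "n \<le> N" for n
  proof -
    have nk: "real n * k \<le> T" using n N T mult_right_mono[of "real n" "real N" k] k by (simp add: k_def)
    have "a n + (\<Sum>j<n. d j) \<le> exp (real n * (k * C\<^sup>2)) * (real n * (k * \<epsilon> * forcing_bound))"
      using rec(2) n k \<epsilon> fb a0 by (intro discrete_Gronwall[where a=a and d=d and N=N]) (auto simp: d_def)
    also have "\<dots> = exp (real n * k * C\<^sup>2) * (real n * k * (\<epsilon> * forcing_bound))" by (simp add: mult.assoc)
    also have "\<dots> \<le> exp (T * C\<^sup>2) * (T * (\<epsilon> * forcing_bound))"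
      using nk fb \<epsilon> T k by (intro mult_mono mult_right_mono) (auto intro: mult_right_mono)
    also have "\<dots> = S" by (simp add: S_def mult.commute mult.left_commute)
    finally show ?thesis .
  qed
  have sum_nn: "0 \<le> (\<Sum>j<n. d j)" if "n \<le> N" for n using rec(2) that by (intro sum_nonneg) auto
  have "(\<integral>\<^sup>+\<omega>. normsq L (u n \<omega> - ue n \<omega>) \<partial>M) \<le> ennreal S" if n: "n \<in> {1..N}" for n
  proof -
    have n': "n \<le> N" using n by simp
    have "(\<integral>\<^sup>+\<omega>. normsq L (u n \<omega> - ue n \<omega>) \<partial>M) = (\<integral>\<^sup>+\<omega>. ennreal (Y n \<omega>) \<partial>M)"
    proof (rule nn_integral_cong_AE)
      show "AE \<omega> in M. normsq L (u n \<omega> - ue n \<omega>) = ennreal (Y n \<omega>)"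
        using Y(1)[OF n'] algorithm1D(2)[OF N alg1 n'] algorithm3D(2)[OF N alg3 n']
      proof eventually_elim
        case (elim \<omega>)
        have "u n \<omega> - ue n \<omega> \<in> L2per L"
          using elim Hper1D(1) by (blast intro: L2per_diff')
        then show ?case using elim(1) by (simp add: normsq_eq)
      qed
    qed
    also have "\<dots> = ennreal (a n)"
      unfolding a_def using Y(1)[OF n'] by (intro nn_integral_eq_integral Y(2)[OF n']) (auto elim: eventually_mono)
    also have "\<dots> \<le> ennreal S" using bound[OF n'] sum_nn[OF n'] by (intro ennreal_leI) linarith
    finally show ?thesis .
  qed
  then have max: "(MAX n\<in>{1..N}. \<integral>\<^sup>+\<omega>. normsq L (u n \<omega> - ue n \<omega>) \<partial>M) \<le> ennreal S"
    using N by (subst Max_le_iff) auto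
  have "ennreal k * (\<Sum>n=1..N. \<integral>\<^sup>+\<omega>. grad_normsq L (u n \<omega> - ue n \<omega>)
        + ennreal \<epsilon> * grad_normsq L (r n \<omega> - re n \<omega>) \<partial>M)
      = (\<Sum>n<N. ennreal k * (\<integral>\<^sup>+\<omega>. grad_normsq L (u (Suc n) \<omega> - ue (Suc n) \<omega>)
        + ennreal \<epsilon> * grad_normsq L (r (Suc n) \<omega> - re (Suc n) \<omega>) \<partial>M))"
    unfolding sum_distrib_left by (rule sum.reindex_bij_witness[where i=Suc and j="\<lambda>n. n - 1"]) auto
  also have "\<dots> \<le> (\<Sum>n<N. ennreal (d n))" using rec(1) by (intro sum_mono) auto
  also have "\<dots> = ennreal (\<Sum>n<N. d n)" using rec(2) by (intro sum_ennreal) auto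
  also have "\<dots> \<le> ennreal S" using bound[OF order_refl] a_nn[OF order_refl] by (intro ennreal_leI) linarith
  finally have sum: "ennreal k * (\<Sum>n=1..N. \<integral>\<^sup>+\<omega>. grad_normsq L (u n \<omega> - ue n \<omega>)
        + ennreal \<epsilon> * grad_normsq L (r n \<omega> - re n \<omega>) \<partial>M) \<le> ennreal S" .
  have "0 \<le> S" unfolding S_def using fb T \<epsilon> by simp
  moreover have "2 * (exp (C\<^sup>2 * T) * (T * forcing_bound)) * \<epsilon> = S + S" by (simp add: S_def)
  ultimately have "ennreal S + ennreal S = ennreal (2 * (exp (C\<^sup>2 * T) * (T * forcing_bound)) * \<epsilon>)"
    by (simp only: ennreal_plus)
  then show ?thesis using add_mono[OF max sum] unfolding k_def by simp
qed

end

theorem theorem5p2: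
  fixes M :: "'a measure" and F :: "real \<Rightarrow> 'a measure" and W :: "real \<Rightarrow> 'a \<Rightarrow> real"
    and L T :: real
    and u0 :: "'a \<Rightarrow> real^'d \<Rightarrow> real^'d"
    and f :: "'a \<Rightarrow> real \<Rightarrow> real^'d \<Rightarrow> real^'d"
    and B :: "(real^'d \<Rightarrow> real^'d) \<Rightarrow> (real^'d \<Rightarrow> real^'d)"
  assumes "CARD('d) \<in> {2, 3}" and "0 < L" and "0 < T"
    and "prob_space M" and "continuous_filtration M T F" and "wiener_process M T F W"
    and "initial_datum M F L u0" and "forcing M F L T f" and "noise_operator M L B"
  shows "\<exists>C>0. \<forall>(N::nat) \<epsilon> u r u\<epsilon> r\<epsilon>.
    1 \<le> N \<longrightarrow> 0 < \<epsilon> \<longrightarrow> \<epsilon> < 1 \<longrightarrow>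
    algorithm1 M L T W u0 f B N u r \<longrightarrow>
    algorithm3 M L T W u0 f B N \<epsilon> u\<epsilon> r\<epsilon> \<longrightarrow>
    (MAX n\<in>{1..N}. \<integral>\<^sup>+\<omega>. normsq L (u n \<omega> - u\<epsilon> n \<omega>) \<partial>M)
      + ennreal (T / real N) *
        (\<Sum>n=1..N. \<integral>\<^sup>+\<omega>. grad_normsq L (u n \<omega> - u\<epsilon> n \<omega>)
                          + ennreal \<epsilon> * grad_normsq L (r n \<omega> - r\<epsilon> n \<omega>) \<partial>M)
    \<le> ennreal (C * \<epsilon>)"
proof -
  obtain C where C: "0 < C" "\<And>v. v \<in> L2per L \<Longrightarrow> B v \<in> L2per L"
    "\<And>v w. v \<in> L2per L \<Longrightarrow> w \<in> L2per L \<Longrightarrow> L2norm L (B v - B w) \<le> C * L2norm L (v - w)"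
    using assms(9) unfolding noise_operator_def by blast
  interpret prob_space M by (rule assms(4))
  interpret stochastic_Stokes_data M F W L T C u0 f B
    by unfold_locales (use assms C in auto)
  define K where "K = 2 * (exp (C\<^sup>2 * T) * (T * forcing_bound))"
  have "0 \<le> K" using assms(3) by (simp add: K_def forcing_bound_def)
  show ?thesis
  \<comment> \<open>\<open>K\<close> is zero when \<open>forcing_bound\<close> is zero, while the
    constant has to be positive.\<close>
  proof (intro exI[of _ "K + 1"] conjI allI impI)
    fix N :: nat and \<epsilon> u r u\<epsilon> r\<epsilon>
    assume a: "1 \<le> N" "0 < \<epsilon>" "algorithm1 M L T W u0 f B N u r" "algorithm3 M L T W u0 f B N \<epsilon> u\<epsilon> r\<epsilon>"
    have "ennreal (K * \<epsilon>) \<le> ennreal ((K + 1) * \<epsilon>)" using a(2) by (intro ennreal_leI) (simp add: distrib_right)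
    with penalization_error[OF a] show "(MAX n\<in>{1..N}. \<integral>\<^sup>+\<omega>. normsq L (u n \<omega> - u\<epsilon> n \<omega>) \<partial>M)
      + ennreal (T / real N) *
        (\<Sum>n=1..N. \<integral>\<^sup>+\<omega>. grad_normsq L (u n \<omega> - u\<epsilon> n \<omega>)
                          + ennreal \<epsilon> * grad_normsq L (r n \<omega> - r\<epsilon> n \<omega>) \<partial>M)
      \<le> ennreal ((K + 1) * \<epsilon>)"
      unfolding K_def by (rule order_trans)
  qed (use \<open>0 \<le> K\<close> in simp)
qed

end
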